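(* Let $g_1,\dots,g_m\in\operatorname{Sym}\mathbb R\langle\mathbf q,\bar{\mathbf q}\rangle$ and $h_1,\dots,h_\ell\in\mathbb R\langle\mathbf q,\bar{\mathbf q}\rangle$. Assume the Archimedean condition: there exists $R>0$ with $R-\sum_{i=1}^n|q_i|^2\in\mathcal Q^{\mathbb H}(\mathbf g,\mathbf h)$. Let $\mathbf y=(y_w)_{w\in\mathcal W}$ be a full quaternion-valued quaternionic pseudo-moment sequence. Then $\mathbf y$ has a positive Borel representing measure supported on $K_{\mathbf g,\mathbf h}$ if and only if $$\begin{aligned}\mathbf M_d(\mathbf y)&\succeq0&&(d\ge0),\\ \mathbf M_d(g_i\mathbf y)&\succeq0&&(d\ge0,\ i=1,\dots,m),\\ L_{\mathbf y}(uh_jv)&=0&&(u,v\in\mathcal W,\ j=1,\dots,\ell),\\ L_{\mathbf y}(u[w+w^*,q_i]v)&=0&&(u,v,w\in\mathcal W,\ i=1,\dots,n).\end{aligned}$$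
   Context: $\mathbb H$ is the skew field of quaternions, $\mathcal R(a)$ the real part of $a\in\mathbb H$. Fix $n\ge1$ and letters $q_1,\dots,q_n,\bar q_1,\dots,\bar q_n$. $\mathcal W$ is the set of words (including the empty word $1$) in these letters, where words with the same normal form are identified: any consecutive factor $q_i\bar q_i$ or $\bar q_iq_i$ is written $|q_i|^2$ and moved to the front, so each word is uniquely $\prod_i|q_i|^{2\alpha_i}\tilde w$ with $\tilde w$ containing no such factor. $|w|$ is the length and $\mathcal W_d$ the family of words of length at most $d$. $w^*$ is obtained by reversing $w$ and exchanging $q_i\leftrightarrow\bar q_i$. $\mathbb R\langle\mathbf q,\bar{\mathbf q}\rangle$ is the real $*$-algebra of finite sums $\sum_wp_ww$, $p_w\in\mathbb R$, with $p^*=\sum_wp_ww^*$. $\mathbb H\langle\mathbf q,\bar{\mathbf q}\rangle$ is the real free product of $\mathbb H$ (involution: conjugation) and $\mathbb R\langle\mathbf q,\bar{\mathbf q}\rangle$; constants do not commute with letters. $\mathcal L\subset\mathbb H\langle\mathbf q,\bar{\mathbf q}\rangle$ is the space of finite sums $\sum_wp_ww$, $p_w\in\mathbb H$. $\operatorname{Sym}$ denotes elements with $p=p^*$; $[a,b]$ is the commutator. $K_{\mathbf g,\mathbf h}=\{\mathbf a\in\mathbb H^n: g_i(\mathbf a,\bar{\mathbf a})\ge0\ (1\le i\le m),\ h_j(\mathbf a,\bar{\mathbf a})=0\ (1\le j\le\ell)\}$, evaluation being $q_i\mapsto a_i$, $\bar q_i\mapsto\bar a_i$. $\Sigma^{\mathbb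 H}$ is the set of finite sums $\sum_sp_s^*p_s$, $p_s\in\mathcal L$. $\mathcal Q^{\mathbb H}(\mathbf g,\mathbf h)$ is the set of all finite expressions $\sigma_0+\tfrac12\sum_i(\sigma_ig_i+g_i\sigma_i)+\sum_j\sum_\alpha(\tau_{j\alpha}h_j\nu_{j\alpha}^*+\nu_{j\alpha}h_j^*\tau_{j\alpha}^* )$ with $\sigma_i\in\Sigma^{\mathbb H}$, $\tau_{j\alpha},\nu_{j\alpha}\in\mathcal L$. Words $u,v$ are cyclically equivalent, $u\stackrel{\mathrm{cyc}}{\sim}v$, if $u=w_1w_2$, $v=w_2w_1$ for some words. A sequence $\mathbf y=(y_w)_{w\in\mathcal W}$ in $\mathbb H$ is a quaternionic pseudo-moment sequence if $y_w=\overline{y_{w^*}}$ for all $w$ and $\mathcal R(y_u)=\mathcal R(y_v)$ whenever $u\stackrel{\mathrm{cyc}}{\sim}v$. For $p=\sum_wp_ww\in\mathbb R\langle\mathbf q,\bar{\mathbf q}\rangle$ put $L_{\mathbf y}(p)=\sum_wp_wy_w\in\mathbb H$. A positive Borel measure $\mu$ supported on $K_{\mathbf g,\mathbf h}$ represents $\mathbf y$ if $y_w=\int w(\mathbf a,\bar{\mathbf a})\,d\mu(\mathbf a)$ for all $w$ (componentwise). Moment and localizing matrices: $[\mathbf M_d(\mathbf y)]_{u,v}=L_{\mathbf y}(u^*v)=y_{u^*v}$ and, for $g\in\operatorname{Sym}\mathbb R\langle\mathbf q,\bar{\mathbf q}\rangle$, $[\mathbf M_d(g\mathbf y)]_{u,v}=L_{\mathbf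 y}(u^*gv)$, $u,v\in\mathcal W_d$. These are Hermitian quaternionic matrices; $A\succeq0$ means $\mathbf v^*A\mathbf v\ge0$ for all quaternionic vectors $\mathbf v$. *)

theory Defs
  imports "HOL-Analysis.Analysis" "HOL-Analysis.Finite_Function_Topology" "HOL-Library.Nonpos_Ints"
begin

section \<open>Involutions\<close>

class star =
  fixes star :: "'a \<Rightarrow> 'a"

class star_algebra = real_algebra_1 + star +
  assumes star_star [simp]: "star (star x) = x"
    and star_add [simp]: "star (x + y) = star x + star y"
    and star_mult [simp]: "star (x * y) = star y * star x"
    and star_scaleR [simp]: "star (r *\<^sub>R x) = r *\<^sub>R star x"
begin

lemma star_zero [simp]: "star 0 = 0"
  using star_add[of 0 0] by (simp del: star_add)

lemma star_one [simp]: "star 1 = 1"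
  using star_mult[of "star 1" 1] by simp

lemma star_sum: "star (sum f A) = (\<Sum>x\<in>A. star (f x))"
  by (induction A rule: infinite_finite_induct) auto

end

instantiation real :: star_algebra
begin
definition star_real :: "real \<Rightarrow> real" where [simp]: "star_real x = x"
instance by standard auto
end

text \<open>Monoids with an involution, written additively because the type \<^typ>\<open>'a \<Rightarrow>\<^sub>0 'b\<close> of
  \<^theory>\<open>HOL-Library.Poly_Mapping\<close> is the monoid algebra of an additive, possibly
  non-commutative, monoid.\<close>

class star_monoid = monoid_add + star +
  assumes star_monoid_star [simp]: "star (star x) = x"
    and star_monoid_add: "star (x + y) = star y + star x"


section \<open>Quaternions\<close>

datatype quat = Quat (Qre: real) (Qi: real) (Qj: real) (Qk: real)

lemma quat_eqI: "Qre x = Qre y \<Longrightarrow> Qi x = Qi y \<Longrightarrow> Qj x = Qj y \<Longrightarrow> Qk x = Qk y \<Longrightarrow> x = y"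
  by (cases x; cases y) simp

lemma quat_eq_iff: "x = y \<longleftrightarrow> Qre x = Qre y \<and> Qi x = Qi y \<and> Qj x = Qj y \<and> Qk x = Qk y"
  by (auto intro: quat_eqI)

instantiation quat :: real_algebra_1
begin

definition "0 = Quat 0 0 0 0"
definition "1 = Quat 1 0 0 0"
definition "x + y = Quat (Qre x + Qre y) (Qi x + Qi y) (Qj x + Qj y) (Qk x + Qk y)"
definition "- x = Quat (- Qre x) (- Qi x) (- Qj x) (- Qk x)"
definition "x - y = Quat (Qre x - Qre y) (Qi x - Qi y) (Qj x - Qj y) (Qk x - Qk y)"
definition "r *\<^sub>R x = Quat (r * Qre x) (r * Qi x) (r * Qj x) (r * Qk x)"
definition "x * y = Quat
  (Qre x * Qre y - Qi x * Qi y - Qj x * Qj y - Qk x * Qk y)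
  (Qre x * Qi y + Qi x * Qre y + Qj x * Qk y - Qk x * Qj y)
  (Qre x * Qj y - Qi x * Qk y + Qj x * Qre y + Qk x * Qi y)
  (Qre x * Qk y + Qi x * Qj y - Qj x * Qi y + Qk x * Qre y)"

instance
  by standard
    (simp_all add: quat_eq_iff zero_quat_def one_quat_def plus_quat_def uminus_quat_def
      minus_quat_def scaleR_quat_def times_quat_def algebra_simps)

end

lemma quat_sel [simp]:
  "Qre 0 = 0" "Qi 0 = 0" "Qj 0 = 0" "Qk 0 = 0"
  "Qre 1 = 1" "Qi 1 = 0" "Qj 1 = 0" "Qk 1 = 0"
  "Qre (x + y) = Qre x + Qre y" "Qi (x + y) = Qi x + Qi y"
  "Qj (x + y) = Qj x + Qj y" "Qk (x + y) = Qk x + Qk y"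
  "Qre (- x) = - Qre x" "Qi (- x) = - Qi x" "Qj (- x) = - Qj x" "Qk (- x) = - Qk x"
  "Qre (x - y) = Qre x - Qre y" "Qi (x - y) = Qi x - Qi y"
  "Qj (x - y) = Qj x - Qj y" "Qk (x - y) = Qk x - Qk y"
  "Qre (r *\<^sub>R x) = r * Qre x" "Qi (r *\<^sub>R x) = r * Qi x"
  "Qj (r *\<^sub>R x) = r * Qj x" "Qk (r *\<^sub>R x) = r * Qk x"
  by (simp_all add: zero_quat_def one_quat_def plus_quat_def uminus_quat_def
      minus_quat_def scaleR_quat_def)

lemma quat_sel_mult:
  "Qre (x * y) = Qre x * Qre y - Qi x * Qi y - Qj x * Qj y - Qk x * Qk y"
  "Qi (x * y) = Qre x * Qi y + Qi x * Qre y + Qj x * Qk y - Qk x * Qj y"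
  "Qj (x * y) = Qre x * Qj y - Qi x * Qk y + Qj x * Qre y + Qk x * Qi y"
  "Qk (x * y) = Qre x * Qk y + Qi x * Qj y - Qj x * Qi y + Qk x * Qre y"
  by (simp_all add: times_quat_def)

lemma quat_sel_of_real [simp]:
  "Qre (of_real r) = r" "Qi (of_real r) = 0" "Qj (of_real r) = 0" "Qk (of_real r) = 0"
  by (simp_all add: of_real_def)

instantiation quat :: star_algebra
begin

definition star_quat :: "quat \<Rightarrow> quat"
  where "star_quat x = Quat (Qre x) (- Qi x) (- Qj x) (- Qk x)"

instance
  by standard (simp_all add: star_quat_def quat_eq_iff quat_sel_mult algebra_simps)

end

lemma quat_sel_star [simp]:
  "Qre (star x) = Qre x" "Qi (star x) = - Qi x" "Qj (star x) = - Qj x" "Qk (star x) = - Qk x"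
  by (simp_all add: star_quat_def)

instantiation quat :: real_inner
begin

definition inner_quat_def: "inner x y = Qre x * Qre y + Qi x * Qi y + Qj x * Qj y + Qk x * Qk y"

definition norm_quat_def: "norm (x::quat) = sqrt (inner x x)"

definition sgn_quat_def: "sgn (x::quat) = x /\<^sub>R norm x"

definition dist_quat_def: "dist (x::quat) y = norm (x - y)"

definition uniformity_quat_def:
  "(uniformity :: (quat \<times> quat) filter) = (INF e\<in>{0 <..}. principal {(x, y). dist x y < e})"

definition open_quat_def:
  "open (U :: quat set) \<longleftrightarrow> (\<forall>x\<in>U. eventually (\<lambda>(x', y). x' = x \<longrightarrow> y \<in> U) uniformity)"

instance
proof
  fix x y z :: quat and r :: real
  show "inner x x = 0 \<longleftrightarrow> x = 0"
  proof
    assume "inner x x = 0"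
    then have "(Qre x)\<^sup>2 + (Qi x)\<^sup>2 + (Qj x)\<^sup>2 + (Qk x)\<^sup>2 = 0"
      by (simp add: inner_quat_def power2_eq_square)
    then show "x = 0"
      by (simp add: quat_eq_iff add_nonneg_eq_0_iff)
  qed (simp add: inner_quat_def)
qed (simp_all add: inner_quat_def norm_quat_def sgn_quat_def dist_quat_def uniformity_quat_def
    open_quat_def algebra_simps)

end

instantiation quat :: euclidean_space
begin

definition Basis_quat_def: "Basis = {Quat 1 0 0 0, Quat 0 1 0 0, Quat 0 0 1 0, Quat 0 0 0 1}"

instance
proof
  fix x u v :: quat
  show "u \<in> Basis \<Longrightarrow> v \<in> Basis \<Longrightarrow> inner u v = (if u = v then 1 else 0)"
    unfolding Basis_quat_def by (elim insertE emptyE) (simp_all add: inner_quat_def)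
  show "(\<forall>u\<in>Basis. inner x u = 0) \<longleftrightarrow> x = 0"
    by (cases x) (simp add: Basis_quat_def inner_quat_def zero_quat_def)
qed (simp_all add: Basis_quat_def)

end

lemma norm_quat_sq: "(norm (x::quat))\<^sup>2 = (Qre x)\<^sup>2 + (Qi x)\<^sup>2 + (Qj x)\<^sup>2 + (Qk x)\<^sup>2"
  by (simp add: norm_quat_def inner_quat_def power2_eq_square)

lemma star_mult_self: "star x * x = of_real ((norm x)\<^sup>2)" "x * star x = of_real ((norm x)\<^sup>2)"
  for x :: quat
  unfolding norm_quat_sq
  by (simp_all add: quat_eq_iff quat_sel_mult power2_eq_square algebra_simps)

instantiation quat :: real_normed_div_algebra
begin

definition inverse_quat_def: "inverse (x::quat) = star x /\<^sub>R (norm x)\<^sup>2"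

definition divide_quat_def: "(x::quat) div y = x * inverse y"

instance
proof
  fix x y :: quat
  show "norm (x * y) = norm x * norm y"
  proof (rule power2_eq_imp_eq)
    show "(norm (x * y))\<^sup>2 = (norm x * norm y)\<^sup>2"
      unfolding power_mult_distrib norm_quat_sq quat_sel_mult
      by (simp add: power2_eq_square algebra_simps)
  qed simp_all
  show "x \<noteq> 0 \<Longrightarrow> inverse x * x = 1" "x \<noteq> 0 \<Longrightarrow> x * inverse x = 1"
    by (simp_all add: inverse_quat_def star_mult_self of_real_def)
  show "inverse (0::quat) = 0"
    by (simp add: inverse_quat_def)
qed (simp add: divide_quat_def)

end


section \<open>Words\<close>

text \<open>The index set $\{1,\dots,n\}$ is an arbitrary finite type.\<close>

datatype 'n letter = Lq (idx: 'n) | Lqbar (idx: 'n)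

primrec lbar :: "'n letter \<Rightarrow> 'n letter" where
  "lbar (Lq i) = Lqbar i"
| "lbar (Lqbar i) = Lq i"

lemma lbar_lbar [simp]: "lbar (lbar x) = x" and idx_lbar [simp]: "idx (lbar x) = idx x"
  and lbar_neq [simp]: "lbar x \<noteq> x" "x \<noteq> lbar x"
  and lbar_eq_iff [simp]: "lbar x = lbar y \<longleftrightarrow> x = y"
  by (cases x; cases y; simp)+

lemma finite_letter [simp]: "finite (UNIV :: 'n::finite letter set)"
proof -
  have "x \<in> range Lq \<union> range Lqbar" for x :: "'n letter"
    by (cases x) auto
  then have "(UNIV :: 'n letter set) = range Lq \<union> range Lqbar"
    by blast
  then show ?thesis by (metis finite finite_UnI finite_imageI)
qed

text \<open>The normal form $\prod_i |q_i|^{2\alpha_i}\,\tilde w$ is the pair $(\alpha,\tilde w)$.  It is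
  computed from the right: a letter put in front of a normal form either cancels against the
  first letter of $\tilde w$ and increases an exponent, or is prepended.\<close>

fun lpush :: "'n letter \<Rightarrow> ('n \<Rightarrow> nat) \<times> 'n letter list \<Rightarrow> ('n \<Rightarrow> nat) \<times> 'n letter list" where
  "lpush x (\<alpha>, []) = (\<alpha>, [x])"
| "lpush x (\<alpha>, y # w) =
    (if y = lbar x then (\<alpha>(idx x := Suc (\<alpha> (idx x))), w) else (\<alpha>, x # y # w))"

definition nform :: "'n letter list \<Rightarrow> ('n \<Rightarrow> nat) \<times> 'n letter list" where
  "nform xs = foldr lpush xs (\<lambda>_. 0, [])"

lemma nform_simps [simp]: "nform [] = (\<lambda>_. 0, [])" "nform (x # xs) = lpush x (nform xs)"
  by (simp_all add: nform_def)

lemma nform_append: "nform (xs @ ys) = foldr lpush xs (nform ys)"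
  by (simp add: nform_def)

definition reduced :: "'n letter list \<Rightarrow> bool" where
  "reduced w \<longleftrightarrow> successively (\<lambda>x y. y \<noteq> lbar x) w"

lemma reduced_simps [simp]:
  "reduced []" "reduced [x]" "reduced (x # y # w) \<longleftrightarrow> y \<noteq> lbar x \<and> reduced (y # w)"
  by (simp_all add: reduced_def)

lemma reduced_ConsD: "reduced (x # w) \<Longrightarrow> reduced w"
  by (cases w) auto

lemma reduced_lpush: "reduced (snd s) \<Longrightarrow> reduced (snd (lpush x s))"
  by (cases "(x, s)" rule: lpush.cases) (auto dest: reduced_ConsD)

lemma reduced_foldr_lpush: "reduced (snd s) \<Longrightarrow> reduced (snd (foldr lpush xs s))"
  by (induction xs) (auto intro: reduced_lpush)

lemma reduced_nform: "reduced (snd (nform xs))"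
  by (simp add: nform_def reduced_foldr_lpush)

lemma nform_of_reduced: "reduced w \<Longrightarrow> nform w = (\<lambda>_. 0, w)"
proof (induction w)
  case (Cons x w)
  then show ?case
    by (cases w) (auto dest: reduced_ConsD)
qed simp

definition shift :: "('n \<Rightarrow> nat) \<Rightarrow> ('n \<Rightarrow> nat) \<times> 'n letter list \<Rightarrow> ('n \<Rightarrow> nat) \<times> 'n letter list" where
  "shift \<beta> s = (\<lambda>i. fst s i + \<beta> i, snd s)"

lemma lpush_shift: "lpush x (shift \<beta> s) = shift \<beta> (lpush x s)"
  by (cases "(x, s)" rule: lpush.cases) (auto simp: shift_def)

lemma foldr_lpush_shift: "foldr lpush xs (shift \<beta> s) = shift \<beta> (foldr lpush xs s)"
  by (induction xs) (simp_all add: lpush_shift)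

lemma lpush_lpush_lbar:
  "reduced (snd s) \<Longrightarrow> lpush x (lpush (lbar x) s) = shift ((\<lambda>_. 0)(idx x := 1)) s"
proof (cases "(x, s)" rule: lpush.cases)
  case (2 x' \<alpha> y w)
  assume "reduced (snd s)"
  with 2 show ?thesis
    by (cases w) (auto simp: shift_def fun_eq_iff)
qed (auto simp: shift_def fun_eq_iff)

lemma foldr_lpush_nform:
  assumes "reduced (snd s)"
  shows "foldr lpush xs s = shift (fst (nform xs)) (foldr lpush (snd (nform xs)) s)"
proof (induction xs)
  case Nil
  show ?case by (simp add: shift_def)
next
  case (Cons x xs)
  obtain \<alpha> w where \<alpha>w: "nform xs = (\<alpha>, w)"
    by (cases "nform xs")
  have *: "foldr lpush (x # xs) s = shift \<alpha> (lpush x (foldr lpush w s))"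
    using Cons by (simp add: \<alpha>w lpush_shift)
  show ?case
  proof (cases w)
    case (Cons y w')
    show ?thesis
    proof (cases "y = lbar x")
      case True
      have "foldr lpush (x # xs) s = shift \<alpha> (shift ((\<lambda>_. 0)(idx x := 1)) (foldr lpush w' s))"
        using * assms by (simp add: Cons True lpush_lpush_lbar reduced_foldr_lpush)
      then show ?thesis
        by (auto simp: \<alpha>w Cons True shift_def fun_eq_iff)
    next
      case False
      with * show ?thesis by (simp add: \<alpha>w Cons)
    qed
  qed (use * in \<open>simp add: \<alpha>w\<close>)
qed

lemma nform_append_cong:
  assumes "nform xs = nform xs'" "nform ys = nform ys'"
  shows "nform (xs @ ys) = nform (xs' @ ys')"
  using assms by (metis nform_append foldr_lpush_nform reduced_nform)

abbreviation lstar :: "'n letter list \<Rightarrow> 'n letter list" where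
  "lstar xs \<equiv> rev (map lbar xs)"

lemma reduced_lstar: "reduced w \<Longrightarrow> reduced (lstar w)"
  unfolding reduced_def successively_rev successively_map
  by (auto elim!: successively_mono)

lemma nform_lstar: "nform (lstar xs) = (fst (nform xs), lstar (snd (nform xs)))"
proof (induction xs)
  case (Cons x xs)
  obtain \<alpha> w where \<alpha>w: "nform xs = (\<alpha>, w)"
    by (cases "nform xs")
  have red: "reduced w"
    using reduced_nform[of xs] by (simp add: \<alpha>w)
  have "nform (lstar (x # xs)) = foldr lpush (lstar xs) (\<lambda>_. 0, [lbar x])"
    by (simp add: nform_append)
  also have "\<dots> = shift \<alpha> (foldr lpush (lstar w) (\<lambda>_. 0, [lbar x]))"
    by (subst foldr_lpush_nform) (simp_all add: Cons \<alpha>w)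
  also have "\<dots> = shift \<alpha> (nform (lstar w @ [lbar x]))"
    by (simp add: nform_append)
  finally have *: "nform (lstar (x # xs)) = shift \<alpha> (nform (lstar w @ [lbar x]))" .
  show ?case
  proof (cases "\<exists>w'. w = lbar x # w'")
    case True
    then obtain w' where w: "w = lbar x # w'" by blast
    have "reduced (lstar w')"
      using red w by (blast intro: reduced_lstar dest: reduced_ConsD)
    then have "nform (lstar w @ [lbar x]) = shift ((\<lambda>_. 0)(idx x := 1)) (\<lambda>_. 0, lstar w')"
      unfolding w using foldr_lpush_shift[of "lstar w'" "(\<lambda>_. 0)(idx x := 1)" "(\<lambda>_. 0, [])"]
      by (simp add: nform_append shift_def fun_upd_def nform_def[symmetric] nform_of_reduced)
    with * show ?thesis
      by (auto simp: \<alpha>w w shift_def fun_eq_iff)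
  next
    case False
    then have "lpush x (\<alpha>, w) = (\<alpha>, x # w)" and "reduced (x # w)"
      using red by (cases w; auto)+
    moreover from this(2) have "nform (lstar (x # w)) = (\<lambda>_. 0, lstar (x # w))"
      by (intro nform_of_reduced reduced_lstar)
    ultimately show ?thesis
      using * by (simp add: \<alpha>w shift_def)
  qed
qed simp

quotient_type 'n qword = "'n letter list" / "\<lambda>xs ys. nform xs = nform ys"
  by (rule equivpI) (auto simp: reflp_def symp_def transp_def)

instantiation qword :: (type) star_monoid
begin

lift_definition zero_qword :: "'a qword" is "[]" .

lift_definition plus_qword :: "'a qword \<Rightarrow> 'a qword \<Rightarrow> 'a qword" is "(@)"
  by (rule nform_append_cong)

lift_definition star_qword :: "'a qword \<Rightarrow> 'a qword" is lstar
  by (simp add: nform_lstar)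

instance
  by (standard; transfer) (simp_all add: rev_map o_def)

end

lift_definition lword :: "'n letter \<Rightarrow> 'n qword" is "\<lambda>x. [x]" .

text \<open>The word $|q_i|^2 = q_i \bar q_i = \bar q_i q_i$.\<close>

definition absq2 :: "'n \<Rightarrow> 'n qword" where
  "absq2 i = lword (Lq i) + lword (Lqbar i)"

lemma absq2_eq: "absq2 i = lword (Lqbar i) + lword (Lq i)"
  unfolding absq2_def by transfer simp

lemma absq2_central: "absq2 i + w = w + absq2 i"
  unfolding absq2_def
proof transfer
  fix i :: 'a and w :: "'a letter list"
  have "foldr lpush w (nform [Lq i, Lqbar i]) = shift ((\<lambda>_. 0)(i := 1)) (nform w)"
    using foldr_lpush_shift[of w "(\<lambda>_. 0)(i := 1)" "(\<lambda>_. 0, [])"]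
    by (simp add: shift_def nform_def fun_upd_def)
  moreover have "nform ([Lq i, Lqbar i] @ w) = shift ((\<lambda>_. 0)(i := 1)) (nform w)"
    using lpush_lpush_lbar[OF reduced_nform, of "Lq i" w] by simp
  ultimately show "nform (([Lq i] @ [Lqbar i]) @ w) = nform (w @ [Lq i] @ [Lqbar i])"
    by (simp add: nform_append)
qed

lemma length_nform:
  fixes xs :: "'n::finite letter list"
  shows "length xs = 2 * sum (fst (nform xs)) UNIV + length (snd (nform xs))"
proof (induction xs)
  case (Cons x xs)
  have "2 * sum (fst (lpush x s)) UNIV + length (snd (lpush x s))
      = Suc (2 * sum (fst s) UNIV + length (snd s))" for s
  proof (cases "(x, s)" rule: lpush.cases)
    case (2 x' \<alpha> y w)
    have "sum (\<alpha>(idx x := Suc (\<alpha> (idx x)))) UNIV = Suc (sum \<alpha> UNIV)"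
      by (subst (1 2) sum.remove[of UNIV "idx x"]) simp_all
    with 2 show ?thesis by simp
  qed auto
  with Cons show ?case by simp
qed simp

lift_definition wlength :: "'n::finite qword \<Rightarrow> nat" is length
  by (metis length_nform)

definition words_upto :: "nat \<Rightarrow> 'n::finite qword set" where
  "words_upto d = {w. wlength w \<le> d}"

text \<open>Finiteness matters because the quadratic forms below are sums over this set.\<close>

lemma finite_words_upto [simp]: "finite (words_upto d :: 'n::finite qword set)"
proof -
  have "words_upto d \<subseteq> abs_qword ` {xs :: 'n letter list. set xs \<subseteq> UNIV \<and> length xs \<le> d}"
  proof
    fix w :: "'n qword" assume "w \<in> words_upto d"
    moreover obtain xs where "w = abs_qword xs"
      by (metis Quotient3_abs_rep Quotient3_qword)
    ultimately show "w \<in> abs_qword ` {xs. set xs \<subseteq> UNIV \<and> length xs \<le> d}"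
      by (auto simp: words_upto_def wlength.abs_eq)
  qed
  then show ?thesis
    by (rule finite_subset) (intro finite_imageI finite_lists_length_le finite_letter)
qed

definition cyc_equiv :: "'n qword \<Rightarrow> 'n qword \<Rightarrow> bool" where
  "cyc_equiv u v \<longleftrightarrow> (\<exists>w1 w2. u = w1 + w2 \<and> v = w2 + w1)"

subsection \<open>Evaluation\<close>

primrec leval :: "quat ^ 'n \<Rightarrow> 'n letter \<Rightarrow> quat" where
  "leval a (Lq i) = a $ i"
| "leval a (Lqbar i) = star (a $ i)"

lemma leval_nform:
  fixes xs :: "'n::finite letter list"
  shows "prod_list (map (leval a) xs) =
    (\<Prod>i\<in>UNIV. norm (a $ i) ^ (2 * fst (nform xs) i)) *\<^sub>R prod_list (map (leval a) (snd (nform xs)))"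
proof (induction xs)
  case (Cons x xs)
  have "(\<Prod>i\<in>UNIV. norm (a $ i) ^ (2 * fst (lpush x s) i)) *\<^sub>R prod_list (map (leval a) (snd (lpush x s)))
      = leval a x * ((\<Prod>i\<in>UNIV. norm (a $ i) ^ (2 * fst s i)) *\<^sub>R prod_list (map (leval a) (snd s)))" for s
  proof (cases "(x, s)" rule: lpush.cases)
    case (2 x' \<alpha> y w)
    let ?i = "idx x"
    have 1: "(\<Prod>i\<in>UNIV. norm (a $ i) ^ (2 * (\<alpha>(?i := Suc (\<alpha> ?i))) i))
        = (norm (a $ ?i))\<^sup>2 * (\<Prod>i\<in>UNIV. norm (a $ i) ^ (2 * \<alpha> i))"
      by (subst (1 2) prod.remove[of UNIV ?i]) (simp_all add: power2_eq_square)
    have cancel: "leval a z * (leval a (lbar z) * c) = (norm (a $ idx z))\<^sup>2 *\<^sub>R c" for z c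
      unfolding mult.assoc[symmetric]
      by (cases z) (simp_all add: star_mult_self scaleR_conv_of_real)
    show ?thesis
      using 2 1 by (auto simp: cancel mult.commute)
  qed auto
  with Cons show ?case by simp
qed simp

lift_definition weval :: "quat ^ 'n \<Rightarrow> 'n::finite qword \<Rightarrow> quat" is
  "\<lambda>a xs. prod_list (map (leval a) xs)"
  using leval_nform by metis


section \<open>The algebra of real polynomials\<close>

lemma lookup_scaleR [simp]:
  "Poly_Mapping.lookup (r *\<^sub>R p) k = r *\<^sub>R Poly_Mapping.lookup p k"
proof -
  have "finite {k. r *\<^sub>R Poly_Mapping.lookup p k \<noteq> 0}"
    by (rule finite_subset[OF _ finite_lookup[of p]]) auto
  then show ?thesis by (simp add: scaleR_poly_mapping_def)
qed

lemma scaleR_single [simp]: "r *\<^sub>R Poly_Mapping.single k c = Poly_Mapping.single k (r *\<^sub>R c)"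
  by (rule poly_mapping_eqI) (simp add: lookup_single when_def)

lemma poly_mapping_additive_induct [case_names single add]:
  assumes "\<And>k c. P (Poly_Mapping.single k c)" "\<And>p q. P p \<Longrightarrow> P q \<Longrightarrow> P (p + q)"
  shows "P (p :: 'a \<Rightarrow>\<^sub>0 'b::comm_monoid_add)"
proof -
  have "P 0"
    using assms(1)[of undefined 0] by simp
  then have "P (\<Sum>k\<in>A. Poly_Mapping.single k (Poly_Mapping.lookup p k))" for A
    by (induction A rule: infinite_finite_induct) (auto intro: assms)
  moreover have "p = (\<Sum>k\<in>Poly_Mapping.keys p. Poly_Mapping.single k (Poly_Mapping.lookup p k))"
    by (rule poly_mapping_eqI)
      (simp add: lookup_sum lookup_single when_def in_keys_iff)
  ultimately show ?thesis by metis
qed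

instance poly_mapping :: (monoid_add, real_algebra_1) real_algebra_1
proof
  fix r :: real and p q :: "'a \<Rightarrow>\<^sub>0 'b"
  have "r *\<^sub>R Poly_Mapping.single k c * q = r *\<^sub>R (Poly_Mapping.single k c * q)" for k c
    by (induction q rule: poly_mapping_additive_induct)
      (simp_all add: mult_single scaleR_add_right distrib_left)
  then show "r *\<^sub>R p * q = r *\<^sub>R (p * q)"
    by (induction p rule: poly_mapping_additive_induct)
      (simp_all add: scaleR_add_right distrib_right)
  have "Poly_Mapping.single k c * r *\<^sub>R q = r *\<^sub>R (Poly_Mapping.single k c * q)" for k c
    by (induction q rule: poly_mapping_additive_induct)
      (simp_all add: mult_single scaleR_add_right distrib_left)
  then show "p * r *\<^sub>R q = r *\<^sub>R (p * q)"
    by (induction p rule: poly_mapping_additive_induct)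
      (simp_all add: scaleR_add_right distrib_right)
qed

instantiation poly_mapping :: (star_monoid, star_algebra) star_algebra
begin

text \<open>$(\sum_w p_w w)^* = \sum_w p_w^* w^*$\<close>

lift_definition star_poly_mapping :: "('a \<Rightarrow>\<^sub>0 'b) \<Rightarrow> ('a \<Rightarrow>\<^sub>0 'b)" is
  "\<lambda>f k. star (f (star k))"
proof -
  fix f :: "'a \<Rightarrow> 'b" assume "finite {k. f k \<noteq> 0}"
  then have "finite (star ` {k. f k \<noteq> 0})" by simp
  then show "finite {k. star (f (star k)) \<noteq> 0}"
    by (rule finite_subset[rotated]) (force simp: image_iff intro: star_monoid_star[symmetric])
qed

instance
proof
  fix r :: real and p q :: "'a \<Rightarrow>\<^sub>0 'b"
  have single: "star (Poly_Mapping.single k c) = Poly_Mapping.single (star k) (star c)"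
    for k :: 'a and c :: 'b
    by (rule poly_mapping_eqI)
      (auto simp: star_poly_mapping.rep_eq lookup_single when_def)
  show add: "star (p + q) = star p + star q" for p q :: "'a \<Rightarrow>\<^sub>0 'b"
    by transfer auto
  show "star (star p) = p"
    by transfer auto
  show "star (r *\<^sub>R p) = r *\<^sub>R star p"
    by (rule poly_mapping_eqI) (simp add: star_poly_mapping.rep_eq)
  have "star (Poly_Mapping.single k c * q) = star q * star (Poly_Mapping.single k c)" for k c
    by (induction q rule: poly_mapping_additive_induct)
      (simp_all add: mult_single single add distrib_left distrib_right star_monoid_add)
  then show "star (p * q) = star q * star p"
    by (induction p rule: poly_mapping_additive_induct)
      (simp_all add: add distrib_left distrib_right)
qed

end

lemma star_single [simp]:
  "star (Poly_Mapping.single k c) = Poly_Mapping.single (star k) (star c)"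
  by (rule poly_mapping_eqI) (auto simp: star_poly_mapping.rep_eq lookup_single when_def)

type_synonym 'n rpoly = "'n qword \<Rightarrow>\<^sub>0 real"

definition mon :: "'n qword \<Rightarrow> 'n rpoly" where
  "mon w = Poly_Mapping.single w 1"

definition peval :: "quat ^ 'n \<Rightarrow> 'n::finite rpoly \<Rightarrow> quat" where
  "peval a p = (\<Sum>w\<in>Poly_Mapping.keys p. Poly_Mapping.lookup p w *\<^sub>R weval a w)"

definition commutator :: "'a::ring \<Rightarrow> 'a \<Rightarrow> 'a" where
  "commutator a b = a * b - b * a"


section \<open>The free product of two real algebras\<close>

text \<open>Formal expressions in elements of the two algebras, modulo the least congruence for which
  the quotient is a unital real algebra and both inclusions are homomorphisms of unital
  algebras.\<close>

datatype ('a, 'b) fpterm =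
    TInl 'a
  | TInr 'b
  | TAdd "('a, 'b) fpterm" "('a, 'b) fpterm"
  | TMul "('a, 'b) fpterm" "('a, 'b) fpterm"
  | TScale real "('a, 'b) fpterm"

inductive fpeq :: "('a::real_algebra_1, 'b::real_algebra_1) fpterm \<Rightarrow> ('a, 'b) fpterm \<Rightarrow> bool" where
  refl: "fpeq s s"
| sym: "fpeq s t \<Longrightarrow> fpeq t s"
| trans: "fpeq s t \<Longrightarrow> fpeq t u \<Longrightarrow> fpeq s u"
| add_cong: "fpeq s s' \<Longrightarrow> fpeq t t' \<Longrightarrow> fpeq (TAdd s t) (TAdd s' t')"
| mul_cong: "fpeq s s' \<Longrightarrow> fpeq t t' \<Longrightarrow> fpeq (TMul s t) (TMul s' t')"
| scale_cong: "fpeq s s' \<Longrightarrow> fpeq (TScale r s) (TScale r s')"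
| add_assoc: "fpeq (TAdd (TAdd s t) u) (TAdd s (TAdd t u))"
| add_comm: "fpeq (TAdd s t) (TAdd t s)"
| add_zero: "fpeq (TAdd (TInl 0) s) s"
| add_neg: "fpeq (TAdd (TScale (-1) s) s) (TInl 0)"
| scale_add: "fpeq (TScale r (TAdd s t)) (TAdd (TScale r s) (TScale r t))"
| add_scale: "fpeq (TScale (r + r') s) (TAdd (TScale r s) (TScale r' s))"
| scale_scale: "fpeq (TScale r (TScale r' s)) (TScale (r * r') s)"
| scale_one: "fpeq (TScale 1 s) s"
| mul_assoc: "fpeq (TMul (TMul s t) u) (TMul s (TMul t u))"
| one_mul: "fpeq (TMul (TInl 1) s) s"
| mul_one: "fpeq (TMul s (TInl 1)) s"
| add_mul: "fpeq (TMul (TAdd s t) u) (TAdd (TMul s u) (TMul t u))"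
| mul_add: "fpeq (TMul s (TAdd t u)) (TAdd (TMul s t) (TMul s u))"
| scale_mul: "fpeq (TMul (TScale r s) t) (TScale r (TMul s t))"
| mul_scale: "fpeq (TMul s (TScale r t)) (TScale r (TMul s t))"
| inl_add: "fpeq (TInl (a + a')) (TAdd (TInl a) (TInl a'))"
| inl_mul: "fpeq (TInl (a * a')) (TMul (TInl a) (TInl a'))"
| inl_scale: "fpeq (TInl (r *\<^sub>R a)) (TScale r (TInl a))"
| inr_add: "fpeq (TInr (b + b')) (TAdd (TInr b) (TInr b'))"
| inr_mul: "fpeq (TInr (b * b')) (TMul (TInr b) (TInr b'))"
| inr_scale: "fpeq (TInr (r *\<^sub>R b)) (TScale r (TInr b))"
| inr_one: "fpeq (TInr 1) (TInl 1)"

quotient_type (overloaded) ('a, 'b) free_product =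
  "('a::real_algebra_1, 'b::real_algebra_1) fpterm" / fpeq
  by (rule equivpI) (auto simp: reflp_def symp_def transp_def intro: fpeq.refl fpeq.sym fpeq.trans)

lift_definition fp_inl :: "'a::real_algebra_1 \<Rightarrow> ('a, 'b::real_algebra_1) free_product" is TInl .

lift_definition fp_inr :: "'b::real_algebra_1 \<Rightarrow> ('a::real_algebra_1, 'b) free_product" is TInr .

text \<open>The free product is not the zero ring: both algebras act on the linear maps from the first
  to the second.\<close>

primrec fpact :: "('a::real_algebra_1, 'b::real_algebra_1) fpterm \<Rightarrow> ('a \<Rightarrow> 'b) \<Rightarrow> 'a \<Rightarrow> 'b" where
  "fpact (TInl a) f = (\<lambda>x. f (x * a))"
| "fpact (TInr b) f = (\<lambda>x. b * f x)"
| "fpact (TAdd s t) f = (\<lambda>x. fpact s f x + fpact t f x)"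
| "fpact (TMul s t) f = fpact s (fpact t f)"
| "fpact (TScale r s) f = (\<lambda>x. r *\<^sub>R fpact s f x)"

lemma linear_fpact: "linear f \<Longrightarrow> linear (fpact s f)"
  by (induction s arbitrary: f)
    (auto simp: linear_iff algebra_simps)

lemma fpact_linear:
  assumes "linear f"
  shows "fpact s f (x + y) = fpact s f x + fpact s f y" "fpact s f (r *\<^sub>R x) = r *\<^sub>R fpact s f x"
  using linear_fpact[OF assms, of s] by (auto simp: linear_iff)

lemma fpact_cong: "fpeq s t \<Longrightarrow> linear f \<Longrightarrow> fpact s f = fpact t f"
proof (induction arbitrary: f rule: fpeq.induct)
  case (mul_cong s s' t t')
  then show ?case by (simp add: linear_fpact)
next
  case (add_mul s t u)
  then show ?case by simp
next
  case (mul_add s t u)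
  have "fpact s (\<lambda>x. g x + h x) = (\<lambda>x. fpact s g x + fpact s h x)" for g h :: "'a \<Rightarrow> 'b"
    by (induction s arbitrary: g h) (auto simp: algebra_simps)
  then show ?case by simp
next
  case (mul_scale s r t)
  have "fpact s (\<lambda>x. r *\<^sub>R g x) = (\<lambda>x. r *\<^sub>R fpact s g x)" for g :: "'a \<Rightarrow> 'b"
    by (induction s arbitrary: g) (auto simp: algebra_simps)
  then show ?case by simp
qed (auto simp: linear_iff fun_eq_iff algebra_simps linear_0)

lemma not_fpeq_zero_one:
  "\<not> fpeq (TInl 0) (TInl 1 :: ('a::real_algebra_1, 'b::real_algebra_1) fpterm)"
proof
  assume *: "fpeq (TInl 0) (TInl 1 :: ('a, 'b) fpterm)"
  have "\<exists>f :: 'a \<Rightarrow> 'b. linear f \<and> (\<forall>x\<in>{1}. f x = 1)"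
    by (rule linear_independent_extend) simp
  then obtain f :: "'a \<Rightarrow> 'b" where f: "linear f" "f 1 = 1"
    by auto
  have "fpact (TInl 0) f 1 = fpact (TInl 1) f 1"
    using fpact_cong[OF * f(1)] by simp
  with f show False
    by (simp add: linear_0)
qed

instantiation free_product :: (real_algebra_1, real_algebra_1) real_algebra_1
begin

lift_definition zero_free_product :: "('a, 'b) free_product" is "TInl 0" .

lift_definition one_free_product :: "('a, 'b) free_product" is "TInl 1" .

lift_definition plus_free_product ::
  "('a, 'b) free_product \<Rightarrow> ('a, 'b) free_product \<Rightarrow> ('a, 'b) free_product" is TAdd
  by (rule fpeq.add_cong)

lift_definition times_free_product ::
  "('a, 'b) free_product \<Rightarrow> ('a, 'b) free_product \<Rightarrow> ('a, 'b) free_product" is TMul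
  by (rule fpeq.mul_cong)

lift_definition scaleR_free_product ::
  "real \<Rightarrow> ('a, 'b) free_product \<Rightarrow> ('a, 'b) free_product" is TScale
  by (rule fpeq.scale_cong)

definition uminus_free_product :: "('a, 'b) free_product \<Rightarrow> ('a, 'b) free_product" where
  "uminus_free_product x = (-1) *\<^sub>R x"

definition minus_free_product ::
  "('a, 'b) free_product \<Rightarrow> ('a, 'b) free_product \<Rightarrow> ('a, 'b) free_product" where
  "minus_free_product x y = x + - y"

instance
proof
  fix x y z :: "('a, 'b) free_product" and r s :: real
  show "x + y + z = x + (y + z)" by transfer (rule fpeq.add_assoc)
  show "x + y = y + x" by transfer (rule fpeq.add_comm)
  show "0 + x = x" by transfer (rule fpeq.add_zero)
  show "- x + x = 0" unfolding uminus_free_product_def by transfer (rule fpeq.add_neg)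
  show "x - y = x + - y" by (rule minus_free_product_def)
  show "r *\<^sub>R (x + y) = r *\<^sub>R x + r *\<^sub>R y" by transfer (rule fpeq.scale_add)
  show "(r + s) *\<^sub>R x = r *\<^sub>R x + s *\<^sub>R x" by transfer (rule fpeq.add_scale)
  show "r *\<^sub>R s *\<^sub>R x = (r * s) *\<^sub>R x" by transfer (rule fpeq.scale_scale)
  show "1 *\<^sub>R x = x" by transfer (rule fpeq.scale_one)
  show "x * y * z = x * (y * z)" by transfer (rule fpeq.mul_assoc)
  show "(x + y) * z = x * z + y * z" by transfer (rule fpeq.add_mul)
  show "x * (y + z) = x * y + x * z" by transfer (rule fpeq.mul_add)
  show "r *\<^sub>R x * y = r *\<^sub>R (x * y)" by transfer (rule fpeq.scale_mul)
  show "x * r *\<^sub>R y = r *\<^sub>R (x * y)" by transfer (rule fpeq.mul_scale)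
  show "1 * x = x" by transfer (rule fpeq.one_mul)
  show "x * 1 = x" by transfer (rule fpeq.mul_one)
  show "(0 :: ('a, 'b) free_product) \<noteq> 1" by transfer (rule not_fpeq_zero_one)
qed

end

primrec tstar :: "('a::star, 'b::star) fpterm \<Rightarrow> ('a, 'b) fpterm" where
  "tstar (TInl a) = TInl (star a)"
| "tstar (TInr b) = TInr (star b)"
| "tstar (TAdd s t) = TAdd (tstar s) (tstar t)"
| "tstar (TMul s t) = TMul (tstar t) (tstar s)"
| "tstar (TScale r s) = TScale r (tstar s)"

lemma tstar_cong: "fpeq s t \<Longrightarrow> fpeq (tstar s) (tstar t)"
  for s t :: "('a::star_algebra, 'b::star_algebra) fpterm"
proof (induction rule: fpeq.induct)
  case (sym s t)
  from sym.IH show ?case by (rule fpeq.sym)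
next
  case (trans s t u)
  from trans.IH show ?case by (rule fpeq.trans)
next
  case (mul_assoc s t u)
  show ?case by (simp add: fpeq.sym[OF fpeq.mul_assoc])
qed (simp_all add: fpeq.refl fpeq.add_cong fpeq.mul_cong fpeq.scale_cong fpeq.add_assoc
    fpeq.add_comm fpeq.add_zero fpeq.add_neg fpeq.scale_add fpeq.add_scale fpeq.scale_scale
    fpeq.scale_one fpeq.one_mul fpeq.mul_one fpeq.add_mul fpeq.mul_add fpeq.scale_mul
    fpeq.mul_scale fpeq.inl_add fpeq.inl_mul fpeq.inl_scale fpeq.inr_add fpeq.inr_mul
    fpeq.inr_scale fpeq.inr_one)

instantiation free_product :: (star_algebra, star_algebra) star_algebra
begin

lift_definition star_free_product :: "('a, 'b) free_product \<Rightarrow> ('a, 'b) free_product" is tstar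
  by (rule tstar_cong)

instance
proof
  fix x y :: "('a, 'b) free_product" and r :: real
  show "star (star x) = x"
  proof transfer
    fix s :: "('a, 'b) fpterm"
    have "tstar (tstar s) = s" by (induction s) simp_all
    then show "fpeq (tstar (tstar s)) s" by (simp add: fpeq.refl)
  qed
  show "star (x + y) = star x + star y" by transfer (simp add: fpeq.refl)
  show "star (x * y) = star y * star x" by transfer (simp add: fpeq.refl)
  show "star (r *\<^sub>R x) = r *\<^sub>R star x" by transfer (simp add: fpeq.refl)
qed

end


section \<open>Quadratic modules\<close>

type_synonym 'n hpoly = "(quat, 'n rpoly) free_product"

text \<open>The sums $\sum_w p_w w$ with the quaternionic coefficients on the left.\<close>

definition left_polys :: "'n hpoly set" where
  "left_polys = {\<Sum>w\<in>W. fp_inl (p w) * fp_inr (mon w) | (W :: 'n qword set) p. finite W}"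

definition sos :: "'n hpoly set" where
  "sos = {\<Sum>p\<leftarrow>ps. star p * p | ps. set ps \<subseteq> left_polys}"

definition qmodule ::
  "nat \<Rightarrow> (nat \<Rightarrow> 'n rpoly) \<Rightarrow> nat \<Rightarrow> (nat \<Rightarrow> 'n rpoly) \<Rightarrow> 'n hpoly set" where
  "qmodule m g l h =
    {\<sigma>0 + (1/2) *\<^sub>R (\<Sum>i=1..m. \<sigma> i * fp_inr (g i) + fp_inr (g i) * \<sigma> i)
        + (\<Sum>j=1..l. \<Sum>(\<tau>, \<nu>)\<leftarrow>T j.
            \<tau> * fp_inr (h j) * star \<nu> + \<nu> * star (fp_inr (h j)) * star \<tau>)
     | \<sigma>0 \<sigma> T. \<sigma>0 \<in> sos \<and> (\<forall>i\<in>{1..m}. \<sigma> i \<in> sos)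
         \<and> (\<forall>j\<in>{1..l}. set (T j) \<subseteq> left_polys \<times> left_polys)}"

definition archimedean ::
  "nat \<Rightarrow> (nat \<Rightarrow> 'n::finite rpoly) \<Rightarrow> nat \<Rightarrow> (nat \<Rightarrow> 'n rpoly) \<Rightarrow> bool" where
  "archimedean m g l h \<longleftrightarrow>
    (\<exists>R>0. fp_inr (of_real R - (\<Sum>i\<in>UNIV. mon (absq2 i))) \<in> qmodule m g l h)"

definition semialg ::
  "nat \<Rightarrow> (nat \<Rightarrow> 'n::finite rpoly) \<Rightarrow> nat \<Rightarrow> (nat \<Rightarrow> 'n rpoly) \<Rightarrow> (quat ^ 'n) set" where
  "semialg m g l h =
    {a. (\<forall>i\<in>{1..m}. peval a (g i) \<in> \<real>\<^sub>\<ge>\<^sub>0) \<and> (\<forall>j\<in>{1..l}. peval a (h j) = 0)}"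


section \<open>Pseudo-moment sequences\<close>

definition pseudo_moment :: "('n qword \<Rightarrow> quat) \<Rightarrow> bool" where
  "pseudo_moment y \<longleftrightarrow>
    (\<forall>w. y w = star (y (star w))) \<and> (\<forall>u v. cyc_equiv u v \<longrightarrow> Qre (y u) = Qre (y v))"

definition riesz :: "('n qword \<Rightarrow> quat) \<Rightarrow> 'n rpoly \<Rightarrow> quat" where
  "riesz y p = (\<Sum>w\<in>Poly_Mapping.keys p. Poly_Mapping.lookup p w *\<^sub>R y w)"

text \<open>Since the empty word is included, a representing measure is automatically finite.\<close>

definition represents ::
  "(quat ^ 'n) measure \<Rightarrow> ('n::finite qword \<Rightarrow> quat) \<Rightarrow> (quat ^ 'n) set \<Rightarrow> bool" where
  "represents \<mu> y K \<longleftrightarrow> sets \<mu> = sets borel \<and> (AE a in \<mu>. a \<in> K) \<and>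
    (\<forall>w. \<forall>c\<in>{Qre, Qi, Qj, Qk}. has_bochner_integral \<mu> (\<lambda>a. c (weval a w)) (c (y w)))"

definition moment_matrix :: "('n qword \<Rightarrow> quat) \<Rightarrow> 'n qword \<Rightarrow> 'n qword \<Rightarrow> quat" where
  "moment_matrix y u v = riesz y (mon (star u + v))"

definition localizing_matrix ::
  "'n rpoly \<Rightarrow> ('n qword \<Rightarrow> quat) \<Rightarrow> 'n qword \<Rightarrow> 'n qword \<Rightarrow> quat" where
  "localizing_matrix g y u v = riesz y (mon (star u) * g * mon v)"

text \<open>$v^* A v \ge 0$ for all quaternionic vectors indexed by the finite set $I$; membership in
  \<open>\<real>\<^sub>\<ge>\<^sub>0\<close> includes that the value is real.\<close>

definition quat_psd :: "'a set \<Rightarrow> ('a \<Rightarrow> 'a \<Rightarrow> quat) \<Rightarrow> bool" where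
  "quat_psd I A \<longleftrightarrow>
    (\<forall>x. (\<Sum>u\<in>I. \<Sum>v\<in>I. star (x u) * A u v * x v) \<in> \<real>\<^sub>\<ge>\<^sub>0)"

end

theory Submission
  imports Defs "HOL-Probability.Probability"
begin

text \<open>The conditions on \<open>y\<close> say that \<open>L p = \<Sum>\<^sub>w \<langle>p\<^sub>w, y\<^sub>w\<rangle>\<close> is a positive functional on the
  quaternionic polynomials with commuting coefficients for which all \<open>w + w\<^sup>*\<close> are central.  By the
  Archimedean condition the normalised functionals of this kind form a compact convex set, and every
  word acts as a bounded operator.  If such a functional is extreme, then every \<open>w + w\<^sup>*\<close> acts as a
  real scalar, so that the real polynomials modulo null elements form a real, complex or
  quaternionic *-algebra (Frobenius) and \<open>y\<close> is a unital positive map of the quaternions after a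
  *-homomorphism; such a map is a convex combination of conjugations, and so \<open>y\<close> is a convex
  combination of point evaluations on the semialgebraic set.  A nearest-point argument extends this
  from the extreme functionals to all of them, up to limits of convex combinations of evaluations.
  The limits are integrals: a space-filling curve transports the finitely supported measures to the
  unit interval, where Helly's selection theorem applies.\<close>

section \<open>Positive functionals on real *-algebras\<close>

text \<open>Pairing with the real inner product packs the four components of \<open>y\<close> into
  one real functional, so that Cauchy-Schwarz, compactness and extremality can be used over the
  reals. The obstacle is that \<open>L\<close> need not be tracial and \<open>y\<close> need not be
  multiplicative, even at an extreme functional: only the elements \<open>w + star w\<close> are
  known to be central. This shapes the proof in two ways. A symmetric g is half of
  \<open>g + star g\<close>, hence central, and this makes the products of g with sums of squares
  positive. And extremality is exploited on central elements only, so it leaves a state on the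
  tensor product of the quaternions with a division algebra D, which is R, C or H. For D = H this
  tensor product is the algebra of real 4 x 4 matrices, so the state amounts to a positive
  semidefinite 4 x 4 matrix; its rank-one summands are the maps taking b to
  \<open>star \<xi> * b * \<xi>\<close>. Up to the weight |\<xi>|^2 each of them is an evaluation at
  a simultaneous conjugate of one and the same point.\<close>

lemma star_uminus [simp]: "star (- x) = - star x" for x :: "'a::star_algebra"
  using star_scaleR[of "-1" x] by simp

lemma star_diff [simp]: "star (x - y) = star x - star y" for x y :: "'a::star_algebra"
  using star_add[of x "- y"] by simp

lemma discriminant_le:
  fixes A B C :: real
  assumes "\<And>s t. 0 \<le> s\<^sup>2 * A + 2 * s * t * B + t\<^sup>2 * C"
  shows "B\<^sup>2 \<le> A * C"
proof (cases "C = 0")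
  case True
  have "B = 0"
  proof (rule ccontr)
    assume "B \<noteq> 0"
    \<comment> \<open>With s = 1 and C = 0 the form is A + 2 t B, and this t makes it -1.\<close>
    then show False
      using assms[of 1 "- (A + 1) / (2 * B)"] True by (simp add: field_simps)
  qed
  then show ?thesis by (simp add: True)
next
  case False
  with assms[of 0 1] have "C > 0" by simp
  \<comment> \<open>At s = C and t = - B the form factors as C (A C - B^2).\<close>
  moreover have "0 \<le> C * (A * C - B\<^sup>2)"
    using assms[of C "- B"] by (simp add: power2_eq_square algebra_simps)
  ultimately show ?thesis by (simp add: zero_le_mult_iff)
qed

text \<open>In a unital ring this is the largest two-sided ideal inside the kernel of
  \<open>L\<close>. Congruence modulo it takes the place of a quotient algebra throughout.\<close>

definition null_elems :: "('a::ring \<Rightarrow> real) \<Rightarrow> 'a set" where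
  "null_elems L = {n. \<forall>p r. L (p * n * r) = 0}"

lemma null_elemsD: "n \<in> null_elems L \<Longrightarrow> L (p * n * r) = 0"
  by (simp add: null_elems_def)

lemma null_elemsD1: "n \<in> null_elems L \<Longrightarrow> L n = 0" for L :: "'a::ring_1 \<Rightarrow> real"
  using null_elemsD[of n L 1 1] by simp

lemma null_elems_mult:
  assumes "n \<in> null_elems L"
  shows "a * n \<in> null_elems L" "n * a \<in> null_elems L"
  unfolding null_elems_def mem_Collect_eq
proof safe
  fix p r
  show "L (p * (a * n) * r) = 0"
    using null_elemsD[OF assms, of "p * a" r] by (simp add: mult.assoc)
  show "L (p * (n * a) * r) = 0"
    using null_elemsD[OF assms, of p "a * r"] by (simp add: mult.assoc)
qed

definition central :: "('a::ring \<Rightarrow> real) \<Rightarrow> 'a \<Rightarrow> bool" where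
  "central L z \<longleftrightarrow> (\<forall>a. z * a - a * z \<in> null_elems L)"

locale positive_functional =
  fixes L :: "'a::star_algebra \<Rightarrow> real"
  assumes linear: "linear L"
    and L_star: "L (star p) = L p"
    and nonneg: "0 \<le> L (star p * p)"
begin

lemmas L_simps = linear_add[OF linear] linear_diff[OF linear] linear_cmul[OF linear]
  linear_0[OF linear] linear_neg[OF linear]

lemma null_zero: "0 \<in> null_elems L"
  by (simp add: null_elems_def L_simps)

lemma null_add: "m \<in> null_elems L \<Longrightarrow> n \<in> null_elems L \<Longrightarrow> m + n \<in> null_elems L"
  by (simp add: null_elems_def L_simps algebra_simps)

lemma null_diff: "m \<in> null_elems L \<Longrightarrow> n \<in> null_elems L \<Longrightarrow> m - n \<in> null_elems L"
  by (simp add: null_elems_def L_simps algebra_simps)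

lemma null_scaleR: "n \<in> null_elems L \<Longrightarrow> c *\<^sub>R n \<in> null_elems L"
  by (simp add: null_elems_def L_simps)

lemma null_uminus: "n \<in> null_elems L \<Longrightarrow> - n \<in> null_elems L"
  using null_diff[OF null_zero] by simp

lemma null_star: 
  assumes "n \<in> null_elems L" shows "star n \<in> null_elems L"
  unfolding null_elems_def mem_Collect_eq
proof (intro allI)
  fix p r
  show "L (p * star n * r) = 0"
    using null_elemsD[OF assms, of "star r" "star p"] L_star[of "star r * n * star p"]
    by (simp add: mult.assoc)
qed

lemma cauchy_schwarz_weighted:
  assumes "star g = g" "\<And>p. 0 \<le> L (star p * g * p)"
  shows "(L (star p * g * r))\<^sup>2 \<le> L (star p * g * p) * L (star r * g * r)"
proof (rule discriminant_le)
  fix s t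
  have "L (star r * g * p) = L (star p * g * r)"
    using L_star[of "star p * g * r"] by (simp add: assms mult.assoc)
  then show "0 \<le> s\<^sup>2 * L (star p * g * p) + 2 * s * t * L (star p * g * r) + t\<^sup>2 * L (star r * g * r)"
    using assms(2)[of "s *\<^sub>R p + t *\<^sub>R r"]
    by (simp add: L_simps algebra_simps power2_eq_square)
qed

lemma cauchy_schwarz: "(L (star p * r))\<^sup>2 \<le> L (star p * p) * L (star r * r)"
  using cauchy_schwarz_weighted[of 1 p r] nonneg by simp

lemma L_one_nonneg: "0 \<le> L 1"
  using nonneg[of 1] by simp

lemma square_le: "(L p)\<^sup>2 \<le> L 1 * L (star p * p)"
  using cauchy_schwarz[of 1 p] by simp

lemma central_swap:
  assumes "central L z"
  shows "L (p * z * a * r) = L (p * a * z * r)"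
  using null_elemsD[of "z * a - a * z" L p r] assms
  by (simp add: central_def algebra_simps L_simps)

lemma central_swap_left: "central L z \<Longrightarrow> L (z * a * r) = L (a * z * r)"
  using central_swap[of z 1 a r] by simp

lemma central_mult:
  assumes "central L x" "central L z" shows "central L (x * z)"
  unfolding central_def
proof
  fix a
  have "x * z * a - a * (x * z) = x * (z * a - a * z) + (x * a - a * x) * z"
    by (simp add: algebra_simps)
  also have "\<dots> \<in> null_elems L"
    using assms by (intro null_add null_elems_mult) (auto simp: central_def)
  finally show "x * z * a - a * (x * z) \<in> null_elems L" .
qed

lemma central_add: "central L x \<Longrightarrow> central L z \<Longrightarrow> central L (x + z)"
  using null_add[of "x * a - a * x" "z * a - a * z" for a]
  by (auto simp: central_def algebra_simps)

lemma central_diff: "central L x \<Longrightarrow> central L z \<Longrightarrow> central L (x - z)"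
  using null_diff[of "x * a - a * x" "z * a - a * z" for a]
  by (auto simp: central_def algebra_simps)

lemma central_scaleR: "central L x \<Longrightarrow> central L (c *\<^sub>R x)"
  using null_scaleR[of "x * a - a * x" c for a]
  by (auto simp: central_def scaleR_diff_right)

lemma central_one: "central L 1"
  by (simp add: central_def null_zero)

text \<open>If $0\le z\le1$, then the recursion $z_{k+1}=z_k-z_k^2$ keeps $0\le z_k\le1$, and
  $z=z_0^2+\dots+z_{k-1}^2+z_k$ with $z_k\to0$ weakly exhibits $z$ as a limit of sums of squares.\<close>

lemma central_mult_nonneg:
  assumes z: "star z = z" "central L z" "\<And>p. 0 \<le> L (star p * z * p)"
      "\<And>p. L (star p * z * p) \<le> L (star p * p)"
    and g: "\<And>p. 0 \<le> L (star p * g * p)"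
  shows "0 \<le> L (z * star p * g * p)"
proof -
  define Z where "Z = rec_nat z (\<lambda>_ a. a - a * a)"
  have Z0: "Z 0 = z" and ZS: "Z (Suc k) = Z k - Z k * Z k" for k
    by (simp_all add: Z_def)
  have starZ: "star (Z k) = Z k" for k
    by (induction k) (simp_all add: Z0 ZS z)
  have centZ: "central L (Z k)" for k
    by (induction k) (simp_all add: Z0 ZS z central_diff central_mult)
  have posZ: "(\<forall>p. 0 \<le> L (star p * Z k * p)) \<and> (\<forall>p. 0 \<le> L (star p * (1 - Z k) * p))" for k
  proof (induction k)
    case 0
    then show ?case using z by (simp add: Z0 algebra_simps L_simps)
  next
    case (Suc k)
    show ?case
    proof safe
      fix p
      \<comment> \<open>By z - z^2 = (1 - z) z (1 - z) + z (1 - z) z both bounds on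
        \<open>Z k\<close> enter the lower bound on \<open>Z (Suc k)\<close>; the upper bound comes
        from 1 - z + z^2.\<close>
      have "star p * Z (Suc k) * p = star ((1 - Z k) * p) * Z k * ((1 - Z k) * p)
          + star (Z k * p) * (1 - Z k) * (Z k * p)"
        by (simp add: ZS starZ algebra_simps)
      then have "L (star p * Z (Suc k) * p) = L (star ((1 - Z k) * p) * Z k * ((1 - Z k) * p))
          + L (star (Z k * p) * (1 - Z k) * (Z k * p))"
        by (simp only: L_simps)
      then show "0 \<le> L (star p * Z (Suc k) * p)"
        using Suc by (metis add_nonneg_nonneg)
      have "star p * (1 - Z (Suc k)) * p = star p * (1 - Z k) * p + star (Z k * p) * (Z k * p)"
        by (simp add: ZS starZ algebra_simps)
      then have "L (star p * (1 - Z (Suc k)) * p)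
          = L (star p * (1 - Z k) * p) + L (star (Z k * p) * (Z k * p))"
        by (simp only: L_simps)
      then show "0 \<le> L (star p * (1 - Z (Suc k)) * p)"
        using Suc nonneg by (metis add_nonneg_nonneg)
    qed
  qed
  have tele: "z = (\<Sum>k<n. Z k * Z k) + Z n" for n
    by (induction n) (simp_all add: Z0 ZS)
  define e where "e k = L (star p * (Z k * Z k) * p)" for k
  have e_eq: "e k = L (star (Z k * p) * (Z k * p))" for k
    by (simp add: e_def starZ mult.assoc)
  have e_nonneg: "0 \<le> e k" for k unfolding e_eq by (rule nonneg)
  \<comment> \<open>What the squares leave of \<open>z\<close> is \<open>Z n\<close>, which is
    positive; so the values of the squares are summable and \<open>e\<close> tends to 0.\<close>
  have "(\<Sum>k<n. e k) \<le> L (star p * z * p)" for n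
  proof -
    have "L (star p * z * p) = (\<Sum>k<n. e k) + L (star p * Z n * p)"
      by (subst tele[of n])
        (simp add: L_simps e_def algebra_simps sum_distrib_left sum_distrib_right
          linear_sum[OF linear])
    then show ?thesis using posZ by simp
  qed
  then have "summable e" by (intro summableI_nonneg_bounded e_nonneg)
  then have e0: "e \<longlonglongrightarrow> 0" by (rule summable_LIMSEQ_zero)
  \<comment> \<open>Each square contributes a nonnegative amount, because one of its two factors can
    be moved past \<open>g\<close>. Only the remainder \<open>Z n\<close> may have the wrong sign,
    and Cauchy-Schwarz bounds it in terms of \<open>e n\<close>.\<close>
  have lower: "- sqrt (e n * L (star (g * p) * (g * p))) \<le> L (z * star p * g * p)" for n
  proof -
    have "L (z * star p * g * p) = L (star p * z * (g * p))"
      using central_swap_left[OF z(2), of "star p" "g * p"] by (simp add: mult.assoc)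
    also have "\<dots> = (\<Sum>k<n. L (star p * (Z k * Z k) * (g * p))) + L (star p * Z n * (g * p))"
      by (subst tele[of n])
        (simp add: L_simps algebra_simps sum_distrib_left sum_distrib_right linear_sum[OF linear])
    finally have *: "L (z * star p * g * p) = \<dots>" .
    have "0 \<le> L (star p * (Z k * Z k) * (g * p))" for k
    proof -
      have "L (star p * (Z k * Z k) * (g * p)) = L (star (Z k * p) * g * (Z k * p))"
        using central_swap[OF centZ[of k], of "star p * Z k" g p] by (simp add: starZ mult.assoc)
      then show ?thesis by (simp only: g)
    qed
    then have "L (star p * Z n * (g * p)) \<le> L (z * star p * g * p)"
      unfolding * by (simp add: sum_nonneg)
    moreover have "(L (star p * Z n * (g * p)))\<^sup>2 \<le> e n * L (star (g * p) * (g * p))"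
      using cauchy_schwarz[of "Z n * p" "g * p"] by (simp add: e_eq starZ mult.assoc)
    then have "\<bar>L (star p * Z n * (g * p))\<bar> \<le> sqrt (e n * L (star (g * p) * (g * p)))"
      by (rule real_le_rsqrt[of "\<bar>_\<bar>", simplified])
    ultimately show ?thesis by linarith
  qed
  have "(\<lambda>n. - sqrt (e n * L (star (g * p) * (g * p)))) \<longlonglongrightarrow> - sqrt (0 * L (star (g * p) * (g * p)))"
    by (intro tendsto_intros e0)
  then show ?thesis
    using lower by (intro LIMSEQ_le_const2[of _ "- sqrt (0 * L (star (g * p) * (g * p)))" , simplified]) auto
qed

end

section \<open>Cones of positive functionals and their extreme normalised elements\<close>

definition pos_cone :: "'a::star_algebra set \<Rightarrow> 'a set \<Rightarrow> ('a \<Rightarrow> real) set" where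
  "pos_cone G N = {L. linear L \<and> (\<forall>p. L (star p) = L p) \<and>
     (\<forall>g\<in>insert 1 G. \<forall>p. 0 \<le> L (star p * g * p)) \<and> N \<subseteq> null_elems L}"

definition states :: "'a::star_algebra set \<Rightarrow> 'a set \<Rightarrow> ('a \<Rightarrow> real) set" where
  "states G N = {L \<in> pos_cone G N. L 1 = 1}"

lemma pos_cone_positive_functional: "L \<in> pos_cone G N \<Longrightarrow> positive_functional L"
  by (auto simp: pos_cone_def positive_functional_def dest: spec[of _ 1])

definition extreme_in :: "('i \<Rightarrow> real) set \<Rightarrow> ('i \<Rightarrow> real) \<Rightarrow> bool" where
  "extreme_in S x \<longleftrightarrow> x \<in> S \<and>
     (\<forall>a\<in>S. \<forall>b\<in>S. \<forall>s. 0 < s \<and> s < 1 \<and> (\<forall>i. x i = (1 - s) * a i + s * b i) \<longrightarrow> a = b)"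

lemma extreme_inD:
  assumes "extreme_in S x" "a \<in> S" "b \<in> S" "0 < s" "s < 1" "\<And>i. x i = (1 - s) * a i + s * b i"
  shows "a = b"
  using assms unfolding extreme_in_def by blast

text \<open>Positivity is \<open>central_mult_nonneg\<close>. The relations \<open>N\<close> survive
  because they are imposed on a two-sided ideal: the factor \<open>z\<close> is absorbed into the
  left multiplier.\<close>

lemma central_perturbation_pos_cone:
  assumes L: "L \<in> pos_cone G N" and z: "star z = z" "central L z"
    "\<And>p. 0 \<le> L (star p * z * p)" "\<And>p. L (star p * z * p) \<le> L (star p * p)"
  shows "(\<lambda>p. L (z * p)) \<in> pos_cone G N"
proof -
  interpret positive_functional L by (rule pos_cone_positive_functional[OF L])
  have "linear (\<lambda>p. L (z * p))"
    by (intro linearI) (simp_all add: L_simps distrib_left)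
  moreover have "L (z * star p) = L (z * p)" for p
    using L_star[of "z * star p"] central_swap_left[OF z(2), of p 1] z(1) by simp
  moreover have "0 \<le> L (z * (star p * g * p))" if "g \<in> insert 1 G" for g p
    using central_mult_nonneg[OF z, of g p] L that by (auto simp: pos_cone_def mult.assoc)
  moreover have "N \<subseteq> null_elems (\<lambda>p. L (z * p))"
  proof
    fix n assume "n \<in> N"
    then have "n \<in> null_elems L" using L by (auto simp: pos_cone_def)
    then show "n \<in> null_elems (\<lambda>p. L (z * p))"
      using null_elemsD[of n L "z * p" r for p r] by (simp add: null_elems_def mult.assoc)
  qed
  ultimately show ?thesis unfolding pos_cone_def mem_Collect_eq by blast
qed

text \<open>The elements (1 + z/(C+1))/2 and (1 - z/(C+1))/2 are central, lie between 0 and 1 and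
  add up to 1, so they split \<open>L\<close> into two positive functionals. By extremality both are
  proportional to \<open>L\<close>, and this is multiplicativity in the factor
  \<open>z\<close>.\<close>

lemma extreme_state_central:
  assumes ext: "extreme_in (states G N) L" and z: "star z = z" "central L z"
    and C: "0 \<le> C" "\<And>p. \<bar>L (star p * z * p)\<bar> \<le> C * L (star p * p)"
  shows "L (z * p) = L z * L p"
proof -
  from ext have L: "L \<in> pos_cone G N" and L1: "L 1 = 1"
    by (auto simp: extreme_in_def states_def)
  interpret positive_functional L by (rule pos_cone_positive_functional[OF L])
  \<comment> \<open>Dividing by C + 1 and not by C keeps \<open>L (u 1)\<close> and
    \<open>L (u (-1))\<close> strictly positive, also for C = 0, so both parts can be
    normalised.\<close>
  define u where "u c = (1 / (2 * (C + 1))) *\<^sub>R ((C + 1) *\<^sub>R 1 + c *\<^sub>R z)" for c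
  have u: "star (u c) = u c" "central L (u c)" for c
    by (auto simp: u_def z intro!: central_scaleR central_add central_one)
  have val: "L (star p * u c * p) = (L (star p * p) + c * L (star p * z * p) / (C + 1)) / 2" for c p
  proof -
    have "L (star p * u c * p) = ((C + 1) * L (star p * p) + c * L (star p * z * p)) / (2 * (C + 1))"
      by (simp add: u_def L_simps distrib_left distrib_right add_divide_distrib)
    then show ?thesis using C(1) by (simp add: field_simps)
  qed
  have bd: "\<bar>L (star p * z * p) / (C + 1)\<bar> \<le> L (star p * p)" for p
  proof -
    have "\<bar>L (star p * z * p)\<bar> \<le> (C + 1) * L (star p * p)"
      using C(2)[of p] nonneg[of p] by (simp add: algebra_simps)
    then show ?thesis using C(1) by (simp add: divide_le_eq mult.commute abs_divide)
  qed
  have "0 \<le> L (star p * u c * p) \<and> L (star p * u c * p) \<le> L (star p * p)" if "\<bar>c\<bar> = 1" for c p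
  proof -
    have "c = 1 \<or> c = -1" using that by auto
    then show ?thesis unfolding val using bd[of p]
      by (elim disjE; simp add: abs_le_iff del: abs_divide; linarith)
  qed
  then have cone: "(\<lambda>p. L (u c * p)) \<in> pos_cone G N" if "\<bar>c\<bar> = 1" for c
    using that by (intro central_perturbation_pos_cone[OF L u]) auto
  have strict: "0 < L (u c)" if "\<bar>c\<bar> = 1" for c
  proof -
    have "\<bar>L z\<bar> \<le> C" using C(2)[of 1] L1 by simp
    then have "\<bar>c * L z / (C + 1)\<bar> < 1" using C(1) that by (simp add: abs_mult divide_less_eq)
    then have "- 1 < c * L z / (C + 1)" unfolding abs_less_iff by linarith
    then show ?thesis using val[of 1 c] L1 by simp
  qed
  have norm: "(\<lambda>p. L (u c * p) / L (u c)) \<in> states G N" if "\<bar>c\<bar> = 1" for c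
  proof -
    have "linear (\<lambda>p. L (u c * p) / L (u c))"
      by (intro linearI) (simp_all add: L_simps distrib_left add_divide_distrib)
    with cone[OF that] strict[OF that] show ?thesis
      unfolding states_def pos_cone_def null_elems_def by auto
  qed
  have sum1: "u 1 + u (-1) = 1"
    using C(1) by (simp add: u_def scaleR_add_right[symmetric] scaleR_2[symmetric])
  then have sumL: "L (u 1 * p) + L (u (-1) * p) = L p" for p
    by (metis distrib_right mult_1 L_simps(1))
  define s where "s = L (u (-1))"
  have s: "0 < s" "s < 1" "1 - s = L (u 1)"
    using strict[of 1] strict[of "-1"] sumL[of 1] L1 by (auto simp: s_def)
  have eq: "L p = (1 - s) * (L (u 1 * p) / L (u 1)) + s * (L (u (-1) * p) / L (u (-1)))" for p
    using s strict[of 1] strict[of "-1"] sumL by (simp add: s_def)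
  have "(\<lambda>p. L (u 1 * p) / L (u 1)) = (\<lambda>p. L (u (-1) * p) / L (u (-1)))"
    by (rule extreme_inD[OF ext norm[of 1] norm[of "-1"] s(1,2) eq]) simp_all
  then have "L (u 1 * p) / L (u 1) = L (u (-1) * p) / L (u (-1))" for p
    by (rule fun_cong)
  then have *: "L (u 1 * p) * L (u (-1)) = L (u (-1) * p) * L (u 1)" for p
    using strict[of 1] strict[of "-1"] by (simp add: field_simps)
  have "L (u 1 * p) = L (u 1) * L p" for p
  proof -
    have "L (u 1 * p) = L (u 1 * p) * (L (u 1) + L (u (-1)))"
      using sumL[of 1] L1 by simp
    also have "\<dots> = L (u 1) * (L (u 1 * p) + L (u (-1) * p))"
      using *[of p] by (simp add: algebra_simps)
    finally show ?thesis by (simp add: sumL)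
  qed
  moreover have "L (u 1 * q) = ((C + 1) * L q + L (z * q)) / (2 * (C + 1))" for q
    by (simp add: u_def L_simps distrib_right add_divide_distrib)
  ultimately have "((C + 1) * L p + L (z * p)) / (2 * (C + 1))
      = ((C + 1) + L z) * L p / (2 * (C + 1))"
    using L1 by (metis mult_1_right times_divide_eq_left)
  then show ?thesis
    using C(1) by (simp add: divide_cancel_right distrib_right)
qed

section \<open>Frobenius' theorem for positive functionals\<close>

text \<open>Modulo null elements each p has the scalar trace \<open>p + star p\<close>, and its norm
  \<open>star p * p\<close>, being symmetric, is scalar too. The quotient is thus a quadratic
  algebra with definite norm, the setting of Frobenius' theorem.\<close>

locale scalar_functional = positive_functional +
  assumes L_one: "L 1 = 1"
    and real_part_null: "p + star p - (2 * L p) *\<^sub>R 1 \<in> null_elems L"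
begin

lemma null_L: "n \<in> null_elems L \<Longrightarrow> L n = 0"
  by (rule null_elemsD1)

lemma symmetric_null:
  assumes "star s = s" shows "s - L s *\<^sub>R 1 \<in> null_elems L"
proof -
  have "s - L s *\<^sub>R 1 = (1/2) *\<^sub>R (s + star s - (2 * L s) *\<^sub>R 1)"
    by (simp add: assms scaleR_right_diff_distrib scaleR_2[symmetric])
  then show ?thesis by (simp only: null_scaleR real_part_null)
qed

text \<open>\<open>star b * b\<close> is congruent to its value under \<open>L\<close>, so here it
  lies in the ideal, and by Cauchy-Schwarz every \<open>L (p * b * r)\<close> vanishes with it. This
  is the definiteness of the norm.\<close>

lemma null_if_L_eq_0:
  assumes "L (star b * b) = 0" shows "b \<in> null_elems L"
proof -
  have sb: "star b * b \<in> null_elems L"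
    using symmetric_null[of "star b * b"] assms by simp
  have "L (p * b * r) = 0" for p r
  proof -
    have "L (star (b * r) * (b * r)) = 0"
      using null_elemsD[OF sb, of "star r" r] by (simp add: mult.assoc)
    then have "(L (star (star p) * (b * r)))\<^sup>2 \<le> 0"
      using cauchy_schwarz[of "star p" "b * r"] by simp
    then show ?thesis by (simp add: mult.assoc)
  qed
  then show ?thesis by (simp add: null_elems_def)
qed

lemma L_skew: "star b = - b \<Longrightarrow> L b = 0"
  using L_star[of b] by (simp add: L_simps)

text \<open>The anticommutator of skew elements is symmetric, hence congruent to its value under
  \<open>L\<close>, and that is twice \<open>L (a * b)\<close>: orthogonal skew elements
  anticommute.\<close>

lemma anticommute_null:
  assumes "star a = - a" "star b = - b" "L (a * b) = 0"
  shows "a * b + b * a \<in> null_elems L"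
proof -
  have "L (b * a) = 0" using L_star[of "a * b"] assms by simp
  then show ?thesis
    using symmetric_null[of "a * b + b * a"] assms by (simp add: L_simps add.commute)
qed

lemma skew_part_null: "p - (L p *\<^sub>R 1 + (1/2) *\<^sub>R (p - star p)) \<in> null_elems L"
proof -
  have "p - (L p *\<^sub>R 1 + (1/2) *\<^sub>R (p - star p)) = (1/2) *\<^sub>R (p + star p - (2 * L p) *\<^sub>R 1)
      + (p - ((1/2) *\<^sub>R p + (1/2) *\<^sub>R p))"
    by (simp add: algebra_simps)
  also have "p - ((1/2) *\<^sub>R p + (1/2) *\<^sub>R p) = 0"
    by (simp flip: scaleR_add_left)
  finally show ?thesis by (simp only: null_scaleR real_part_null add_0_right)
qed

text \<open>The square of a skew element is congruent to the scalar \<open>- L (star b * b)\<close>,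
  which is negative unless \<open>b\<close> is null; rescaling makes it -1.\<close>

lemma obtain_imaginary_unit:
  assumes "star b = - b" "b \<notin> null_elems L"
  obtains c where "c > 0" "(c *\<^sub>R b) * (c *\<^sub>R b) + 1 \<in> null_elems L"
proof -
  have pos: "L (star b * b) > 0"
    using assms null_if_L_eq_0 nonneg[of b] by force
  define c where "c = 1 / sqrt (L (star b * b))"
  have c: "c > 0" "c * c * L (star b * b) = 1"
    using pos by (auto simp: c_def)
  have "(c * c) *\<^sub>R (b * b - L (b * b) *\<^sub>R 1) \<in> null_elems L"
    by (intro null_scaleR symmetric_null) (simp add: assms)
  moreover have "c * c * L (b * b) = -1"
    using c assms by (simp add: L_simps)
  ultimately have "(c *\<^sub>R b) * (c *\<^sub>R b) + 1 \<in> null_elems L"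
    by (simp add: scaleR_right_diff_distrib)
  with c that show ?thesis by blast
qed

text \<open>\<open>\<phi>\<close> realises the quotient inside the quaternions and \<open>E\<close>
  lifts it back modulo null elements. \<open>E\<close> has all quaternions as its domain even if
  only the reals or the complex numbers are reached; the constructions below let it kill the
  remaining units, so that all cases of Frobenius' theorem share one type.\<close>

definition quat_embedding :: "('a \<Rightarrow> quat) \<Rightarrow> (quat \<Rightarrow> 'a) \<Rightarrow> bool" where
  "quat_embedding \<phi> E \<longleftrightarrow> linear \<phi> \<and> \<phi> 1 = 1 \<and> (\<forall>p q. \<phi> (p * q) = \<phi> p * \<phi> q) \<and>
     (\<forall>p. \<phi> (star p) = star (\<phi> p)) \<and> (\<forall>p. Qre (\<phi> p) = L p) \<and>
     linear E \<and> E 1 = 1 \<and> (\<forall>u. star (E u) = E (star u)) \<and> (\<forall>p. p - E (\<phi> p) \<in> null_elems L)"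

text \<open>\<open>P\<close> is the projection of the quaternions onto a subalgebra (the reals, the complex numbers
  or all quaternions) that \<open>E\<close> identifies with the algebra modulo null elements.\<close>

lemma embedding_aux:
  fixes E :: "quat \<Rightarrow> 'a" and P :: "quat \<Rightarrow> quat"
  assumes E: "linear E" "E 1 = 1" "\<And>u. star (E u) = E (star u)"
    and P: "linear P" "\<And>u. E (P u) = E u" "P 1 = 1" "\<And>u. P (star u) = star (P u)"
      "\<And>u v. P (P u * P v) = P u * P v" "\<And>u. Qre (P u) = Qre u"
    and mult: "\<And>u v. E u * E v - E (P u * P v) \<in> null_elems L"
    and span: "\<And>p. \<exists>u. p - E u \<in> null_elems L"
  shows "\<exists>\<phi>. quat_embedding \<phi> E \<and> (\<forall>u. \<phi> (E u) = P u)"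
proof -
  note E_simps = linear_add[OF E(1)] linear_cmul[OF E(1)] linear_diff[OF E(1)]
  note P_simps = linear_add[OF P(1)] linear_cmul[OF P(1)] linear_diff[OF P(1)]
  have inj: "P w = 0" if "E w \<in> null_elems L" for w
  proof -
    \<comment> \<open>Multiplication by \<open>E (star w)\<close> replaces \<open>E w\<close> by the
      scalar |P w|^2, and a scalar is null only if it is 0. This makes the choice in the definition
      of \<open>\<phi>\<close> immaterial.\<close>
    have "E (P (star w) * P w) \<in> null_elems L"
      using null_diff[OF null_elems_mult(1)[OF that, of "E (star w)"] mult[of "star w" w]] by simp
    then have "(norm (P w))\<^sup>2 *\<^sub>R 1 \<in> null_elems L"
      by (simp add: P star_mult_self of_real_def E_simps E(2))
    from null_L[OF this] have "(norm (P w))\<^sup>2 * L 1 = 0"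
      by (simp add: L_simps)
    then show ?thesis by (simp add: L_one)
  qed
  define \<phi> where "\<phi> p = P (SOME u. p - E u \<in> null_elems L)" for p
  have \<phi>I: "\<phi> p = P u" if "p - E u \<in> null_elems L" for p u
  proof -
    let ?v = "SOME u. p - E u \<in> null_elems L"
    have v: "p - E ?v \<in> null_elems L" using that by (rule someI)
    then have "E (u - ?v) \<in> null_elems L"
      using null_diff[OF v that] by (simp add: E_simps)
    from inj[OF this] show ?thesis by (simp add: \<phi>_def P_simps)
  qed
  have \<phi>E: "p - E (\<phi> p) \<in> null_elems L" for p
    using span[of p] \<phi>I P(2) by fastforce
  have P\<phi>: "P (\<phi> p) = \<phi> p" for p
    using \<phi>I[OF \<phi>E] by simp
  have "\<phi> (p + q) = \<phi> p + \<phi> q" for p q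
    using \<phi>I[of "p + q" "\<phi> p + \<phi> q"] null_add[OF \<phi>E[of p] \<phi>E[of q]] P\<phi>
    by (simp add: E_simps P_simps algebra_simps)
  moreover have "\<phi> (c *\<^sub>R p) = c *\<^sub>R \<phi> p" for c p
    using \<phi>I[of "c *\<^sub>R p" "c *\<^sub>R \<phi> p"] null_scaleR[OF \<phi>E[of p], of c] P\<phi>
    by (simp add: E_simps P_simps algebra_simps)
  moreover have "\<phi> 1 = 1"
    using \<phi>I[of 1 1] P null_zero E by simp
  moreover have "\<phi> (p * q) = \<phi> p * \<phi> q" for p q
  proof -
    have "p * q - E (\<phi> p * \<phi> q) = (p - E (\<phi> p)) * q + E (\<phi> p) * (q - E (\<phi> q))
        + (E (\<phi> p) * E (\<phi> q) - E (P (\<phi> p) * P (\<phi> q)))"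
      by (simp add: algebra_simps P\<phi>)
    also have "\<dots> \<in> null_elems L"
      by (intro null_add null_elems_mult \<phi>E mult)
    finally have "\<phi> (p * q) = P (\<phi> p * \<phi> q)" by (rule \<phi>I)
    then show ?thesis using P(5)[of "\<phi> p" "\<phi> q"] by (simp add: P\<phi>)
  qed
  moreover have "\<phi> (star p) = star (\<phi> p)" for p
    using \<phi>I[of "star p" "star (\<phi> p)"] null_star[OF \<phi>E[of p]] by (simp add: E P P\<phi>)
  moreover have "Qre (\<phi> p) = L p" for p
  proof -
    have E_skew: "L (E u) = 0" if "star u = - u" for u
      using L_skew[of "E u"] E(3)[of u] that E_simps(2)[of "-1" u] by simp
    have "E (\<phi> p) = Qre (\<phi> p) *\<^sub>R 1 + E (\<phi> p - of_real (Qre (\<phi> p)))"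
      by (simp add: E_simps E(2) of_real_def)
    also have "L \<dots> = Qre (\<phi> p)"
      by (simp add: L_simps L_one E_skew quat_eq_iff)
    finally show ?thesis
      using null_L[OF \<phi>E[of p]] by (simp add: L_simps)
  qed
  moreover have "\<phi> (E u) = P u" for u
    by (rule \<phi>I) (simp add: null_zero)
  ultimately show ?thesis
    using \<phi>E E unfolding quat_embedding_def by (intro exI[of _ \<phi>]) (simp add: linearI)
qed

text \<open>Orthogonal imaginary units are adjoined one at a time. This stops with none, with
  \<open>e\<close>, or with \<open>e\<close>, \<open>f\<close> and their product \<open>k\<close>: a
  skew element orthogonal to all three anticommutes with \<open>e\<close> and \<open>f\<close>,
  hence commutes with \<open>e * f\<close>, yet it also anticommutes with \<open>k\<close>, so it is
  null.\<close>

theorem frobenius_embedding: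
  "\<exists>\<phi> E. quat_embedding \<phi> E \<and> ((\<forall>u. \<phi> (E u) = u) \<or>
     (\<forall>u. \<phi> (E u) = Quat (Qre u) (Qi u) 0 0 \<and> E u = E (\<phi> (E u))) \<or>
     (\<forall>u. \<phi> (E u) = Quat (Qre u) 0 0 0 \<and> E u = E (\<phi> (E u))))"
proof -
  define skew where "skew p = (1/2) *\<^sub>R (p - star p)" for p :: 'a
  have skew: "star (skew p) = - skew p" for p
    by (simp add: skew_def flip: scaleR_minus_right)
  have split: "p - (L p *\<^sub>R 1 + skew p) \<in> null_elems L" for p
    unfolding skew_def by (rule skew_part_null)
  show ?thesis
  proof (cases "\<forall>p. skew p \<in> null_elems L")
    case True
    define E where "E u = Qre u *\<^sub>R (1::'a)" for u
    define P where "P u = Quat (Qre u) 0 0 0" for u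
    have "\<exists>\<phi>. quat_embedding \<phi> E \<and> (\<forall>u. \<phi> (E u) = P u)"
    proof (rule embedding_aux)
      show "linear E" "linear P"
        by (auto intro!: linearI simp: E_def P_def quat_eq_iff algebra_simps)
      show "\<exists>u. p - E u \<in> null_elems L" for p
        using null_add[OF split[of p] True[rule_format, of p]]
        by (intro exI[of _ "of_real (L p)"]) (simp add: E_def)
    qed (simp_all add: E_def P_def quat_eq_iff quat_sel_mult null_zero mult.commute)
    then show ?thesis
      by (elim exE conjE) (rule exI, rule exI[of _ E], auto simp: E_def P_def)
  next
    case False
    then obtain b where "skew b \<notin> null_elems L" by blast
    then obtain c where c: "c > 0" "(c *\<^sub>R skew b) * (c *\<^sub>R skew b) + 1 \<in> null_elems L"
      using obtain_imaginary_unit skew by metis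
    define e where "e = c *\<^sub>R skew b"
    have e: "star e = - e" "e * e + 1 \<in> null_elems L"
      using c skew by (simp_all add: e_def)
    have Le: "L (e * e) = -1"
      using null_L[OF e(2)] by (simp add: L_simps L_one)
    \<comment> \<open>The component orthogonal to \<open>e\<close>. The inner product of skew
      elements is - L (a b), hence the plus sign.\<close>
    define rest where "rest p = skew p + L (e * skew p) *\<^sub>R e" for p
    have rest: "star (rest p) = - rest p" "L (e * rest p) = 0" for p
      by (simp_all add: rest_def skew e L_simps distrib_left Le)
    show ?thesis
    proof (cases "\<forall>p. rest p \<in> null_elems L")
      case True
      define E where "E u = Qre u *\<^sub>R (1::'a) + Qi u *\<^sub>R e" for u
      define P where "P u = Quat (Qre u) (Qi u) 0 0" for u
      have "\<exists>\<phi>. quat_embedding \<phi> E \<and> (\<forall>u. \<phi> (E u) = P u)"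
      proof (rule embedding_aux)
        show "linear E" "linear P"
          by (auto intro!: linearI simp: E_def P_def quat_eq_iff algebra_simps)
        show "E u * E v - E (P u * P v) \<in> null_elems L" for u v
        proof -
          have "E u * E v - E (P u * P v) = (Qi u * Qi v) *\<^sub>R (e * e + 1)"
            by (simp add: E_def P_def quat_sel_mult algebra_simps)
          then show ?thesis by (simp only: null_scaleR e)
        qed
        show "\<exists>u. p - E u \<in> null_elems L" for p
          using null_add[OF split[of p] True[rule_format, of p]]
          by (intro exI[of _ "Quat (L p) (- L (e * skew p)) 0 0"]) (simp add: E_def rest_def algebra_simps)
      qed (simp_all add: E_def P_def quat_eq_iff quat_sel_mult e)
      then show ?thesis
        by (elim exE conjE) (rule exI, rule exI[of _ E], auto simp: E_def P_def)
    next
      case False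
      then obtain b' where "rest b' \<notin> null_elems L" by blast
      then obtain c' where c': "c' > 0" "(c' *\<^sub>R rest b') * (c' *\<^sub>R rest b') + 1 \<in> null_elems L"
        using obtain_imaginary_unit rest by metis
      define f where "f = c' *\<^sub>R rest b'"
      have f: "star f = - f" "f * f + 1 \<in> null_elems L" "L (e * f) = 0"
        using c' rest by (simp_all add: f_def L_simps)
      \<comment> \<open>The commutator is skew exactly, \<open>e * f\<close> only modulo null
        elements, and \<open>star (E u) = E (star u)\<close> is required as an equation.\<close>
      define k where "k = (1/2) *\<^sub>R (e * f - f * e)"
      have k: "star k = - k"
        by (simp add: k_def e f flip: scaleR_minus_right)
      have anti: "e * f + f * e \<in> null_elems L"
        by (rule anticommute_null) (simp_all add: e f)
      have half: "(1/2) *\<^sub>R x + (1/2) *\<^sub>R x = x" for x :: 'a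
        by (simp flip: scaleR_add_left)
      have "e * f - k = (1/2) *\<^sub>R (e * f + f * e) + (e * f - ((1/2) *\<^sub>R (e * f) + (1/2) *\<^sub>R (e * f)))"
        by (simp add: k_def algebra_simps)
      then have ef: "e * f - k \<in> null_elems L"
        using null_scaleR[OF anti, of "1/2"] by (simp add: half)
      have "f * e + k = (e * f + f * e) - (e * f - k)" by simp
      then have fe: "f * e + k \<in> null_elems L"
        using null_diff[OF anti ef] by simp
      \<comment> \<open>Up to null terms \<open>k\<close> is e f, and e f e f = - e e f f =
        -1.\<close>
      have "k * k + 1 = (e * f) * (k - e * f) + (k - e * f) * k + e * (e * f + f * e) * f
          - (e * e + 1) * (f * f) + (f * f + 1)"
        by (simp add: algebra_simps)
      moreover have ef': "k - e * f \<in> null_elems L"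
        using null_uminus[OF ef] by simp
      ultimately have kk: "k * k + 1 \<in> null_elems L"
        using null_add[OF null_diff[OF null_add[OF null_add[OF null_elems_mult(1)[OF ef'] null_elems_mult(2)[OF ef']]
            null_elems_mult(2)[OF null_elems_mult(1)[OF anti]]] null_elems_mult(2)[OF e(2)]] f(2)]
        by metis
      have "f * k - e = f * (f * e + k) - (f * f + 1) * e" by (simp add: algebra_simps)
      then have fk: "f * k - e \<in> null_elems L"
        using null_diff[OF null_elems_mult(1)[OF fe] null_elems_mult(2)[OF f(2)]] by metis
      have "k * f + e = e * (f * f + 1) - (e * f - k) * f" by (simp add: algebra_simps)
      then have kf: "k * f + e \<in> null_elems L"
        using null_diff[OF null_elems_mult(1)[OF f(2)] null_elems_mult(2)[OF ef]] by metis
      have "k * e - f = (f * e + k) * e - f * (e * e + 1)" by (simp add: algebra_simps)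
      then have ke: "k * e - f \<in> null_elems L"
        using null_diff[OF null_elems_mult(2)[OF fe] null_elems_mult(1)[OF e(2)]] by metis
      have "e * k + f = (e * e + 1) * f - e * (e * f - k)" by (simp add: algebra_simps)
      then have ek: "e * k + f \<in> null_elems L"
        using null_diff[OF null_elems_mult(2)[OF e(2)] null_elems_mult(1)[OF ef]] by metis
      note table = e(2) f(2) kk ef fe fk kf ke ek
      have skew0: "L e = 0" "L f = 0" "L k = 0"
        by (auto intro!: L_skew e f k)
      have Ltable: "L (e * e) = -1" "L (f * f) = -1" "L (k * k) = -1" "L (e * f) = 0" "L (f * e) = 0"
        "L (e * k) = 0" "L (k * e) = 0" "L (f * k) = 0" "L (k * f) = 0"
        using table[THEN null_L] by (simp_all add: L_simps L_one skew0)
      define E where "E u = Qre u *\<^sub>R (1::'a) + Qi u *\<^sub>R e + Qj u *\<^sub>R f + Qk u *\<^sub>R k" for u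
      have "\<exists>\<phi>. quat_embedding \<phi> E \<and> (\<forall>u. \<phi> (E u) = u)"
      proof (rule embedding_aux)
        show "linear E"
          by (auto intro!: linearI simp: E_def algebra_simps)
        show "linear (\<lambda>u::quat. u)" by (auto intro: linearI)
        show "E u * E v - E (u * v) \<in> null_elems L" for u v
        proof -
          have "E u * E v - E (u * v) = (Qi u * Qi v) *\<^sub>R (e * e + 1) + (Qj u * Qj v) *\<^sub>R (f * f + 1)
            + (Qk u * Qk v) *\<^sub>R (k * k + 1) + (Qi u * Qj v) *\<^sub>R (e * f - k) + (Qj u * Qi v) *\<^sub>R (f * e + k)
            + (Qj u * Qk v) *\<^sub>R (f * k - e) + (Qk u * Qj v) *\<^sub>R (k * f + e)
            + (Qk u * Qi v) *\<^sub>R (k * e - f) + (Qi u * Qk v) *\<^sub>R (e * k + f)"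
            by (simp add: E_def quat_sel_mult algebra_simps)
          then show ?thesis by (simp only:) (intro null_add null_scaleR table)
        qed
        show "\<exists>u. p - E u \<in> null_elems L" for p
        proof -
          define r where "r = skew p + L (e * skew p) *\<^sub>R e + L (f * skew p) *\<^sub>R f + L (k * skew p) *\<^sub>R k"
          have r: "star r = - r" "L (e * r) = 0" "L (f * r) = 0" "L (k * r) = 0"
            by (simp_all add: r_def skew e f k L_simps distrib_left Ltable)
          have re: "e * r + r * e \<in> null_elems L" "f * r + r * f \<in> null_elems L"
            "k * r + r * k \<in> null_elems L"
            by (auto intro!: anticommute_null e f k r)
          \<comment> \<open>\<open>r\<close> anticommutes with \<open>k\<close> but commutes with e
            f, which is congruent to \<open>k\<close>; so 2 k r is null, and a further
            multiplication by \<open>k\<close> isolates \<open>r\<close>.\<close>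
          have "2 *\<^sub>R (k * r) = (k * r + r * k) - (r * (k - e * f) + (e * r + r * e) * f
              - e * (f * r + r * f) + (e * f - k) * r)"
            by (simp add: algebra_simps scaleR_2)
          also have "\<dots> \<in> null_elems L"
            by (intro null_diff[OF re(3)] null_add null_diff[OF _ null_elems_mult(1)[OF re(2)]]
                null_elems_mult(1)[OF ef'] null_elems_mult(2)[OF re(1)] null_elems_mult(2)[OF ef])
          finally have kr: "k * r \<in> null_elems L"
            using null_scaleR[of "2 *\<^sub>R (k * r)" "1/2"] by simp
          have "r = (k * k + 1) * r - k * (k * r)" by (simp add: algebra_simps)
          also have "\<dots> \<in> null_elems L"
            by (rule null_diff[OF null_elems_mult(2)[OF kk] null_elems_mult(1)[OF kr]])
          finally have rn: "r \<in> null_elems L" .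
          have "p - E (Quat (L p) (- L (e * skew p)) (- L (f * skew p)) (- L (k * skew p)))
              = (p - (L p *\<^sub>R 1 + skew p)) + r"
            by (simp add: E_def r_def)
          with null_add[OF split[of p] rn] show ?thesis by metis
        qed
      qed (simp_all add: E_def e f k)
      then show ?thesis
        by (elim exE conjE) (rule exI, rule exI[of _ E], auto)
    qed
  qed
qed

end

section \<open>Unital positive maps on the quaternions\<close>

text \<open>Symmetric Gaussian elimination: the row of \<open>i\<close>, divided by the square root
  of the pivot, is the first vector, and the induction hypothesis splits the Schur
  complement.\<close>

lemma psd_rank_one_decomposition:
  fixes M :: "'i \<Rightarrow> 'i \<Rightarrow> real"
  assumes "finite I" "\<And>s t. M s t = M t s" "\<And>x. 0 \<le> (\<Sum>s\<in>I. \<Sum>t\<in>I. x s * M s t * x t)"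
  shows "\<exists>(N::nat) v. \<forall>s\<in>I. \<forall>t\<in>I. M s t = (\<Sum>k<N. v k s * v k t)"
  using assms
proof (induction I arbitrary: M rule: finite_induct)
  case empty
  show ?case by simp
next
  case (insert i I)
  note sym = insert.prems(1)
  define d where "d = M i i"
  have expand: "(\<Sum>s\<in>insert i I. \<Sum>t\<in>insert i I. x s * M s t * x t)
      = d * (x i)\<^sup>2 + 2 * x i * (\<Sum>t\<in>I. M i t * x t) + (\<Sum>s\<in>I. \<Sum>t\<in>I. x s * M s t * x t)" for x
  proof -
    have "(\<Sum>s\<in>I. x s * M s i * x i) = x i * (\<Sum>t\<in>I. M i t * x t)"
      by (simp add: sum_distrib_left sym[of _ i] mult_ac)
    moreover have "(\<Sum>t\<in>I. x i * M i t * x t) = x i * (\<Sum>t\<in>I. M i t * x t)"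
      by (simp add: sum_distrib_left mult_ac)
    ultimately show ?thesis
      using insert.hyps by (simp add: sum.distrib d_def power2_eq_square algebra_simps)
  qed
  \<comment> \<open>The 2 x 2 minors on \<open>i\<close> and \<open>t\<close>; for d = 0 they force
    the row of \<open>i\<close> to vanish.\<close>
  have row: "(M i t)\<^sup>2 \<le> d * M t t" if "t \<in> I" for t
  proof (rule discriminant_le)
    fix a b :: real
    have ti: "t \<noteq> i" using that insert.hyps by blast
    define x where "x = (\<lambda>s. if s = i then a else if s = t then b else 0)"
    have "(\<Sum>r\<in>I. M i r * x r) = M i t * b"
      using that insert.hyps by (subst sum.remove[of _ t]) (auto simp: x_def ti intro!: sum.neutral split: if_split_asm)
    moreover have "(\<Sum>s\<in>I. \<Sum>r\<in>I. x s * M s r * x r) = b * M t t * b"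
    proof -
      have "(\<Sum>r\<in>I. x s * M s r * x r) = x s * M s t * b" for s
        using that insert.hyps by (subst sum.remove[of _ t]) (auto simp: x_def ti intro!: sum.neutral split: if_split_asm)
      then show ?thesis
        using that insert.hyps by (simp, subst sum.remove[of _ t]) (auto simp: x_def ti intro!: sum.neutral split: if_split_asm)
    qed
    ultimately show "0 \<le> a\<^sup>2 * d + 2 * a * b * M i t + b\<^sup>2 * M t t"
      using insert.prems(2)[of x] unfolding expand
      by (simp add: x_def power2_eq_square algebra_simps)
  qed
  have d: "0 \<le> d"
    using insert.prems(2)[of "\<lambda>s. if s = i then 1 else 0"] unfolding expand
    using insert.hyps by (simp add: if_distrib cong: if_cong)
  text \<open>The Schur complement; if \<open>d = 0\<close>, then the row of \<open>i\<close> vanishes and division by zero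
    makes the correction term vanish too.\<close>
  define M' where "M' s t = M s t - M i s * M i t / d" for s t
  have "\<exists>(N::nat) v. \<forall>s\<in>I. \<forall>t\<in>I. M' s t = (\<Sum>k<N. v k s * v k t)"
  proof (rule insert.IH)
    show "M' s t = M' t s" for s t by (simp add: M'_def sym[of s t])
    show "0 \<le> (\<Sum>s\<in>I. \<Sum>t\<in>I. x s * M' s t * x t)" for x
    proof -
      define A where "A = (\<Sum>t\<in>I. M i t * x t)"
      \<comment> \<open>For d > 0 this value at \<open>i\<close> minimises the form with the other
        coordinates fixed, so that exactly the Schur complement remains.\<close>
      define z where "z = x(i := - A / d)"
      have zI: "(\<Sum>t\<in>I. M i t * z t) = A" "(\<Sum>s\<in>I. \<Sum>t\<in>I. z s * M s t * z t) = (\<Sum>s\<in>I. \<Sum>t\<in>I. x s * M s t * x t)"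
        using insert.hyps by (auto simp: z_def A_def intro!: sum.cong)
      have "A * A = (\<Sum>s\<in>I. \<Sum>t\<in>I. M i s * x s * (M i t * x t))"
        by (simp add: A_def sum_product)
      then have "(\<Sum>s\<in>I. \<Sum>t\<in>I. x s * M' s t * x t) = (\<Sum>s\<in>I. \<Sum>t\<in>I. x s * M s t * x t) - A * A / d"
        by (simp add: M'_def sum_divide_distrib sum_subtractf algebra_simps)
      moreover have "0 \<le> d * (z i)\<^sup>2 + 2 * z i * A + (\<Sum>s\<in>I. \<Sum>t\<in>I. x s * M s t * x t)"
        using insert.prems(2)[of z] unfolding expand zI .
      moreover have "d * (z i)\<^sup>2 + 2 * z i * A = - (A * A / d)"
        by (cases "d = 0") (simp_all add: z_def power2_eq_square field_simps)
      ultimately show ?thesis by linarith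
    qed
  qed
  then obtain N :: nat and v where v: "\<And>s t. s \<in> I \<Longrightarrow> t \<in> I \<Longrightarrow> M' s t = (\<Sum>k<N. v k s * v k t)"
    by blast
  define v' where "v' k = (case k of 0 \<Rightarrow> (\<lambda>s. M i s / sqrt d) | Suc k \<Rightarrow> (v k)(i := 0))" for k
  have "M s t = (\<Sum>k<Suc N. v' k s * v' k t)" if "s \<in> insert i I" "t \<in> insert i I" for s t
  proof -
    have sum: "(\<Sum>k<Suc N. v' k s * v' k t)
        = M i s * M i t / d + (\<Sum>k<N. ((v k)(i := 0)) s * ((v k)(i := 0)) t)"
      using d unfolding sum.lessThan_Suc_shift by (simp add: v'_def)
    show ?thesis
    proof (cases "s = i \<or> t = i")
      case True
      have row_eq: "M i i * M i r / d = M i r" if "r \<in> insert i I" for r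
        using row[of r] that by (cases "d = 0") (auto simp: d_def)
      from True show ?thesis
      proof
        assume "s = i"
        then show ?thesis unfolding sum using row_eq[OF that(2)] by simp
      next
        assume "t = i"
        then show ?thesis unfolding sum using row_eq[OF that(1)] by (simp add: sym[of s i] mult.commute)
      qed
    next
      case False
      then show ?thesis unfolding sum using that v[of s t] by (simp add: M'_def)
    qed
  qed
  then show ?case by blast
qed

text \<open>An analogue of Choi's theorem. A linear map that respects the involution consists of a
  real value at 1 and a 3 x 3 matrix on the imaginary part; these 10 parameters match the symmetric
  4 x 4 matrices. The hypothesis \<open>pos\<close> is positive semidefiniteness of the matrix of
  \<open>T\<close>, and the rank-one matrices belong to the conjugations.\<close>

lemma quat_map_sum_of_conjugations:
  fixes T :: "quat \<Rightarrow> quat"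
  assumes T: "linear T" "T 1 = 1" "\<And>u. T (star u) = star (T u)"
    and pos: "\<And>x. 0 \<le> inner (star x * x) 1 + inner (star x * Quat 0 1 0 0 * x) (T (Quat 0 1 0 0))
      + inner (star x * Quat 0 0 1 0 * x) (T (Quat 0 0 1 0))
      + inner (star x * Quat 0 0 0 1 * x) (T (Quat 0 0 0 1))"
  shows "\<exists>(N::nat) \<xi>. \<forall>b. T b = (\<Sum>k<N. star (\<xi> k) * b * \<xi> k)"
proof -
  have skew: "Qre (T u) = 0" if "star u = - u" for u
    using T(3)[of u] linear_neg[OF T(1), of u] that by (simp add: quat_eq_iff)
  define r where "r = [Quat 1 0 0 0, Quat 0 1 0 0, Quat 0 0 1 0, Quat 0 0 0 1]"
  obtain a1 a2 a3 b1 b2 b3 c1 c2 c3 where abc: "T (Quat 0 1 0 0) = Quat 0 a1 a2 a3"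
      "T (Quat 0 0 1 0) = Quat 0 b1 b2 b3" "T (Quat 0 0 0 1) = Quat 0 c1 c2 c3"
    using skew by (metis (no_types, opaque_lifting) quat.collapse quat_sel_star quat_sel minus_zero quat_eq_iff quat.sel)
  have Tb: "T b = Quat (Qre b) (Qi b * a1 + Qj b * b1 + Qk b * c1)
      (Qi b * a2 + Qj b * b2 + Qk b * c2) (Qi b * a3 + Qj b * b3 + Qk b * c3)" for b
  proof -
    have "b = Qre b *\<^sub>R 1 + Qi b *\<^sub>R Quat 0 1 0 0 + Qj b *\<^sub>R Quat 0 0 1 0 + Qk b *\<^sub>R Quat 0 0 0 1"
      by (simp add: quat_eq_iff)
    then have "T b = Qre b *\<^sub>R 1 + Qi b *\<^sub>R T (Quat 0 1 0 0) + Qj b *\<^sub>R T (Quat 0 0 1 0)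
        + Qk b *\<^sub>R T (Quat 0 0 0 1)"
      by (metis linear_add[OF T(1)] linear_cmul[OF T(1)] T(2))
    then show ?thesis by (simp add: abc quat_eq_iff)
  qed
  \<comment> \<open>If \<open>T b = star \<xi> * b * \<xi>\<close>, then the inner products of
    \<open>star x * u * x\<close> with \<open>T u\<close>, summed over the four units u, give 4 <x,
    \<xi>>^2, because the products \<open>star u * c * u\<close> sum to 4 Re c. The 8 is this 4
    times the 2 from symmetrising in \<open>s\<close> and \<open>t\<close>.\<close>
  define D where "D s t = (\<Sum>l<4. inner (star (r ! s) * r ! l * r ! t + star (r ! t) * r ! l * r ! s) (T (r ! l))) / 8" for s t
  define S where "S x = (\<Sum>s<4. x s *\<^sub>R r ! s)" for x :: "nat \<Rightarrow> real"
  have sum4: "(\<Sum>k<4. f k) = f 0 + f 1 + f 2 + f 3" for f :: "nat \<Rightarrow> 'b::comm_monoid_add"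
    by (simp add: eval_nat_numeral)
  have rn: "r ! 0 = Quat 1 0 0 0" "r ! 1 = Quat 0 1 0 0" "r ! 2 = Quat 0 0 1 0" "r ! 3 = Quat 0 0 0 1"
    by (simp_all add: r_def eval_nat_numeral)
  have "\<exists>(N::nat) v. \<forall>s\<in>{..<4}. \<forall>t\<in>{..<4}. D s t = (\<Sum>k<N. v k s * v k t)"
  proof (rule psd_rank_one_decomposition)
    show "D s t = D t s" for s t by (simp add: D_def add.commute)
    show "0 \<le> (\<Sum>s<4. \<Sum>t<4. x s * D s t * x t)" for x
    proof -
      have "(\<Sum>s<4. \<Sum>t<4. x s * D s t * x t) = (inner (star (S x) * S x) 1
        + inner (star (S x) * Quat 0 1 0 0 * S x) (T (Quat 0 1 0 0))
        + inner (star (S x) * Quat 0 0 1 0 * S x) (T (Quat 0 0 1 0))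
        + inner (star (S x) * Quat 0 0 0 1 * S x) (T (Quat 0 0 0 1))) / 4"
        unfolding D_def S_def sum4 rn Tb
        by (simp add: inner_quat_def quat_sel_mult field_simps)
      then show ?thesis using pos[of "S x"] by simp
    qed
  qed simp
  then obtain N :: nat and v where v: "\<And>s t. s < 4 \<Longrightarrow> t < 4 \<Longrightarrow> D s t = (\<Sum>k<N. v k s * v k t)"
    by force
  have "T b = (\<Sum>k<N. star (S (v k)) * b * S (v k))" for b
  proof -
    have "(\<Sum>k<N. star (S (v k)) * b * S (v k))
        = (\<Sum>k<N. \<Sum>s<4. \<Sum>t<4. (v k s * v k t) *\<^sub>R (star (r ! s) * b * r ! t))"
      by (rule sum.cong[OF HOL.refl], subst sum.swap[of _ "{..<4}" "{..<4}"])
        (simp add: S_def star_sum sum_distrib_left sum_distrib_right scaleR_sum_right mult.commute)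
    also have "\<dots> = (\<Sum>s<4. \<Sum>t<4. \<Sum>k<N. (v k s * v k t) *\<^sub>R (star (r ! s) * b * r ! t))"
      by (subst sum.swap) (intro sum.cong HOL.refl sum.swap)
    also have "\<dots> = (\<Sum>s<4. \<Sum>t<4. D s t *\<^sub>R (star (r ! s) * b * r ! t))"
      by (intro sum.cong HOL.refl) (simp add: v scaleR_left.sum)
    also have "\<dots> = T b"
      unfolding D_def sum4 rn Tb
      by (simp add: quat_eq_iff inner_quat_def quat_sel_mult field_simps)
    finally show ?thesis by simp
  qed
  then show ?thesis by (intro exI[of _ N] exI[of _ "\<lambda>k. S (v k)"]) simp
qed

section \<open>Approximation by convex combinations\<close>

text \<open>The weights make the series converge for all bounded sequences, and on uniformly bounded
  sets the norm describes coordinatewise convergence. So the product topology acquires a Hilbert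
  space geometry, with distances to minimise and strict convexity.\<close>

definition wip :: "(nat \<Rightarrow> real) \<Rightarrow> (nat \<Rightarrow> real) \<Rightarrow> real" where
  "wip X Y = (suminf (\<lambda>k. (1/2) ^ k * (X k * Y k)))"

lemma wip_bound_summable:
  assumes "\<And>k. \<bar>X k\<bar> \<le> M" "\<And>k. \<bar>Y k\<bar> \<le> M'"
  shows "summable (\<lambda>k. (1/2) ^ k * (X k * Y k))" "\<bar>wip X Y\<bar> \<le> 2 * (M * M')"
proof -
  have M: "0 \<le> M" using assms(1)[of 0] by linarith
  have bd: "norm ((1/2) ^ k * (X k * Y k)) \<le> (1/2) ^ k * (M * M')" for k
    using mult_mono[OF assms(1)[of k] assms(2)[of k] M] by (simp add: abs_mult)
  have sums: "(\<lambda>k. (1/2::real) ^ k * (M * M')) sums (2 * (M * M'))"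
    using sums_mult2[OF geometric_sums[of "1/2::real"], of "M * M'"] by simp
  show s: "summable (\<lambda>k. (1/2) ^ k * (X k * Y k))"
    by (rule summable_comparison_test'[OF sums_summable[OF sums] bd])
  have "norm (wip X Y) \<le> (suminf (\<lambda>k. (1/2) ^ k * (M * M')))"
    unfolding wip_def by (rule norm_suminf_le) (use bd sums in \<open>auto simp: sums_iff\<close>)
  then show "\<bar>wip X Y\<bar> \<le> 2 * (M * M')"
    using sums by (simp add: sums_iff)
qed

definition bseq :: "(nat \<Rightarrow> real) \<Rightarrow> bool" where
  "bseq X \<longleftrightarrow> (\<exists>M. \<forall>k. \<bar>X k\<bar> \<le> M)"

lemma bseqI: "(\<And>k. \<bar>X k\<bar> \<le> M) \<Longrightarrow> bseq X"
  by (auto simp: bseq_def)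

lemma bseq_combine:
  assumes "bseq X" "bseq Y" shows "bseq (\<lambda>k. a * X k + b * Y k)"
proof -
  from assms obtain M M' where M: "\<And>k. \<bar>X k\<bar> \<le> M" "\<And>k. \<bar>Y k\<bar> \<le> M'" by (auto simp: bseq_def)
  have "\<bar>a * X k + b * Y k\<bar> \<le> \<bar>a\<bar> * M + \<bar>b\<bar> * M'" for k
    by (rule order_trans[OF abs_triangle_ineq])
      (simp add: abs_mult add_mono mult_left_mono M)
  then show ?thesis by (rule bseqI)
qed

lemma bseq_diff: "bseq X \<Longrightarrow> bseq Y \<Longrightarrow> bseq (\<lambda>k. X k - Y k)"
  using bseq_combine[of X Y 1 "-1"] by simp

lemma wip_summable: "bseq X \<Longrightarrow> bseq Y \<Longrightarrow> summable (\<lambda>k. (1/2) ^ k * (X k * Y k))"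
  by (auto simp: bseq_def intro: wip_bound_summable)

lemma wip_commute: "wip X Y = wip Y X"
  by (simp add: wip_def mult.commute)

lemma wip_combine:
  assumes "bseq C" "bseq X" "bseq Y"
  shows "wip C (\<lambda>k. a * X k + b * Y k) = a * wip C X + b * wip C Y"
proof -
  have "(\<lambda>k. (1/2) ^ k * (C k * (a * X k + b * Y k)))
      = (\<lambda>k. a * ((1/2) ^ k * (C k * X k)) + b * ((1/2) ^ k * (C k * Y k)))"
    by (simp add: algebra_simps)
  then show ?thesis
    unfolding wip_def
    by (simp add: suminf_add[symmetric] suminf_mult summable_mult wip_summable assms)
qed

lemma wip_diff:
  "bseq C \<Longrightarrow> bseq X \<Longrightarrow> bseq Y \<Longrightarrow> wip C (\<lambda>k. X k - Y k) = wip C X - wip C Y"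
  using wip_combine[of C X Y 1 "-1"] by simp

lemma wip_self_ge:
  assumes "bseq X" shows "(1/2) ^ k * (X k)\<^sup>2 \<le> wip X X"
  using sum_le_suminf[OF wip_summable[OF assms assms], of "{k}"]
  by (simp add: wip_def power2_eq_square)

lemma wip_self_nonneg: "bseq X \<Longrightarrow> 0 \<le> wip X X"
  by (rule order_trans[OF _ wip_self_ge[of X 0]]) auto

lemma continuous_on_weighted_series:
  fixes g :: "nat \<Rightarrow> 'a::topological_space \<Rightarrow> real"
  assumes "\<And>k. continuous_on S (g k)" "\<And>k x. x \<in> S \<Longrightarrow> \<bar>g k x\<bar> \<le> M"
  shows "continuous_on S (\<lambda>x. suminf (\<lambda>k. (1/2) ^ k * g k x))"
proof (rule uniform_limit_theorem)
  show "uniform_limit S (\<lambda>n x. \<Sum>k<n. (1/2) ^ k * g k x) (\<lambda>x. suminf (\<lambda>k. (1/2) ^ k * g k x)) sequentially"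
    by (rule Weierstrass_m_test[where M = "\<lambda>k. (1/2) ^ k * M"])
      (auto simp: abs_mult assms mult_left_mono intro!: summable_mult2 summable_geometric)
  show "\<forall>\<^sub>F n in sequentially. continuous_on S (\<lambda>x. \<Sum>k<n. (1/2) ^ k * g k x)"
    by (intro always_eventually allI continuous_intros assms)
qed simp

text \<open>The nodes \<open>t k\<close> are kept as points of \<open>K\<close>, so that a mixture
  can later be read as the integrals of the \<open>F i\<close> against a finitely supported
  probability measure on \<open>K\<close>.\<close>

definition mixtures :: "'e set \<Rightarrow> ('i \<Rightarrow> 'e \<Rightarrow> real) \<Rightarrow> ('i \<Rightarrow> real) set" where
  "mixtures K F = {z. \<exists>(N::nat) c t. (\<forall>k<N. 0 \<le> c k \<and> t k \<in> K) \<and> (\<Sum>k<N. c k) = 1 \<and>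
     (\<forall>i. z i = (\<Sum>k<N. c k * F i (t k)))}"

lemma mixtures_step:
  assumes "z \<in> mixtures K F" "t \<in> K" "0 \<le> s" "s \<le> 1"
  shows "(\<lambda>i. (1 - s) * z i + s * F i t) \<in> mixtures K F"
proof -
  obtain N :: nat and c u where z: "\<And>k. k < N \<Longrightarrow> 0 \<le> c k \<and> u k \<in> K" "(\<Sum>k<N. c k) = 1"
    "\<And>i. z i = (\<Sum>k<N. c k * F i (u k))"
    using assms(1) by (auto simp: mixtures_def)
  define c' where "c' k = (if k < N then (1 - s) * c k else s)" for k
  define u' where "u' k = (if k < N then u k else t)" for k
  have "(\<Sum>k<Suc N. c' k) = (1 - s) * (\<Sum>k<N. c k) + s"
    by (simp add: c'_def sum_distrib_left)
  moreover have "(1 - s) * z i + s * F i t = (\<Sum>k<Suc N. c' k * F i (u' k))" for i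
    by (simp add: c'_def u'_def z(3) sum_distrib_left mult.assoc)
  moreover have "\<forall>k<Suc N. 0 \<le> c' k \<and> u' k \<in> K"
    using z(1) assms by (auto simp: c'_def u'_def)
  ultimately show ?thesis
    unfolding mixtures_def mem_Collect_eq z(2)
    by (intro exI[of _ "Suc N"] exI[of _ c'] exI[of _ u']) simp
qed

lemma mixtures_bounded:
  assumes "z \<in> mixtures K F" "\<And>t. t \<in> K \<Longrightarrow> \<bar>F i t\<bar> \<le> b"
  shows "\<bar>z i\<bar> \<le> b"
proof -
  obtain N :: nat and c u where z: "\<And>k. k < N \<Longrightarrow> 0 \<le> c k \<and> u k \<in> K" "(\<Sum>k<N. c k) = 1"
    "\<And>i. z i = (\<Sum>k<N. c k * F i (u k))"
    using assms(1) by (auto simp: mixtures_def)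
  have "\<bar>z i\<bar> \<le> (\<Sum>k<N. \<bar>c k * F i (u k)\<bar>)" unfolding z(3) by (rule sum_abs)
  also have "\<dots> \<le> (\<Sum>k<N. c k * b)"
    using z(1) assms(2) by (intro sum_mono) (auto simp: abs_mult intro!: mult_left_mono)
  also have "\<dots> = b" by (simp add: z(2) flip: sum_distrib_right)
  finally show ?thesis .
qed

lemma wip_mixture_le:
  assumes z: "z \<in> mixtures K F" and C: "bseq C" and F: "\<And>t k. t \<in> K \<Longrightarrow> \<bar>F (e k) t / q k\<bar> \<le> 1"
    and le: "\<And>t. t \<in> K \<Longrightarrow> wip C (\<lambda>k. F (e k) t / q k) \<le> \<alpha>"
  shows "wip C (\<lambda>k. z (e k) / q k) \<le> \<alpha>"
proof -
  obtain N :: nat and c u where z: "\<And>k. k < N \<Longrightarrow> 0 \<le> c k \<and> u k \<in> K" "(\<Sum>k<N. c k) = 1"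
    "\<And>i. z i = (\<Sum>k<N. c k * F i (u k))"
    using assms(1) by (auto simp: mixtures_def)
  have "n \<le> N \<Longrightarrow> bseq (\<lambda>k. \<Sum>j<n. c j * (F (e k) (u j) / q k)) \<and>
     wip C (\<lambda>k. \<Sum>j<n. c j * (F (e k) (u j) / q k)) = (\<Sum>j<n. c j * wip C (\<lambda>k. F (e k) (u j) / q k))" for n
  proof (induction n)
    case 0
    show ?case by (auto simp: wip_def intro: bseqI[of _ 0])
  next
    case (Suc n)
    have b: "bseq (\<lambda>k. F (e k) (u n) / q k)"
      using z(1)[of n] Suc.prems F by (intro bseqI[of _ 1]) auto
    from Suc have IH: "bseq (\<lambda>k. \<Sum>j<n. c j * (F (e k) (u j) / q k))"
        "wip C (\<lambda>k. \<Sum>j<n. c j * (F (e k) (u j) / q k)) = (\<Sum>j<n. c j * wip C (\<lambda>k. F (e k) (u j) / q k))"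
      by auto
    show ?case
      using bseq_combine[OF IH(1) b, of 1 "c n"] wip_combine[OF C IH(1) b, of 1 "c n"] IH(2) by simp
  qed
  from this[of N] have "wip C (\<lambda>k. z (e k) / q k) = (\<Sum>j<N. c j * wip C (\<lambda>k. F (e k) (u j) / q k))"
    by (simp add: z(3) sum_divide_distrib)
  also have "\<dots> \<le> (\<Sum>j<N. c j * \<alpha>)"
    using z(1) le by (intro sum_mono mult_left_mono) auto
  also have "\<dots> = \<alpha>" by (simp add: z(2) flip: sum_distrib_right)
  finally show ?thesis .
qed

section \<open>Extreme points as maximisers of linear functionals\<close>

lemma compact_level_set:
  fixes f :: "'a::topological_space \<Rightarrow> real"
  assumes "compact S" "continuous_on S f"
  shows "compact {x \<in> S. f x = a}"
proof -
  have "closedin (top_of_set S) (S \<inter> f -` {a})"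
    by (intro continuous_closedin_preimage assms closed_singleton)
  then have "compact (S \<inter> f -` {a})" by (rule closedin_compact[OF assms(1)])
  moreover have "S \<inter> f -` {a} = {x \<in> S. f x = a}" by auto
  ultimately show ?thesis by simp
qed

text \<open>A maximiser of a strictly convex function on the face of maximisers of a linear function is
  an extreme point.\<close>

lemma wip_maximal_extreme_point:
  fixes S :: "('i \<Rightarrow> real) set"
  assumes S: "compact S" "S \<noteq> {}" and q: "\<And>k. q k > 0"
    and bd: "\<And>x k. x \<in> S \<Longrightarrow> \<bar>x (e k) / q k\<bar> \<le> 1" and C: "\<And>k. \<bar>C k\<bar> \<le> M"
    and sep: "\<And>x z. x \<in> S \<Longrightarrow> z \<in> S \<Longrightarrow> (\<And>k. x (e k) = z (e k)) \<Longrightarrow> x = z"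
  shows "\<exists>x. extreme_in S x \<and> (\<forall>z\<in>S. wip C (\<lambda>k. z (e k) / q k) \<le> wip C (\<lambda>k. x (e k) / q k))"
proof -
  define X where "X x k = x (e k) / q k" for x :: "'i \<Rightarrow> real" and k
  have bX: "bseq (X x)" if "x \<in> S" for x
    using bd[OF that] by (intro bseqI[of _ 1]) (simp add: X_def)
  have bC: "bseq C" by (rule bseqI[OF C])
  have cX: "continuous_on S (\<lambda>x. X x k)" for k
    unfolding X_def by (intro continuous_intros continuous_on_subset[OF continuous_on_product_coordinates]) 
      (use q in \<open>auto simp: less_le\<close>)
  have M: "0 \<le> M" using C[of 0] by linarith
  have cf: "continuous_on S (\<lambda>x. wip C (X x))"
    unfolding wip_def
  proof (rule continuous_on_weighted_series)
    show "continuous_on S (\<lambda>x. C k * X x k)" for k by (intro continuous_intros cX)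
    show "\<bar>C k * X x k\<bar> \<le> M * 1" if "x \<in> S" for k x
      unfolding abs_mult by (rule mult_mono) (use C M bd[OF that] in \<open>auto simp: X_def\<close>)
  qed
  have cQ: "continuous_on S (\<lambda>x. wip (X x) (X x))"
    unfolding wip_def
  proof (rule continuous_on_weighted_series)
    show "continuous_on S (\<lambda>x. X x k * X x k)" for k by (intro continuous_intros cX)
    show "\<bar>X x k * X x k\<bar> \<le> 1 * 1" if "x \<in> S" for k x
      unfolding abs_mult by (rule mult_mono) (use bd[OF that] in \<open>auto simp: X_def\<close>)
  qed
  obtain x0 where x0: "x0 \<in> S" "\<And>z. z \<in> S \<Longrightarrow> wip C (X z) \<le> wip C (X x0)"
    using continuous_attains_sup[OF S cf] by blast
  define Face where "Face = {x \<in> S. wip C (X x) = wip C (X x0)}"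
  have "compact Face" unfolding Face_def by (rule compact_level_set[OF S(1) cf])
  moreover have "Face \<noteq> {}" using x0 by (auto simp: Face_def)
  moreover have "continuous_on Face (\<lambda>x. wip (X x) (X x))"
    by (rule continuous_on_subset[OF cQ]) (auto simp: Face_def)
  ultimately obtain x where x: "x \<in> Face" "\<And>z. z \<in> Face \<Longrightarrow> wip (X z) (X z) \<le> wip (X x) (X x)"
    by (elim continuous_attains_sup[THEN bexE]) blast+
  have xS: "x \<in> S" and fx: "wip C (X x) = wip C (X x0)" using x by (auto simp: Face_def)
  have "a = b" if ab: "a \<in> S" "b \<in> S" "0 < s" "s < 1" "\<And>i. x i = (1 - s) * a i + s * b i" for a b s
  proof -
    note B = bX[OF ab(1)] bX[OF ab(2)]
    have Xx: "X x = (\<lambda>k. (1 - s) * X a k + s * X b k)"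
      by (simp add: fun_eq_iff X_def ab(5) add_divide_distrib)
    have f: "wip C (X x) = (1 - s) * wip C (X a) + s * wip C (X b)"
      unfolding Xx by (rule wip_combine[OF bC B])
    have le: "wip C (X a) \<le> wip C (X x)" "wip C (X b) \<le> wip C (X x)"
      using x0(2) ab fx by auto
    \<comment> \<open>Two nonnegative gaps with sum 0: both ends of the segment lie on the
      face.\<close>
    have "(1 - s) * (wip C (X x) - wip C (X a)) + s * (wip C (X x) - wip C (X b)) = 0"
      using f by (simp add: algebra_simps)
    moreover have "0 \<le> (1 - s) * (wip C (X x) - wip C (X a))" "0 \<le> s * (wip C (X x) - wip C (X b))"
      using le ab by auto
    ultimately have "(1 - s) * (wip C (X x) - wip C (X a)) = 0" "s * (wip C (X x) - wip C (X b)) = 0"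
      by linarith+
    then have "a \<in> Face" "b \<in> Face" using ab fx by (auto simp: Face_def)
    then have Q: "wip (X a) (X a) \<le> wip (X x) (X x)" "wip (X b) (X b) \<le> wip (X x) (X x)"
      using x(2) by auto
    define d where "d k = X a k - X b k" for k
    have bd': "bseq d" unfolding d_def by (rule bseq_diff[OF B])
    have dd: "wip d d = wip (X a) (X a) - 2 * wip (X a) (X b) + wip (X b) (X b)"
      using wip_diff[OF bd' B] wip_diff[OF B(1) B] wip_diff[OF B(2) B]
      unfolding d_def[symmetric] by (simp add: wip_commute)
    have "wip (X x) (X x) = (1 - s) * wip (X x) (X a) + s * wip (X x) (X b)"
      by (subst (2) Xx) (rule wip_combine[OF bX[OF xS] B])
    also have "wip (X x) (X a) = (1 - s) * wip (X a) (X a) + s * wip (X a) (X b)"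
      unfolding wip_commute[of "X x"] by (subst Xx) (rule wip_combine[OF B(1) B])
    also have "wip (X x) (X b) = (1 - s) * wip (X a) (X b) + s * wip (X b) (X b)"
      unfolding wip_commute[of "X x"] wip_commute[of "X a" "X b"]
      by (subst Xx) (rule wip_combine[OF B(2) B])
    \<comment> \<open>Strict convexity in explicit form: the defect is s (1 - s) times the squared
      distance of the ends, so maximality of \<open>x\<close> on the face makes this distance
      0.\<close>
    finally have "wip (X x) (X x)
        = (1 - s) * wip (X a) (X a) + s * wip (X b) (X b) - s * (1 - s) * wip d d"
      unfolding dd by (simp add: algebra_simps)
    moreover have "(1 - s) * wip (X a) (X a) + s * wip (X b) (X b) \<le> wip (X x) (X x)"
      using convex_bound_le[OF Q(1) Q(2), of "1 - s" s] ab by simp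
    ultimately have "s * (1 - s) * wip d d \<le> 0" by linarith
    then have "wip d d \<le> 0" using ab by (simp add: mult_le_0_iff)
    have Xab: "X a k = X b k" for k
    proof -
      have "(1/2) ^ k * (d k)\<^sup>2 \<le> 0"
        using wip_self_ge[OF bd', of k] \<open>wip d d \<le> 0\<close> by linarith
      moreover have "(0::real) < (1/2) ^ k" by simp
      ultimately have "(d k)\<^sup>2 \<le> 0" by (metis mult_le_cancel_left_pos mult_zero_right)
      then show ?thesis by (simp add: d_def)
    qed
    have "a (e k) = b (e k)" for k
      using Xab[of k] q[of k] by (simp add: X_def)
    then show ?thesis by (rule sep[OF ab(1,2)])
  qed
  then have "extreme_in S x" unfolding extreme_in_def using xS by blast
  then show ?thesis using x0(2) fx unfolding X_def by auto
qed

text \<open>If \<open>z\<close> nearly minimises the distance to \<open>y\<close> among the mixtures, then the linear functional given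
  by \<open>y - z\<close> is nearly maximal at \<open>z\<close> among the mixtures, hence also on \<open>S\<close>, because its
  maximum on \<open>S\<close> is attained at an extreme point.  Its values at \<open>y\<close> and \<open>z\<close> are therefore close.\<close>

theorem approximation_by_mixtures:
  fixes S :: "('i \<Rightarrow> real) set" and e :: "nat \<Rightarrow> 'i"
  assumes S: "compact S" and bdS: "\<And>x i. x \<in> S \<Longrightarrow> \<bar>x i\<bar> \<le> B i"
    and bdF: "\<And>t i. t \<in> K \<Longrightarrow> \<bar>F i t\<bar> \<le> B i"
    and sep: "\<And>x z. x \<in> S \<Longrightarrow> z \<in> S \<Longrightarrow> (\<And>k. x (e k) = z (e k)) \<Longrightarrow> x = z"
    and ext: "\<And>x. extreme_in S x \<Longrightarrow> x \<in> mixtures K F" and y: "y \<in> S"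
  shows "\<exists>Z. (\<forall>n. Z n \<in> mixtures K F) \<and> (\<forall>k. (\<lambda>n. Z n (e k)) \<longlonglongrightarrow> y (e k))"
proof -
  \<comment> \<open>Adding 1 keeps the scale positive where the bound is 0; the scaled coordinates
    lie in [-1, 1].\<close>
  define q where "q k = 1 + B (e k)" for k
  have B: "0 \<le> B i" for i using bdS[OF y, of i] by linarith
  have q: "q k > 0" for k using B[of "e k"] by (simp add: q_def)
  define X where "X x k = x (e k) / q k" for x :: "'i \<Rightarrow> real" and k
  have scaled: "\<bar>r / q k\<bar> \<le> 1" if "\<bar>r\<bar> \<le> B (e k)" for r k
    using that q[of k] by (simp add: abs_divide q_def)
  have XS: "\<bar>X x k\<bar> \<le> 1" if "x \<in> S" for x k
    using scaled[OF bdS[OF that]] by (simp only: X_def)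
  have XF: "\<bar>X (\<lambda>i. F i t) k\<bar> \<le> 1" if "t \<in> K" for t k
    using scaled[OF bdF[OF that]] by (simp only: X_def)
  have XM: "\<bar>X z k\<bar> \<le> 1" if "z \<in> mixtures K F" for z k
    using scaled[OF mixtures_bounded[OF that bdF]] by (simp only: X_def)
  have bY: "bseq (X y)" by (rule bseqI[OF XS[OF y]])
  define D where "D z = wip (\<lambda>k. X y k - X z k) (\<lambda>k. X y k - X z k)" for z
  \<comment> \<open>Maximising the zero functional yields some extreme point, so there is a mixture
    and the infimal distance below is meaningful.\<close>
  have "\<exists>x. extreme_in S x"
    using wip_maximal_extreme_point[OF S, where e = e and q = q and C = "\<lambda>_. 0" and M = 0]
      q XS sep y unfolding X_def by auto
  then obtain m0 where m0: "m0 \<in> mixtures K F" using ext by blast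
  have D0: "0 \<le> D z" if "z \<in> mixtures K F" for z
    unfolding D_def by (intro wip_self_nonneg bseq_diff bY bseqI[OF XM[OF that]])
  define d where "d = Inf (D ` mixtures K F)"
  have bdd: "bdd_below (D ` mixtures K F)" using D0 by (intro bdd_belowI2[of _ 0]) auto
  have d_le: "d \<le> D z" if "z \<in> mixtures K F" for z
    unfolding d_def using that bdd by (intro cInf_lower) auto
  \<comment> \<open>Origin of the 5: a step \<sigma> from z towards a node changes \<open>D\<close>
    by -2 \<sigma> <C, E> + \<sigma>^2 <E, E> with <E, E> at most 8, while \<open>D z\<close> is
    within \<sigma>^2 of its infimum. Hence 2 \<sigma> <C, E> is at most 9 \<sigma>^2, rounded up to
    10 \<sigma>^2.\<close>
  have "\<exists>z\<in>mixtures K F. D z \<le> 5 * \<sigma>" if \<sigma>: "0 < \<sigma>" "\<sigma> \<le> 1" for \<sigma>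
  proof -
    have "\<exists>r\<in>D ` mixtures K F. r < d + \<sigma>\<^sup>2"
      using m0 bdd \<sigma> unfolding d_def by (subst cInf_less_iff[symmetric]) auto
    then obtain z where z: "z \<in> mixtures K F" "D z < d + \<sigma>\<^sup>2" by blast
    define C where "C k = X y k - X z k" for k
    have bz: "bseq (X z)" by (rule bseqI[OF XM[OF z(1)]])
    have C2: "\<bar>C k\<bar> \<le> 2" for k
      using XS[OF y, of k] XM[OF z(1), of k] unfolding C_def by linarith
    have bC: "bseq C" by (rule bseqI[OF C2])
    have *: "wip C (X (\<lambda>i. F i t)) \<le> wip C (X z) + 5 * \<sigma>" if t: "t \<in> K" for t
    proof -
      define E where "E k = X (\<lambda>i. F i t) k - X z k" for k
      have bF: "bseq (X (\<lambda>i. F i t))" by (rule bseqI[OF XF[OF t]])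
      have E2: "\<bar>E k\<bar> \<le> 2" for k
        using XF[OF t, of k] XM[OF z(1), of k] unfolding E_def by linarith
      have bE: "bseq E" by (rule bseqI[OF E2])
      define z' where "z' = (\<lambda>i. (1 - \<sigma>) * z i + \<sigma> * F i t)"
      have "z' \<in> mixtures K F" unfolding z'_def using mixtures_step[OF z(1) t] \<sigma> by simp
      then have "d \<le> D z'" by (rule d_le)
      also have "(\<lambda>k. X y k - X z' k) = (\<lambda>k. C k - \<sigma> * E k)"
        by (simp add: X_def z'_def C_def E_def fun_eq_iff add_divide_distrib diff_divide_distrib algebra_simps)
      then have "D z' = wip (\<lambda>k. C k - \<sigma> * E k) (\<lambda>k. C k - \<sigma> * E k)"
        by (simp add: D_def)
      also have "\<dots> = wip C C - 2 * \<sigma> * wip C E + \<sigma>\<^sup>2 * wip E E"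
      proof -
        have lin: "wip A (\<lambda>k. C k - \<sigma> * E k) = wip A C - \<sigma> * wip A E" if "bseq A" for A
          using wip_combine[OF that bC bE, of 1 "-\<sigma>"] by simp
        have "bseq (\<lambda>k. C k - \<sigma> * E k)" using bseq_combine[OF bC bE, of 1 "-\<sigma>"] by simp
        from lin[OF this] have "wip (\<lambda>k. C k - \<sigma> * E k) (\<lambda>k. C k - \<sigma> * E k)
            = wip C (\<lambda>k. C k - \<sigma> * E k) - \<sigma> * wip E (\<lambda>k. C k - \<sigma> * E k)"
          by (simp only: wip_commute[of _ C] wip_commute[of _ E])
        then show ?thesis
          unfolding lin[OF bC] lin[OF bE] wip_commute[of E C]
          by (simp add: power2_eq_square algebra_simps)
      qed
      also have "wip C C = D z" by (simp add: D_def C_def[abs_def])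
      finally have "2 * \<sigma> * wip C E \<le> \<sigma>\<^sup>2 + \<sigma>\<^sup>2 * wip E E" using z(2) by linarith
      also have "\<dots> \<le> \<sigma>\<^sup>2 + \<sigma>\<^sup>2 * 8"
        using wip_bound_summable(2)[of E 2 E 2] E2 by (intro add_left_mono mult_left_mono) auto
      also have "\<dots> \<le> 2 * \<sigma> * (5 * \<sigma>)" by (simp add: power2_eq_square)
      finally have "wip C E \<le> 5 * \<sigma>" using \<sigma> by simp
      then show ?thesis using wip_diff[OF bC bF bz] by (simp add: E_def[abs_def])
    qed
    obtain x where x: "extreme_in S x" "\<And>z. z \<in> S \<Longrightarrow> wip C (X z) \<le> wip C (X x)"
      using wip_maximal_extreme_point[OF S, where e = e and q = q and C = C and M = 2]
        q XS sep y C2 unfolding X_def by blast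
    have "wip C (X y) \<le> wip C (X x)" by (rule x(2)[OF y])
    also have "\<dots> \<le> wip C (X z) + 5 * \<sigma>"
      unfolding X_def[abs_def]
      by (rule wip_mixture_le[OF ext[OF x(1)] bC]) (use XF * in \<open>auto simp: X_def[abs_def]\<close>)
    finally have "D z \<le> 5 * \<sigma>"
      using wip_diff[OF bC bY bz] by (simp add: D_def C_def[abs_def])
    with z(1) show ?thesis by blast
  qed
  then have "\<forall>n. \<exists>z\<in>mixtures K F. D z \<le> 5 * inverse (real (Suc n))"
    by (simp add: inverse_le_1_iff)
  then obtain Z where Z: "\<And>n. Z n \<in> mixtures K F" "\<And>n. D (Z n) \<le> 5 * inverse (real (Suc n))"
    by metis
  have "(\<lambda>n. Z n (e k)) \<longlonglongrightarrow> y (e k)" for k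
  proof -
    have le: "(X y k - X (Z n) k)\<^sup>2 \<le> 2 ^ k * (5 * inverse (real (Suc n)))" for n
    proof -
      have "(1/2) ^ k * (X y k - X (Z n) k)\<^sup>2 \<le> D (Z n)"
        unfolding D_def by (intro wip_self_ge bseq_diff bY bseqI[OF XM[OF Z(1)]])
      also have "\<dots> \<le> 5 * inverse (real (Suc n))" by (rule Z(2))
      finally show ?thesis by (simp add: power_divide field_simps)
    qed
    have "(\<lambda>n. 2 ^ k * (5 * inverse (real (Suc n)))) \<longlonglongrightarrow> 2 ^ k * (5 * 0)"
      by (intro tendsto_intros LIMSEQ_inverse_real_of_nat)
    then have "(\<lambda>n. 2 ^ k * (5 * inverse (real (Suc n)))) \<longlonglongrightarrow> 0" by simp
    then have "(\<lambda>n. (X y k - X (Z n) k)\<^sup>2) \<longlonglongrightarrow> 0"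
      by (rule tendsto_sandwich[OF _ _ tendsto_const, rotated 2]) (use le in auto)
    then have "(\<lambda>n. X y k - X (Z n) k) \<longlonglongrightarrow> 0"
      by (simp add: power_tendsto_0_iff)
    then have "(\<lambda>n. y (e k) - q k * (X y k - X (Z n) k)) \<longlonglongrightarrow> y (e k) - q k * 0"
      by (intro tendsto_intros)
    moreover have "y (e k) - q k * (X y k - X (Z n) k) = Z n (e k)" for n
      using q[of k] by (simp add: X_def field_simps)
    ultimately show ?thesis by simp
  qed
  with Z(1) show ?thesis by blast
qed

section \<open>A space-filling curve\<close>

text \<open>Schoenberg's construction: the bits of the coordinates are interleaved into base 5 digits of the
  parameter \<open>t\<close>, with 1 for the bit 1 and 3 for the bit 0, and the 1-periodic gate at \<open>5\<^sup>m t\<close> reads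
  off the \<open>m\<close>-th bit.\<close>

definition curve_gate :: "real \<Rightarrow> real" where
  "curve_gate t = max 0 (min 1 (1/2 + sin (2 * pi * t)))"

lemma curve_gate_range: "0 \<le> curve_gate t" "curve_gate t \<le> 1"
  by (auto simp: curve_gate_def)

lemma continuous_on_curve_gate:
  fixes f :: "'a::t2_space \<Rightarrow> real"
  assumes "continuous_on S f" shows "continuous_on S (\<lambda>t. curve_gate (f t))"
  unfolding curve_gate_def
  by (intro continuous_on_max continuous_on_min continuous_on_add continuous_on_sin
      continuous_on_mult continuous_on_const assms)

lemma curve_gate_add_of_nat: "curve_gate (real n + t) = curve_gate t"
proof -
  have "2 * pi * (real n + t) = 2 * pi * t + 2 * real n * pi"
    by (simp add: algebra_simps)
  then have "sin (2 * pi * (real n + t)) = sin (2 * pi * t)"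
    by (simp only: sin_add cos_2npi sin_2npi)
  then show ?thesis by (simp add: curve_gate_def)
qed

lemma sin_ge_half:
  assumes "pi / 6 \<le> x" "x \<le> pi / 2" shows "1/2 \<le> sin x"
proof -
  have "sin (pi / 6) \<le> sin x"
    using assms pi_gt_zero by (intro sin_monotone_2pi_le) linarith+
  then show ?thesis by (simp add: sin_30)
qed

text \<open>The interval is (1 + [1/4, 3/4]) / 5, the range of \<open>base5 d\<close> for leading
  digit 1; for leading digit 3 it is [13/20, 3/4]. There the sine is at least 1/2, respectively at
  most -1/2, and clipping gives exactly 1, respectively 0.\<close>

lemma curve_gate_eq_1:
  assumes "1/4 \<le> t" "t \<le> 7/20" shows "curve_gate t = 1"
proof -
  have "pi / 6 \<le> pi - 2 * pi * t"
  proof -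
    have "pi * t \<le> pi * (7/20)" using assms by (intro mult_left_mono) auto
    then show ?thesis using pi_gt_zero by linarith
  qed
  moreover have "pi - 2 * pi * t \<le> pi / 2"
  proof -
    have "pi * (1/4) \<le> pi * t" using assms by (intro mult_left_mono) auto
    then show ?thesis by linarith
  qed
  ultimately have "1/2 \<le> sin (pi - 2 * pi * t)" by (rule sin_ge_half)
  then show ?thesis unfolding sin_pi_minus by (simp add: curve_gate_def)
qed

lemma curve_gate_eq_0:
  assumes "13/20 \<le> t" "t \<le> 3/4" shows "curve_gate t = 0"
proof -
  have "pi / 6 \<le> 2 * pi * t - pi"
  proof -
    have "pi * (13/20) \<le> pi * t" using assms by (intro mult_left_mono) auto
    then show ?thesis using pi_gt_zero by linarith
  qed
  moreover have "2 * pi * t - pi \<le> pi / 2"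
  proof -
    have "pi * t \<le> pi * (3/4)" using assms by (intro mult_left_mono) auto
    then show ?thesis by linarith
  qed
  ultimately have "1/2 \<le> sin (2 * pi * t - pi)" by (rule sin_ge_half)
  then have "sin (2 * pi * t) \<le> - (1/2)" by (simp add: sin_diff)
  then show ?thesis by (simp add: curve_gate_def)
qed

text \<open>Digit \<open>l\<close> has weight 5^-(l+1), so multiplication by 5^m brings digit
  \<open>m\<close> to the first place after the point. Using only 1 and 3 leaves a gap in which the
  continuous gate can fall from 1 to 0.\<close>

definition base5 :: "(nat \<Rightarrow> bool) \<Rightarrow> real" where
  "base5 d = suminf (\<lambda>l. (if d l then 1 else 3) * (1/5) ^ Suc l)"

lemma base5_summable: "summable (\<lambda>l. (if d l then 1 else 3) * (1/5::real) ^ Suc l)"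
proof (rule summable_comparison_test')
  show "summable (\<lambda>l. 3 * (1/5::real) ^ Suc l)"
    by (intro summable_mult) (simp add: summable_geometric summable_mult)
qed auto

lemma base5_bounds: "1/4 \<le> base5 d" "base5 d \<le> 3/4"
proof -
  have s: "(\<lambda>l. (1/5::real) ^ Suc l) sums (1/4)"
    using sums_mult[OF geometric_sums[of "1/5::real"], of "1/5"] by simp
  have "(1/4::real) = suminf (\<lambda>l. (1/5) ^ Suc l)" using s by (simp add: sums_iff)
  also have "\<dots> \<le> base5 d"
    unfolding base5_def by (rule suminf_le[OF _ sums_summable[OF s] base5_summable]) auto
  finally show "1/4 \<le> base5 d" .
  have s3: "(\<lambda>l. 3 * (1/5::real) ^ Suc l) sums (3/4)"
    using sums_mult[OF s, of 3] by simp
  have "base5 d \<le> suminf (\<lambda>l. 3 * (1/5) ^ Suc l)"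
    unfolding base5_def by (rule suminf_le[OF _ base5_summable sums_summable[OF s3]]) auto
  also have "\<dots> = 3/4" using s3 by (simp add: sums_iff)
  finally show "base5 d \<le> 3/4" .
qed

lemma base5_shift: "5 * base5 d = (if d 0 then 1 else 3) + base5 (\<lambda>l. d (Suc l))"
proof -
  have "base5 d = (if d 0 then 1 else 3) * (1/5) ^ Suc 0
      + suminf (\<lambda>l. (if d (Suc l) then 1 else 3) * (1/5) ^ Suc (Suc l))"
    unfolding base5_def by (subst suminf_split_head[OF base5_summable]) simp
  also have "suminf (\<lambda>l. (if d (Suc l) then 1 else 3) * (1/5::real) ^ Suc (Suc l))
      = suminf (\<lambda>l. ((if d (Suc l) then 1 else 3) * (1/5) ^ Suc l) * (1/5))"
    by (intro arg_cong[where f = suminf]) (simp add: fun_eq_iff)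
  also have "\<dots> = base5 (\<lambda>l. d (Suc l)) * (1/5)"
    unfolding base5_def by (rule suminf_mult2[OF base5_summable, symmetric])
  finally show ?thesis by simp
qed

lemma base5_shift_n: "\<exists>n::nat. 5 ^ m * base5 d = real n + base5 (\<lambda>l. d (m + l))"
proof (induction m)
  case 0
  show ?case by (auto intro: exI[of _ 0])
next
  case (Suc m)
  then obtain n :: nat where "5 ^ m * base5 d = real n + base5 (\<lambda>l. d (m + l))" by blast
  then have "5 ^ Suc m * base5 d = 5 * real n + 5 * base5 (\<lambda>l. d (m + l))" by simp
  also have "\<dots> = real (5 * n + (if d m then 1 else 3)) + base5 (\<lambda>l. d (Suc m + l))"
    by (subst base5_shift) simp
  finally show ?case by blast
qed

lemma curve_gate_base5: "curve_gate (5 ^ m * base5 d) = (if d m then 1 else 0)"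
proof -
  obtain n :: nat where n: "5 ^ m * base5 d = real n + base5 (\<lambda>l. d (m + l))"
    using base5_shift_n by blast
  have "5 * base5 (\<lambda>l. d (m + l)) = (if d m then 1 else 3) + base5 (\<lambda>l. d (m + Suc l))"
    using base5_shift[of "\<lambda>l. d (m + l)"] by simp
  then show ?thesis
    unfolding n curve_gate_add_of_nat
    using base5_bounds[of "\<lambda>l. d (m + Suc l)"] by (auto intro!: curve_gate_eq_1 curve_gate_eq_0)
qed

text \<open>Greedy doubling: \<open>r k\<close> is 2^k times what is left after k bits. The series
  has the shape of the curve's coordinates, with the bit in place of the gate.\<close>

lemma binary_expansion:
  fixes v :: real
  assumes "0 \<le> v" "v \<le> 1"
  shows "\<exists>b. (\<lambda>k. (1/2) ^ k * ((if b k then 1 else 0) / 2)) sums v"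
proof -
  define r where "r = rec_nat v (\<lambda>_ x. if x \<ge> 1/2 then 2 * x - 1 else 2 * x)"
  have r0: "r 0 = v" and rS: "r (Suc k) = (if r k \<ge> 1/2 then 2 * r k - 1 else 2 * r k)" for k
    by (simp_all add: r_def)
  have r: "0 \<le> r k \<and> r k \<le> 1" for k
    by (induction k) (auto simp: r0 rS assms)
  have part: "(\<Sum>k<n. (1/2) ^ k * ((if r k \<ge> 1/2 then 1 else 0) / 2)) = v - (1/2) ^ n * r n" for n
    by (induction n) (auto simp: r0 rS algebra_simps diff_divide_distrib)
  have "(\<lambda>n. (1/2) ^ n * r n) \<longlonglongrightarrow> 0"
  proof (rule tendsto_sandwich[OF _ _ tendsto_const])
    show "(\<lambda>n. (1/2::real) ^ n) \<longlonglongrightarrow> 0" by (intro LIMSEQ_power_zero) simp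
  qed (use r in \<open>auto intro!: always_eventually mult_left_le\<close>)
  then have "(\<lambda>n. v - (1/2) ^ n * r n) \<longlonglongrightarrow> v - 0" by (intro tendsto_intros)
  then have "(\<lambda>k. (1/2) ^ k * ((if r k \<ge> 1/2 then 1 else 0) / 2)) sums v"
    unfolding sums_def part by simp
  then show ?thesis by (intro exI[of _ "\<lambda>k. r k \<ge> 1/2"])
qed

text \<open>Continuity and boundedness hold on the whole line, so that compositions of continuous
  functions with the curve are test functions for weak convergence of measures on the line.\<close>

lemma space_filling_curve:
  "\<exists>\<phi>::real \<Rightarrow> 'e::euclidean_space. continuous_on UNIV \<phi> \<and> bounded (range \<phi>) \<and> cball 0 \<rho> \<subseteq> \<phi> ` {0..1}"
proof -
  define N where "N = DIM('e)"
  obtain b :: "nat \<Rightarrow> 'e" where b: "bij_betw b {..<N} Basis"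
    using ex_bij_betw_nat_finite[of "Basis :: 'e set"] by (auto simp: N_def atLeast0LessThan)
  have N: "N > 0" by (simp add: N_def)
  define x where "x j t = suminf (\<lambda>k. (1/2) ^ k * (curve_gate (5 ^ (k * N + j) * t) / 2))" for j t
  have gate: "\<bar>curve_gate t / 2\<bar> \<le> 1" for t
    using curve_gate_range[of t] by simp
  have x_cont: "continuous_on UNIV (x j)" for j
    unfolding x_def
  proof (rule continuous_on_weighted_series)
    show "continuous_on UNIV (\<lambda>t. curve_gate (5 ^ (k * N + j) * t) / 2)" for k
      by (intro continuous_intros continuous_on_curve_gate) simp
  qed (rule gate)
  have x_bd: "\<bar>x j t\<bar> \<le> 2" for j t
    using wip_bound_summable(2)[of "\<lambda>_. 1" 1 "\<lambda>k. curve_gate (5 ^ (k * N + j) * t) / 2" 1] gate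
    by (simp add: wip_def x_def)
  define \<phi> where "\<phi> t = (\<Sum>j<N. (2 * \<rho> * x j t - \<rho>) *\<^sub>R b j)" for t
  have "continuous_on UNIV \<phi>"
    unfolding \<phi>_def by (intro continuous_intros x_cont)
  moreover have "bounded (range \<phi>)"
  proof (rule boundedI)
    fix y assume "y \<in> range \<phi>"
    then obtain t where t: "y = \<phi> t" by blast
    have "norm (\<phi> t) \<le> (\<Sum>j<N. \<bar>2 * \<rho> * x j t - \<rho>\<bar> * norm (b j))"
      unfolding \<phi>_def by (rule order_trans[OF norm_sum]) simp
    also have "\<dots> \<le> (\<Sum>j<N. (2 * \<bar>\<rho>\<bar> * 2 + \<bar>\<rho>\<bar>) * norm (b j))"
    proof (intro sum_mono mult_right_mono norm_ge_zero)
      fix j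
      have "\<bar>2 * \<rho> * x j t\<bar> \<le> 2 * \<bar>\<rho>\<bar> * 2"
        unfolding abs_mult using x_bd by (intro mult_mono) auto
      then show "\<bar>2 * \<rho> * x j t - \<rho>\<bar> \<le> 2 * \<bar>\<rho>\<bar> * 2 + \<bar>\<rho>\<bar>" by linarith
    qed
    finally show "norm y \<le> (\<Sum>j<N. (2 * \<bar>\<rho>\<bar> * 2 + \<bar>\<rho>\<bar>) * norm (b j))" by (simp add: t)
  qed
  moreover have "a \<in> \<phi> ` {0..1}" if a: "a \<in> cball 0 \<rho>" for a :: 'e
  proof -
    have \<rho>: "0 \<le> \<rho>" using a norm_ge_zero[of a] by (simp del: norm_ge_zero)
    define v where "v j = (if \<rho> = 0 then 0 else (inner a (b j) + \<rho>) / (2 * \<rho>))" for j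
    have ab: "\<bar>inner a (b j)\<bar> \<le> \<rho>" if "j < N" for j
    proof -
      have "b j \<in> Basis" using b that by (auto simp: bij_betw_def)
      then have "\<bar>inner a (b j)\<bar> \<le> norm a" by (rule Basis_le_norm)
      with a show ?thesis by simp
    qed
    have "\<exists>c. (\<lambda>k. (1/2) ^ k * ((if c k then 1 else 0) / 2)) sums v j" if "j < N" for j
      using ab[OF that] \<rho> by (intro binary_expansion) (auto simp: v_def field_simps)
    then obtain c where c: "\<And>j. j < N \<Longrightarrow> (\<lambda>k. (1/2) ^ k * ((if c j k then 1 else 0) / 2)) sums v j"
      by metis
    \<comment> \<open>Bit k of coordinate j is digit k N + j; \<open>mod\<close> and
      \<open>div\<close> undo this interleaving.\<close>
    define t where "t = base5 (\<lambda>m. c (m mod N) (m div N))"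
    have "x j t = v j" if "j < N" for j
    proof -
      have "curve_gate (5 ^ (k * N + j) * t) = (if c j k then 1 else 0)" for k
        unfolding t_def curve_gate_base5 using that by simp
      then show ?thesis unfolding x_def using c[OF that] by (simp add: sums_iff)
    qed
    then have "\<phi> t = (\<Sum>j<N. (2 * \<rho> * v j - \<rho>) *\<^sub>R b j)" by (simp add: \<phi>_def)
    also have "\<dots> = (\<Sum>j<N. inner a (b j) *\<^sub>R b j)"
      using ab \<rho> by (intro sum.cong HOL.refl) (auto simp: v_def)
    also have "\<dots> = (\<Sum>u\<in>Basis. inner a u *\<^sub>R u)"
      by (rule sum.reindex_bij_betw[OF b])
    also have "\<dots> = a" by (rule euclidean_representation)
    finally have "\<phi> t = a" .
    moreover have "t \<in> {0..1}" 
      using base5_bounds[of "\<lambda>m. c (m mod N) (m div N)"] unfolding t_def[symmetric] by simp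
    ultimately show ?thesis by blast
  qed
  ultimately show ?thesis by blast
qed

section \<open>Weak limits of finitely supported measures on a compact set\<close>

text \<open>A right inverse \<open>\<tau>\<close> of the curve is chosen pointwise on
  \<open>K\<close>; no regularity is asked of it, as each mixture lifts only finitely many points.
  The lifted measures live on [0, 1] and so are tight, and a weak limit is pushed forward along the
  curve.\<close>

theorem measure_from_mixtures:
  fixes K :: "'e::euclidean_space set" and F :: "'i \<Rightarrow> 'e \<Rightarrow> real"
  assumes K: "compact K" and F: "\<And>i. continuous_on UNIV (F i)"
    and Z: "\<And>n. Z n \<in> mixtures K F" and lim: "\<And>i. i \<in> J \<Longrightarrow> (\<lambda>n. Z n i) \<longlonglongrightarrow> y i"
  shows "\<exists>\<mu>. prob_space \<mu> \<and> sets \<mu> = sets borel \<and> (AE a in \<mu>. a \<in> K) \<and>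
    (\<forall>i\<in>J. has_bochner_integral \<mu> (F i) (y i))"
proof -
  obtain \<rho> where \<rho>: "K \<subseteq> cball 0 \<rho>"
    using compact_imp_bounded[OF K] by (auto simp: bounded_iff subset_iff)
  obtain \<phi> :: "real \<Rightarrow> 'e" where \<phi>: "continuous_on UNIV \<phi>" "bounded (range \<phi>)" "cball 0 \<rho> \<subseteq> \<phi> ` {0..1}"
    using space_filling_curve by blast
  have "\<forall>a\<in>K. \<exists>t\<in>{0..1}. \<phi> t = a" using \<rho> \<phi>(3) by (metis (no_types, lifting) image_iff subsetD)
  then obtain \<tau> where \<tau>: "\<And>a. a \<in> K \<Longrightarrow> \<tau> a \<in> {0..1} \<and> \<phi> (\<tau> a) = a" by metis
  have "\<forall>n. \<exists>(N::nat) c t. (\<forall>k<N. 0 \<le> c k \<and> t k \<in> K) \<and> (\<Sum>k<N. c k) = 1 \<and>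
     (\<forall>i. Z n i = (\<Sum>k<N. c k * F i (t k)))"
    using Z by (simp add: mixtures_def)
  then obtain N :: "nat \<Rightarrow> nat" and c :: "nat \<Rightarrow> nat \<Rightarrow> real" and t :: "nat \<Rightarrow> nat \<Rightarrow> 'e" where
    ct: "\<And>n k. k < N n \<Longrightarrow> 0 \<le> c n k \<and> t n k \<in> K" "\<And>n. (\<Sum>k<N n. c n k) = 1"
    "\<And>n i. Z n i = (\<Sum>k<N n. c n k * F i (t n k))"
    by metis
  define P where "P n = point_measure {..<N n} (\<lambda>k. ennreal (c n k))" for n
  define \<nu> where "\<nu> n = distr (P n) borel (\<lambda>k. \<tau> (t n k))" for n
  have meas: "(\<lambda>k. \<tau> (t n k)) \<in> measurable (P n) borel" for n
    by (simp add: P_def)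
  have P: "prob_space (P n)" for n
    unfolding P_def
    using ct sum_ennreal[of "{..<N n}" "c n"] by (intro prob_space_point_measure) auto
  have \<nu>: "real_distribution (\<nu> n)" for n
    unfolding real_distribution_def real_distribution_axioms_def \<nu>_def
    using prob_space.prob_space_distr[OF P meas] by simp
  have int: "integral\<^sup>L (\<nu> n) f = (\<Sum>k<N n. c n k * f (\<tau> (t n k)))" if "continuous_on UNIV f" for f :: "real \<Rightarrow> real" and n
  proof -
    have "integral\<^sup>L (\<nu> n) f = integral\<^sup>L (P n) (\<lambda>k. f (\<tau> (t n k)))"
      unfolding \<nu>_def by (rule integral_distr[OF meas borel_measurable_continuous_onI[OF that]])
    then show ?thesis
      unfolding P_def using ct by (subst (asm) lebesgue_integral_point_measure_finite) auto
  qed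
  have tight: "tight \<nu>"
    unfolding tight_def
  proof (intro conjI allI impI \<nu>)
    fix \<epsilon> :: real assume "\<epsilon> > 0"
    have "measure (\<nu> n) {-1<..1} = 1" for n
    proof -
      have "(\<lambda>k. \<tau> (t n k)) -` {-1<..1} \<inter> space (P n) = space (P n)"
        using \<tau> ct(1) by (fastforce simp: P_def space_point_measure)
      then show ?thesis
        unfolding \<nu>_def using prob_space.prob_space[OF P] by (simp add: measure_distr[OF meas])
    qed
    then show "\<exists>a b. a < b \<and> (\<forall>n. 1 - \<epsilon> < measure (\<nu> n) {a<..b})"
      using \<open>\<epsilon> > 0\<close> by (intro exI[of _ "-1"] exI[of _ 1]) simp
  qed
  then obtain r M where r: "strict_mono (r :: nat \<Rightarrow> nat)" and M: "real_distribution M"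
    and conv: "weak_conv_m (\<nu> \<circ> id \<circ> r) M"
    using tight_imp_convergent_subsubsequence[OF tight, of id] by (metis strict_mono_id)
  have conv_int: "(\<lambda>n. integral\<^sup>L (\<nu> (r n)) f) \<longlonglongrightarrow> integral\<^sup>L M f"
    if cf: "continuous_on UNIV f" and bf: "bounded (range f)" for f :: "real \<Rightarrow> real"
  proof -
    obtain B where "\<And>x. norm (f x) \<le> B" using bf by (auto simp: bounded_iff)
    then show ?thesis
      using weak_conv_imp_integral_bdd_continuous_conv[of "\<nu> \<circ> id \<circ> r" M f B] conv M \<nu> cf
      by (simp add: continuous_on_eq_continuous_at)
  qed
  interpret M: real_distribution M by (rule M)
  have \<phi>_meas: "\<phi> \<in> measurable M borel"
    using borel_measurable_continuous_onI[OF \<phi>(1)] by simp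
  have cF: "continuous_on UNIV (\<lambda>x. F i (\<phi> x))" for i
    by (rule continuous_on_compose2[OF F \<phi>(1)]) auto
  have bF: "bounded (range (\<lambda>x. f (\<phi> x)))" if "continuous_on UNIV f" for f :: "'e \<Rightarrow> real"
  proof -
    have "bounded (f ` closure (range \<phi>))"
      by (intro compact_imp_bounded compact_continuous_image continuous_on_subset[OF that])
        (auto simp: compact_closure \<phi>)
    then show ?thesis by (rule bounded_subset) (use closure_subset in blast)
  qed
  define \<mu> where "\<mu> = distr M borel \<phi>"
  have "prob_space \<mu>" unfolding \<mu>_def by (rule M.prob_space_distr[OF \<phi>_meas])
  moreover have "sets \<mu> = sets borel" by (simp add: \<mu>_def)
  moreover have "AE a in \<mu>. a \<in> K"
  \<comment> \<open>\<open>infdist\<close> to the empty set is 0 by convention and would detect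
    nothing; but over an empty \<open>K\<close> the weights could not sum to 1.\<close>
  proof (cases "K = {}")
    case True
    then have "c 0 k = 0" if "k < N 0" for k using ct(1)[OF that] by auto
    with ct(2)[of 0] show ?thesis by simp
  next
    case False
    \<comment> \<open>The distance to \<open>K\<close> has integral 0 against every lifted mixture,
      hence against the limit; being nonnegative, it vanishes almost everywhere.\<close>
    define f where "f x = infdist (\<phi> x) K" for x
    have cf: "continuous_on UNIV f" unfolding f_def by (intro continuous_intros \<phi>)
    have bf: "bounded (range f)" unfolding f_def by (intro bF continuous_intros)
    have "integral\<^sup>L (\<nu> (r n)) f = 0" for n
      unfolding int[OF cf] using ct(1) \<tau> by (intro sum.neutral) (simp add: f_def)
    with conv_int[OF cf bf] have "integral\<^sup>L M f = 0"
      by (simp add: LIMSEQ_const_iff)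
    moreover have "integrable M f"
    proof -
      obtain B where "\<And>x. norm (f x) \<le> B" using bf by (auto simp: bounded_iff)
      then show ?thesis
        using borel_measurable_continuous_onI[OF cf] by (intro M.integrable_const_bound[of _ B]) auto
    qed
    ultimately have "AE x in M. f x = 0"
      by (subst integral_nonneg_eq_0_iff_AE[symmetric]) (auto simp: f_def infdist_nonneg)
    then have "AE x in M. \<phi> x \<in> K"
      by eventually_elim (use K False in \<open>simp add: f_def in_closed_iff_infdist_zero compact_imp_closed\<close>)
    then show ?thesis
      unfolding \<mu>_def using compact_imp_closed[OF K]
      by (subst AE_distr_iff[OF \<phi>_meas]) auto
  qed
  moreover have "has_bochner_integral \<mu> (F i) (y i)" if "i \<in> J" for i
  proof -
    obtain B where B: "\<And>x. norm (F i (\<phi> x)) \<le> B" using bF[OF F[of i]] by (auto simp: bounded_iff)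
    have "integrable M (\<lambda>x. F i (\<phi> x))"
      using borel_measurable_continuous_onI[OF cF] B by (intro M.integrable_const_bound[of _ B]) auto
    moreover have "integral\<^sup>L M (\<lambda>x. F i (\<phi> x)) = y i"
    proof (rule LIMSEQ_unique)
      show "(\<lambda>n. integral\<^sup>L (\<nu> (r n)) (\<lambda>x. F i (\<phi> x))) \<longlonglongrightarrow> integral\<^sup>L M (\<lambda>x. F i (\<phi> x))"
        by (rule conv_int[OF cF bF[OF F]])
      have "integral\<^sup>L (\<nu> n) (\<lambda>x. F i (\<phi> x)) = Z n i" for n
        unfolding int[OF cF] ct(3) using ct(1) \<tau> by (intro sum.cong) auto
      then show "(\<lambda>n. integral\<^sup>L (\<nu> (r n)) (\<lambda>x. F i (\<phi> x))) \<longlonglongrightarrow> y i"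
        using LIMSEQ_subseq_LIMSEQ[OF lim[OF that] r] by (simp add: o_def)
    qed
    ultimately show ?thesis
      unfolding \<mu>_def using borel_measurable_continuous_onI[OF F[of i]]
      by (simp add: has_bochner_integral_iff integrable_distr_eq[OF \<phi>_meas] integral_distr[OF \<phi>_meas])
  qed
  ultimately show ?thesis by blast
qed

section \<open>Quaternionic polynomials with commuting coefficients\<close>

text \<open>In the monoid algebra over the quaternions the constants commute with the letters.  It is the
  quotient of the free product in which the computations with \<open>L\<close> take place.\<close>

type_synonym 'n qpoly = "'n qword \<Rightarrow>\<^sub>0 quat"

lemma lookup_map_of_real:
  "Poly_Mapping.lookup (Poly_Mapping.map of_real p) w = (of_real (Poly_Mapping.lookup p w) :: quat)"
  by (simp add: Poly_Mapping.map.rep_eq when_def)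

definition ofr :: "'n rpoly \<Rightarrow> 'n qpoly" where
  "ofr p = Poly_Mapping.map of_real p"

definition konst :: "quat \<Rightarrow> 'n qpoly" where
  "konst c = Poly_Mapping.single 0 c"

lemma ofr_single: "ofr (Poly_Mapping.single w r) = Poly_Mapping.single w (of_real r)"
  by (rule poly_mapping_eqI) (simp add: ofr_def lookup_map_of_real lookup_single when_def)

lemma ofr_add [simp]: "ofr (p + q) = ofr p + ofr q"
  by (rule poly_mapping_eqI) (simp add: ofr_def lookup_map_of_real lookup_add)

lemma ofr_scaleR [simp]: "ofr (c *\<^sub>R p) = c *\<^sub>R ofr p"
  by (rule poly_mapping_eqI) (simp add: ofr_def lookup_map_of_real of_real_def)

lemma linear_ofr: "linear ofr"
  by (intro linearI) simp_all

lemma ofr_diff [simp]: "ofr (p - q) = ofr p - ofr q"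
  by (rule linear_diff[OF linear_ofr])

lemma ofr_zero [simp]: "ofr 0 = 0"
  by (rule linear_0[OF linear_ofr])

lemma ofr_one [simp]: "ofr 1 = 1"
  using ofr_single[of 0 1] by simp

lemma ofr_mult [simp]: "ofr (p * q) = ofr p * ofr q"
proof -
  have "ofr (Poly_Mapping.single w r * q) = ofr (Poly_Mapping.single w r) * ofr q" for w r
    by (induction q rule: poly_mapping_additive_induct)
      (simp_all add: mult_single ofr_single distrib_left)
  then show ?thesis
    by (induction p rule: poly_mapping_additive_induct) (simp_all add: distrib_right)
qed

lemma ofr_star [simp]: "ofr (star p) = star (ofr p)"
proof (induction p rule: poly_mapping_additive_induct)
  case (single w r)
  have "star (of_real r :: quat) = of_real r" by (simp add: quat_eq_iff)
  then show ?case by (simp add: ofr_single)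
qed simp

lemma konst_simps [simp]:
  "konst (c + d) = konst c + konst d" "konst (c * d) = konst c * konst d"
  "konst (star c) = star (konst c)" "konst (r *\<^sub>R c) = r *\<^sub>R konst c" "konst 1 = 1" "konst 0 = 0"
  by (simp_all add: konst_def single_add mult_single)
    (simp add: star_qword.abs_eq zero_qword_def)

lemma konst_ofr_commute: "konst c * ofr p = ofr p * konst c"
proof (induction p rule: poly_mapping_additive_induct)
  case (single w r)
  have "c * of_real r = of_real r * c" by (simp add: quat_eq_iff quat_sel_mult mult.commute)
  then show ?case by (simp add: konst_def ofr_single mult_single)
qed (simp add: algebra_simps)

lemma single_eq_konst_mon: "Poly_Mapping.single w c = konst c * ofr (mon w)"
  by (simp add: konst_def mon_def ofr_single mult_single)

lemma konst_mult_shuffle: "konst c * ofr p * (konst d * ofr q) = konst (c * d) * ofr (p * q)"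
proof -
  have "konst c * ofr p * (konst d * ofr q) = konst c * (ofr p * konst d) * ofr q"
    by (simp only: mult.assoc)
  also have "\<dots> = konst c * (konst d * ofr p) * ofr q" by (simp only: konst_ofr_commute)
  finally show ?thesis by (simp add: mult.assoc)
qed

lemma mon_add: "mon (u + v) = mon u * mon v"
  by (simp add: mon_def mult_single)

lemma mon_zero [simp]: "mon 0 = 1"
  by (simp add: mon_def)

lemma mon_star [simp]: "star (mon w) = mon (star w)"
  by (simp add: mon_def)

lemma single_eq_scaleR_mon: "Poly_Mapping.single w r = r *\<^sub>R mon w"
  by (simp add: mon_def)

lemma qword_induct [case_names zero letter]:
  assumes "P 0" "\<And>x w. P w \<Longrightarrow> P (lword x + w)"
  shows "P w"
proof -
  have "P (abs_qword xs)" for xs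
  proof (induction xs)
    case Nil
    then show ?case using assms(1) by (simp add: zero_qword_def)
  next
    case (Cons x xs)
    have "abs_qword (x # xs) = lword x + abs_qword xs"
      by (simp add: lword.abs_eq plus_qword.abs_eq)
    with assms(2)[OF Cons] show ?case by simp
  qed
  then show ?thesis by (metis Quotient3_abs_rep Quotient3_qword)
qed

lemma star_lword: "star (lword x) = lword (lbar x)"
  by (simp add: lword.abs_eq star_qword.abs_eq)

section \<open>Linear extensions of sequences\<close>

text \<open>\<open>inner c (y w)\<close> is the real part of \<open>star c * y w\<close>; letting
  \<open>c\<close> run through the four units recovers \<open>y w\<close> from this real
  functional.\<close>

definition pairing :: "('n qword \<Rightarrow> quat) \<Rightarrow> 'n qpoly \<Rightarrow> real" where
  "pairing y p = (\<Sum>w\<in>Poly_Mapping.keys p. inner (Poly_Mapping.lookup p w) (y w))"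

lemma pairing_single [simp]: "pairing y (Poly_Mapping.single w c) = inner c (y w)"
  by (simp add: pairing_def)

lemma pairing_add: "pairing y (p + q) = pairing y p + pairing y q"
  unfolding pairing_def by (rule setsum_keys_plus_distrib) (simp_all add: inner_add_left)

lemma linear_pairing: "linear (pairing y)"
proof (rule linearI)
  fix c :: real and p :: "'a qpoly"
  show "pairing y (c *\<^sub>R p) = c *\<^sub>R pairing y p"
    by (induction p rule: poly_mapping_additive_induct)
      (simp_all add: pairing_add scaleR_add_right distrib_left)
qed (rule pairing_add)

lemma riesz_single [simp]: "riesz y (Poly_Mapping.single w r) = r *\<^sub>R y w"
  by (simp add: riesz_def)

lemma riesz_mon [simp]: "riesz y (mon w) = y w"
  by (simp add: mon_def)

lemma riesz_add: "riesz y (p + q) = riesz y p + riesz y q"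
  unfolding riesz_def by (rule setsum_keys_plus_distrib) (simp_all add: scaleR_add_left)

lemma linear_riesz: "linear (riesz y)"
proof (rule linearI)
  fix c :: real and p :: "'a rpoly"
  show "riesz y (c *\<^sub>R p) = c *\<^sub>R riesz y p"
    by (induction p rule: poly_mapping_additive_induct)
      (simp_all add: riesz_add scaleR_add_right)
qed (rule riesz_add)

lemma pairing_konst_ofr: "pairing y (konst c * ofr p) = inner c (riesz y p)"
proof (induction p rule: poly_mapping_additive_induct)
  case (single w r)
  show ?case
    by (simp add: konst_def ofr_single mult_single flip: scaleR_conv_of_real)
      (simp add: inner_quat_def quat_sel_mult algebra_simps)
qed (simp add: distrib_left pairing_add riesz_add inner_add_right)

text \<open>Extreme states arise as abstract functionals; this gives them back a sequence of
  quaternions.\<close>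

lemma linear_functional_eq_pairing:
  fixes L :: "'n qpoly \<Rightarrow> real"
  assumes "linear L"
  shows "L p = pairing (\<lambda>w. \<Sum>u\<in>Basis. L (Poly_Mapping.single w u) *\<^sub>R u) p"
proof (induction p rule: poly_mapping_additive_induct)
  case (single w c)
  have "L (Poly_Mapping.single w c) = L (\<Sum>u\<in>Basis. inner c u *\<^sub>R Poly_Mapping.single w u)"
  proof -
    have "(\<Sum>u\<in>Basis. inner c u *\<^sub>R Poly_Mapping.single w u) = Poly_Mapping.single w (\<Sum>u\<in>Basis. inner c u *\<^sub>R u)"
      by (rule poly_mapping_eqI) (simp add: lookup_sum lookup_single when_def)
    then show ?thesis by (simp only: euclidean_representation)
  qed
  then show ?case
    by (simp add: linear_sum[OF assms] linear_cmul[OF assms] inner_sum_right mult.commute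
        del: scaleR_single)
qed (simp add: linear_add[OF assms] pairing_add)

lemma hermitian_iff_pairing_star:
  "(\<forall>w. y w = star (y (star w))) \<longleftrightarrow> (\<forall>p. pairing y (star p) = pairing y p)"
proof safe
  fix p :: "'a qpoly"
  assume herm: "\<forall>w. y w = star (y (star w))"
  show "pairing y (star p) = pairing y p"
  proof (induction p rule: poly_mapping_additive_induct)
    case (single w c)
    have "inner (star c) (y (star w)) = inner c (star (y (star w)))"
      by (simp add: inner_quat_def)
    with herm show ?case by (metis pairing_single star_single)
  qed (simp add: pairing_add)
next
  fix w
  assume *: "\<forall>p. pairing y (star p) = pairing y p"
  have "inner c (star (y (star w))) = inner c (y w)" for c
  proof -
    have "inner c (star (y (star w))) = inner (star c) (y (star w))"
      by (simp add: inner_quat_def)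
    also have "\<dots> = inner c (y w)" using *[rule_format, of "Poly_Mapping.single w c"] by simp
    finally show ?thesis .
  qed
  then show "y w = star (y (star w))" by (metis vector_eq_ldot)
qed

text \<open>Coefficients on the two sides of a real polynomial merge into one constant in front, so
  words suffice as multipliers.\<close>

lemma pairing_null_elems:
  assumes "\<And>u v. riesz y (mon u * n * mon v) = 0"
  shows "ofr n \<in> null_elems (pairing y)"
proof -
  note lin = linear_0[OF linear_pairing] pairing_add
  have 1: "pairing y (Poly_Mapping.single u c * ofr n * Poly_Mapping.single v d) = 0" for u v c d
  proof -
    have "Poly_Mapping.single u c * ofr n * Poly_Mapping.single v d
        = konst c * ofr (mon u * n) * (konst d * ofr (mon v))"
      by (simp add: single_eq_konst_mon mult.assoc)
    also have "\<dots> = konst (c * d) * ofr (mon u * n * mon v)" by (rule konst_mult_shuffle)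
    finally show ?thesis by (simp only: pairing_konst_ofr assms inner_zero_right)
  qed
  have 2: "pairing y (Poly_Mapping.single u c * ofr n * r) = 0" for u c r
    by (induction r rule: poly_mapping_additive_induct) (simp_all add: 1 distrib_left lin)
  have "pairing y (p * ofr n * r) = 0" for p r
    by (induction p rule: poly_mapping_additive_induct) (simp_all add: 2 distrib_right lin)
  then show ?thesis by (simp add: null_elems_def)
qed

text \<open>A polynomial with coefficients \<open>c w\<close> corresponds to the test vector of
  their conjugates: with A the localizing matrix, the contribution of u, v is the real part of
  \<open>c u * A u v * star (c v)\<close>.\<close>

lemma pairing_localizing_nonneg:
  fixes y :: "'n::finite qword \<Rightarrow> quat"
  assumes "\<And>d. quat_psd (words_upto d) (localizing_matrix g y)"
  shows "0 \<le> pairing y (star p * ofr g * p)"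
proof -
  define W where "W = Poly_Mapping.keys p"
  define d where "d = (if W = {} then 0 else Max (wlength ` W))"
  have fin: "finite W" by (simp add: W_def)
  have WV: "W \<subseteq> words_upto d"
  proof
    fix w assume "w \<in> W"
    then show "w \<in> words_upto d"
      using fin by (auto simp: words_upto_def d_def intro!: Max_ge)
  qed
  define V where "V = (words_upto d :: 'n qword set)"
  define c where "c = Poly_Mapping.lookup p"
  have p: "p = (\<Sum>w\<in>V. konst (c w) * ofr (mon w))"
  proof (rule poly_mapping_eqI)
    fix w
    have "Poly_Mapping.lookup (\<Sum>w\<in>V. konst (c w) * ofr (mon w)) w = (if w \<in> V then c w else 0)"
      by (simp add: lookup_sum lookup_single when_def V_def flip: single_eq_konst_mon)
    then show "Poly_Mapping.lookup p w = Poly_Mapping.lookup (\<Sum>w\<in>V. konst (c w) * ofr (mon w)) w"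
      using WV by (auto simp: c_def W_def V_def in_keys_iff)
  qed
  have entry: "pairing y (star (konst (c u) * ofr (mon u)) * ofr g * (konst (c v) * ofr (mon v)))
      = Qre (c u * localizing_matrix g y u v * star (c v))" for u v
  proof -
    have "star (konst (c u) * ofr (mon u)) * ofr g * (konst (c v) * ofr (mon v))
        = (ofr (mon (star u)) * konst (star (c u))) * ofr g * (konst (c v) * ofr (mon v))"
      by (simp flip: ofr_star)
    also have "\<dots> = konst (star (c u)) * ofr (mon (star u) * g) * (konst (c v) * ofr (mon v))"
      by (simp only: konst_ofr_commute[symmetric] ofr_mult mult.assoc)
    also have "\<dots> = konst (star (c u) * c v) * ofr (mon (star u) * g * mon v)"
      by (rule konst_mult_shuffle)
    finally show ?thesis
      unfolding localizing_matrix_def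
      by (simp only: pairing_konst_ofr) (simp add: inner_quat_def quat_sel_mult algebra_simps)
  qed
  have Qre_sum: "Qre (\<Sum>x\<in>A. f x) = (\<Sum>x\<in>A. Qre (f x))" for f :: "'n qword \<Rightarrow> quat" and A
    by (induction A rule: infinite_finite_induct) auto
  have "star p * ofr g * p
      = (\<Sum>u\<in>V. \<Sum>v\<in>V. star (konst (c u) * ofr (mon u)) * ofr g * (konst (c v) * ofr (mon v)))"
    by (subst (1 2) p) (simp only: star_sum sum_distrib_left sum_distrib_right, rule sum.swap)
  then have "pairing y (star p * ofr g * p)
      = Qre (\<Sum>u\<in>V. \<Sum>v\<in>V. star (star (c u)) * localizing_matrix g y u v * star (c v))"
    by (simp only: linear_sum[OF linear_pairing] entry Qre_sum star_star)
  also have "\<dots> \<ge> 0"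
  proof -
    have "(\<Sum>u\<in>V. \<Sum>v\<in>V. star (star (c u)) * localizing_matrix g y u v * star (c v)) \<in> \<real>\<^sub>\<ge>\<^sub>0"
      using assms[of d] unfolding quat_psd_def V_def by (rule allE[where x = "\<lambda>u. star (c u)"])
    then show ?thesis by (auto elim!: nonneg_Reals_cases)
  qed
  finally show ?thesis .
qed

lemma moment_matrix_eq_localizing: "moment_matrix y = localizing_matrix 1 y"
  by (simp add: fun_eq_iff moment_matrix_def localizing_matrix_def mon_add)

section \<open>The quadratic module in the monoid algebra\<close>

primrec fpeval :: "(quat, 'n rpoly) fpterm \<Rightarrow> 'n qpoly" where
  "fpeval (TInl c) = konst c"
| "fpeval (TInr p) = ofr p"
| "fpeval (TAdd s t) = fpeval s + fpeval t"
| "fpeval (TMul s t) = fpeval s * fpeval t"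
| "fpeval (TScale r s) = r *\<^sub>R fpeval s"

lemma fpeval_cong: "fpeq s t \<Longrightarrow> fpeval s = fpeval t"
  by (induction rule: fpeq.induct) (simp_all add: algebra_simps)

lift_definition fphom :: "'n hpoly \<Rightarrow> 'n qpoly" is fpeval
  by (rule fpeval_cong)

lemma fphom_simps [simp]:
  "fphom (fp_inl c) = konst c" "fphom (fp_inr p) = ofr p" "fphom (x + y) = fphom x + fphom y"
  "fphom (x * y) = fphom x * fphom y" "fphom (r *\<^sub>R x) = r *\<^sub>R fphom x" "fphom 0 = 0"
  subgoal by transfer simp
  subgoal by transfer simp
  subgoal by transfer simp
  subgoal by transfer simp
  subgoal by transfer simp
  subgoal by transfer simp
  done

lemma fphom_star [simp]: "fphom (star x) = star (fphom x)"
proof transfer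
  fix s :: "(quat, 'a rpoly) fpterm"
  show "fpeval (tstar s) = star (fpeval s)" by (induction s) simp_all
qed

lemma fphom_sum: "fphom (\<Sum>x\<in>A. f x) = (\<Sum>x\<in>A. fphom (f x))"
  by (induction A rule: infinite_finite_induct) auto

section \<open>The cone of functionals attached to the constraints\<close>

definition nonneg_constraints :: "nat \<Rightarrow> (nat \<Rightarrow> 'n rpoly) \<Rightarrow> 'n qpoly set" where
  "nonneg_constraints m g = (\<lambda>i. ofr (g i)) ` {1..m}"

definition null_constraints :: "nat \<Rightarrow> (nat \<Rightarrow> 'n rpoly) \<Rightarrow> 'n qpoly set" where
  "null_constraints l h = (\<lambda>j. ofr (h j)) ` {1..l} \<union>
     range (\<lambda>(w, i). ofr (commutator (mon w + mon (star w)) (mon (lword (Lq i)))))"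

abbreviation qcone :: "nat \<Rightarrow> (nat \<Rightarrow> 'n rpoly) \<Rightarrow> nat \<Rightarrow> (nat \<Rightarrow> 'n rpoly) \<Rightarrow> ('n qpoly \<Rightarrow> real) set" where
  "qcone m g l h \<equiv> pos_cone (nonneg_constraints m g) (null_constraints l h)"

text \<open>The commutator with \<open>w + star w\<close> is a derivation. It maps the letters q_i
  into the ideal by definition of the cone, the conjugate letters by applying the star, and words by
  the Leibniz rule; it annihilates constants, which commute with real polynomials.\<close>

lemma qcone_central_mon:
  assumes L: "L \<in> qcone m g l h"
  shows "central L (ofr (mon w + mon (star w)))"
proof -
  interpret positive_functional L by (rule pos_cone_positive_functional[OF L])
  define z where "z = ofr (mon w + mon (star w))"
  define D where "D a = z * a - a * z" for a
  have starz: "star z = z" by (simp add: z_def add.commute flip: ofr_star)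
  have q: "D (ofr (mon (lword (Lq i)))) \<in> null_elems L" for i
  proof -
    have "D (ofr (mon (lword (Lq i)))) \<in> null_constraints l h"
      by (auto simp: null_constraints_def D_def z_def commutator_def intro!: image_eqI[of _ _ "(w, i)"])
    then show ?thesis using L by (auto simp: pos_cone_def)
  qed
  have qbar: "D (ofr (mon (lword (Lqbar i)))) \<in> null_elems L" for i
  proof -
    have "star (ofr (mon (lword (Lq i)))) = ofr (mon (lword (Lqbar i)))"
      by (simp add: star_lword flip: ofr_star)
    then have "D (ofr (mon (lword (Lqbar i)))) = - star (D (ofr (mon (lword (Lq i)))))"
      by (simp add: D_def starz)
    then show ?thesis using null_uminus[OF null_star[OF q]] by simp
  qed
  have mult: "D (a * b) \<in> null_elems L" if "D a \<in> null_elems L" "D b \<in> null_elems L" for a b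
  proof -
    have "D (a * b) = D a * b + a * D b" by (simp add: D_def algebra_simps)
    then show ?thesis using that by (simp add: null_add null_elems_mult)
  qed
  have letter: "D (ofr (mon (lword x))) \<in> null_elems L" for x
    using q qbar by (cases x) simp_all
  have word: "D (ofr (mon v)) \<in> null_elems L" for v
    by (induction v rule: qword_induct) (simp_all add: mon_add mult letter, simp add: D_def null_zero)
  have const: "D (konst c) \<in> null_elems L" for c
    by (simp add: D_def z_def konst_ofr_commute null_zero flip: ofr_add)
  have "D a \<in> null_elems L" for a
  proof (induction a rule: poly_mapping_additive_induct)
    case (single v c)
    show ?case unfolding single_eq_konst_mon by (rule mult[OF const word])
  next
    case (add a b)
    then show ?case using null_add[of "D a" "D b"] by (simp add: D_def algebra_simps)
  qed
  then show ?thesis by (simp add: central_def D_def z_def)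
qed

lemma qcone_central_real_part:
  assumes L: "L \<in> qcone m g l h"
  shows "central L (ofr (p + star p))"
proof -
  interpret positive_functional L by (rule pos_cone_positive_functional[OF L])
  show ?thesis
  proof (induction p rule: poly_mapping_additive_induct)
    case (single w r)
    have "Poly_Mapping.single w r + star (Poly_Mapping.single w r) = r *\<^sub>R (mon w + mon (star w))"
      by (simp add: single_eq_scaleR_mon scaleR_add_right)
    then show ?case using central_scaleR[OF qcone_central_mon[OF L]] by simp
  next
    case (add p q)
    have eq: "ofr (p + q + star (p + q)) = ofr (p + star p) + ofr (q + star q)"
      by (simp add: algebra_simps)
    show ?case unfolding eq by (rule central_add[OF add])
  qed
qed

text \<open>A symmetric \<open>g i\<close> is half of its sum with its own star, hence central. So
  both orders of its product with \<open>\<sigma> i\<close> have the same value, and each square in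
  \<open>\<sigma> i\<close> can be wrapped around \<open>g i\<close>. The terms with
  \<open>h j\<close> lie in the ideal.\<close>

lemma qmodule_nonneg:
  assumes L: "L \<in> qcone m g l h" and g: "\<And>i. i \<in> {1..m} \<Longrightarrow> star (g i) = g i"
    and x: "x \<in> qmodule m g l h"
  shows "0 \<le> L (star p * fphom x * p)"
proof -
  interpret positive_functional L by (rule pos_cone_positive_functional[OF L])
  obtain \<sigma>0 \<sigma> T where x: "x = \<sigma>0 + (1/2) *\<^sub>R (\<Sum>i=1..m. \<sigma> i * fp_inr (g i) + fp_inr (g i) * \<sigma> i)
        + (\<Sum>j=1..l. \<Sum>(\<tau>, \<nu>)\<leftarrow>T j. \<tau> * fp_inr (h j) * star \<nu> + \<nu> * star (fp_inr (h j)) * star \<tau>)"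
      and \<sigma>: "\<sigma>0 \<in> sos" "\<And>i. i \<in> {1..m} \<Longrightarrow> \<sigma> i \<in> sos"
    using x unfolding qmodule_def by blast
  \<comment> \<open>The weight \<open>a\<close> will be 1 for \<open>\<sigma>0\<close> and
    \<open>ofr (g i)\<close> for \<open>\<sigma> i\<close>.\<close>
  have sos_pos: "0 \<le> L (star p * fphom s * a * p)"
    if s: "s \<in> sos" and a: "\<And>b p. L (star p * star b * b * a * p) \<ge> 0" for s a
  proof -
    obtain ps where s: "s = (\<Sum>p\<leftarrow>ps. star p * p)" using s by (auto simp: sos_def)
    have "0 \<le> L (star p * fphom (\<Sum>p\<leftarrow>ps. star p * p) * a * p)"
      by (induction ps) (simp_all add: L_simps distrib_left distrib_right a mult.assoc[symmetric])
    then show ?thesis by (simp add: s)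
  qed
  have 0: "0 \<le> L (star p * fphom \<sigma>0 * p)"
  proof -
    have "0 \<le> L (star p * star b * b * 1 * p)" for b p
      using nonneg[of "b * p"] by (simp add: mult.assoc)
    from sos_pos[OF \<sigma>(1) this] show ?thesis by simp
  qed
  have i: "0 \<le> L (star p * (fphom (\<sigma> i) * ofr (g i)) * p)"
    "L (star p * (ofr (g i) * fphom (\<sigma> i)) * p) = L (star p * (fphom (\<sigma> i) * ofr (g i)) * p)"
    if i: "i \<in> {1..m}" for i
  proof -
    have "g i = (1/2) *\<^sub>R (g i + star (g i))" using g[OF i] by (simp flip: scaleR_2)
    then have "central L (ofr (g i))"
      using central_scaleR[OF qcone_central_real_part[OF L, of "g i"], of "1/2"] by (metis ofr_scaleR)
    note swap = central_swap[OF this]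
    have gpos: "0 \<le> L (star p * ofr (g i) * p)" for p
      using L i by (auto simp: pos_cone_def nonneg_constraints_def)
    have "0 \<le> L (star p * star b * b * ofr (g i) * p)" for b p
      using gpos[of "b * p"] swap[of "star p * star b" b p] by (simp add: mult.assoc)
    from sos_pos[OF \<sigma>(2)[OF i] this] show "0 \<le> L (star p * (fphom (\<sigma> i) * ofr (g i)) * p)"
      by (simp add: mult.assoc)
    show "L (star p * (ofr (g i) * fphom (\<sigma> i)) * p) = L (star p * (fphom (\<sigma> i) * ofr (g i)) * p)"
      using swap[of "star p" "fphom (\<sigma> i)" p] by (simp add: mult.assoc)
  qed
  have j: "L (star p * fphom (\<Sum>(\<tau>, \<nu>)\<leftarrow>ts. \<tau> * fp_inr (h j) * star \<nu> + \<nu> * star (fp_inr (h j)) * star \<tau>) * p) = 0"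
    if j: "j \<in> {1..l}" for j ts
  proof (induction ts)
    case (Cons t ts)
    have n: "ofr (h j) \<in> null_elems L"
      using L j by (auto simp: pos_cone_def null_constraints_def)
    obtain \<tau> \<nu> where t: "t = (\<tau>, \<nu>)" by (cases t)
    have "L (star p * (fphom \<tau> * ofr (h j) * star (fphom \<nu>)) * p) = 0"
      using null_elemsD[OF n, of "star p * fphom \<tau>" "star (fphom \<nu>) * p"] by (simp add: mult.assoc)
    moreover have "L (star p * (fphom \<nu> * star (ofr (h j)) * star (fphom \<tau>)) * p) = 0"
      using null_elemsD[OF null_star[OF n], of "star p * fphom \<nu>" "star (fphom \<tau>) * p"] by (simp add: mult.assoc)
    ultimately show ?case
      using Cons by (simp add: t L_simps distrib_left distrib_right)
  qed (simp add: L_simps)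
  have "L (star p * fphom x * p) = L (star p * fphom \<sigma>0 * p)
      + (1/2) * (\<Sum>i=1..m. L (star p * (fphom (\<sigma> i) * ofr (g i)) * p) + L (star p * (ofr (g i) * fphom (\<sigma> i)) * p))
      + (\<Sum>j=1..l. L (star p * fphom (\<Sum>(\<tau>, \<nu>)\<leftarrow>T j. \<tau> * fp_inr (h j) * star \<nu> + \<nu> * star (fp_inr (h j)) * star \<tau>) * p))"
  proof -
    have "fphom x = fphom \<sigma>0 + (1/2) *\<^sub>R (\<Sum>i=1..m. fphom (\<sigma> i) * ofr (g i) + ofr (g i) * fphom (\<sigma> i))
        + (\<Sum>j=1..l. fphom (\<Sum>(\<tau>, \<nu>)\<leftarrow>T j. \<tau> * fp_inr (h j) * star \<nu> + \<nu> * star (fp_inr (h j)) * star \<tau>))"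
      unfolding x by (simp only: fphom_simps fphom_sum)
    then show ?thesis
      by (simp add: L_simps linear_sum[OF linear] distrib_left distrib_right sum_distrib_left
        sum_distrib_right)
  qed
  then show ?thesis using 0 i j by (auto intro!: add_nonneg_nonneg sum_nonneg)
qed

section \<open>Evaluation at points\<close>

lemma peval_eq_riesz: "peval a p = riesz (weval a) p"
  by (simp add: peval_def riesz_def)

lemma weval_add: "weval a (u + v) = weval a u * weval a v"
  by transfer simp

lemma weval_zero [simp]: "weval a 0 = 1"
  by transfer simp

lemma weval_lword: "weval a (lword x) = leval a x"
  by transfer simp

lemma leval_lbar: "leval a (lbar x) = star (leval a x)"
  by (cases x) simp_all

lemma weval_star: "weval a (star w) = star (weval a w)"
  by (induction w rule: qword_induct)
    (simp_all add: star_monoid_add star_lword weval_add weval_lword leval_lbar,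
      metis add.right_neutral add_left_cancel star_monoid_add star_monoid_star weval_zero)

lemma riesz_linear: "riesz y (r *\<^sub>R p) = r *\<^sub>R riesz y p" "riesz y (p - q) = riesz y p - riesz y q"
  "riesz y 0 = 0"
  using linear_cmul[OF linear_riesz] linear_diff[OF linear_riesz] linear_0[OF linear_riesz] by auto

lemma peval_simps [simp]:
  "peval a (p + q) = peval a p + peval a q" "peval a (p - q) = peval a p - peval a q"
  "peval a (r *\<^sub>R p) = r *\<^sub>R peval a p" "peval a (mon w) = weval a w" "peval a 0 = 0"
  by (simp_all add: peval_eq_riesz riesz_add riesz_linear)

lemma peval_one [simp]: "peval a 1 = 1"
  using peval_simps(4)[of a 0] by (simp only: mon_zero weval_zero)

lemma peval_mult [simp]: "peval a (p * q) = peval a p * peval a q"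
proof -
  have "peval a (mon w * q) = weval a w * peval a q" for w
    by (induction q rule: poly_mapping_additive_induct)
      (simp_all add: single_eq_scaleR_mon weval_add distrib_left flip: mon_add)
  then show ?thesis
    by (induction p rule: poly_mapping_additive_induct)
      (simp_all add: single_eq_scaleR_mon distrib_right)
qed

lemma peval_star [simp]: "peval a (star p) = star (peval a p)"
  by (induction p rule: poly_mapping_additive_induct)
    (simp_all add: single_eq_scaleR_mon weval_star del: star_single)

lemma continuous_on_quat_star [continuous_intros]:
  assumes "continuous_on S f" shows "continuous_on S (\<lambda>x. star (f x :: quat))"
proof -
  have "bounded_linear (star :: quat \<Rightarrow> quat)"
    unfolding linear_conv_bounded_linear[symmetric] by (intro linearI) simp_all
  then show ?thesis using assms by (rule bounded_linear.continuous_on)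
qed

lemma continuous_on_weval: "continuous_on S (\<lambda>a. weval a w)"
proof (induction w rule: qword_induct)
  case (letter x w)
  have "continuous_on S (\<lambda>a. leval a x)"
    by (cases x) (auto intro!: continuous_intros)
  with letter show ?case by (simp add: weval_add weval_lword continuous_on_mult)
qed simp

lemma continuous_on_peval: "continuous_on S (\<lambda>a. peval a p)"
  unfolding peval_def by (intro continuous_intros continuous_on_weval)

lemma continuous_on_pairing_weval: "continuous_on S (\<lambda>a. pairing (weval a) p)"
  unfolding pairing_def by (intro continuous_intros continuous_on_weval)

lemma nonneg_Reals_quat_iff: "x \<in> \<real>\<^sub>\<ge>\<^sub>0 \<longleftrightarrow> 0 \<le> Qre x \<and> Qi x = 0 \<and> Qj x = 0 \<and> Qk x = 0"
proof
  assume "0 \<le> Qre x \<and> Qi x = 0 \<and> Qj x = 0 \<and> Qk x = 0"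
  then have "x = of_real (Qre x)" "0 \<le> Qre x" by (simp_all add: quat_eq_iff)
  then show "x \<in> \<real>\<^sub>\<ge>\<^sub>0" by (metis nonneg_Reals_of_real_iff)
qed (auto elim!: nonneg_Reals_cases)

lemma closed_semialg: "closed (semialg m g l h)"
proof -
  have Q: "continuous_on UNIV (\<lambda>a. Qre (peval a p))" "continuous_on UNIV (\<lambda>a. Qi (peval a p))"
    "continuous_on UNIV (\<lambda>a. Qj (peval a p))" "continuous_on UNIV (\<lambda>a. Qk (peval a p))" for p :: "'a rpoly"
  proof -
    have "linear Qre" "linear Qi" "linear Qj" "linear Qk" by (auto intro!: linearI)
    then show "continuous_on UNIV (\<lambda>a. Qre (peval a p))" "continuous_on UNIV (\<lambda>a. Qi (peval a p))"
      "continuous_on UNIV (\<lambda>a. Qj (peval a p))" "continuous_on UNIV (\<lambda>a. Qk (peval a p))"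
      by (auto intro!: linear_continuous_on_compose[OF continuous_on_peval])
  qed
  have "closed {a. peval a (h j) = 0}" for j
    by (intro closed_Collect_eq continuous_on_peval continuous_on_const)
  moreover have "closed {a. peval a (g i) \<in> \<real>\<^sub>\<ge>\<^sub>0}" for i
    unfolding nonneg_Reals_quat_iff
    by (intro closed_Collect_conj closed_Collect_le closed_Collect_eq Q continuous_on_const)
  moreover have "semialg m g l h
      = (\<Inter>i\<in>{1..m}. {a. peval a (g i) \<in> \<real>\<^sub>\<ge>\<^sub>0}) \<inter> (\<Inter>j\<in>{1..l}. {a. peval a (h j) = 0})"
    by (auto simp: semialg_def)
  ultimately show ?thesis by (simp add: closed_INT closed_Int)
qed

section \<open>Moment conditions\<close>

definition moment_conditions ::
  "nat \<Rightarrow> (nat \<Rightarrow> 'n::finite rpoly) \<Rightarrow> nat \<Rightarrow> (nat \<Rightarrow> 'n rpoly) \<Rightarrow> ('n qword \<Rightarrow> quat) \<Rightarrow> bool" where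
  "moment_conditions m g l h y \<longleftrightarrow>
    (\<forall>d. quat_psd (words_upto d) (moment_matrix y)) \<and>
    (\<forall>d. \<forall>i\<in>{1..m}. quat_psd (words_upto d) (localizing_matrix (g i) y)) \<and>
    (\<forall>u v. \<forall>j\<in>{1..l}. riesz y (mon u * h j * mon v) = 0) \<and>
    (\<forall>u v w i. riesz y (mon u * commutator (mon w + mon (star w)) (mon (lword (Lq i))) * mon v) = 0)"

lemma pairing_in_qcone:
  assumes "moment_conditions m g l h y" "\<And>w. y w = star (y (star w))"
  shows "pairing y \<in> qcone m g l h"
  unfolding pos_cone_def mem_Collect_eq
proof (intro conjI ballI allI)
  show "pairing y (star p) = pairing y p" for p
    using hermitian_iff_pairing_star[of y] assms(2) by blast
  fix G p assume "G \<in> insert 1 (nonneg_constraints m g)"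
  then show "0 \<le> pairing y (star p * G * p)"
  proof
    assume "G = 1"
    then show ?thesis
      using assms(1) pairing_localizing_nonneg[of 1 y p]
      by (simp add: moment_conditions_def moment_matrix_eq_localizing)
  next
    assume "G \<in> nonneg_constraints m g"
    then show ?thesis
      using assms(1) pairing_localizing_nonneg[of "g i" y p for i]
      by (auto simp: moment_conditions_def nonneg_constraints_def)
  qed
next
  show "null_constraints l h \<subseteq> null_elems (pairing y)"
    using assms(1) unfolding null_constraints_def moment_conditions_def
    by (auto intro!: pairing_null_elems simp del: ofr_diff ofr_mult ofr_add)
qed (rule linear_pairing)

section \<open>Necessity of the moment conditions\<close>

lemma integral_nonneg_Reals:
  fixes f :: "'a \<Rightarrow> quat"
  assumes f: "has_bochner_integral \<mu> f x" and nn: "AE a in \<mu>. f a \<in> \<real>\<^sub>\<ge>\<^sub>0"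
  shows "x \<in> \<real>\<^sub>\<ge>\<^sub>0"
proof -
  have comp: "has_bochner_integral \<mu> (\<lambda>a. T (f a)) (T x)" if "linear T" for T :: "quat \<Rightarrow> real"
    by (rule has_bochner_integral_bounded_linear[OF _ f])
      (use that in \<open>simp add: linear_conv_bounded_linear\<close>)
  have lin: "linear Qre" "linear Qi" "linear Qj" "linear Qk" by (auto intro!: linearI)
  have "0 \<le> Qre x"
  proof -
    have "AE a in \<mu>. 0 \<le> Qre (f a)"
      using nn by eventually_elim (simp add: nonneg_Reals_quat_iff)
    then have "0 \<le> integral\<^sup>L \<mu> (\<lambda>a. Qre (f a))" by (rule integral_nonneg_AE)
    then show ?thesis using comp[OF lin(1)] by (simp add: has_bochner_integral_iff)
  qed
  moreover have "T x = 0" if T: "linear T" "\<And>z. z \<in> \<real>\<^sub>\<ge>\<^sub>0 \<Longrightarrow> T z = 0" for T :: "quat \<Rightarrow> real"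
  proof -
    have "AE a in \<mu>. T (f a) = 0" using nn by eventually_elim (rule T(2))
    then have "integral\<^sup>L \<mu> (\<lambda>a. T (f a)) = 0" by (rule integral_eq_zero_AE)
    then show ?thesis using comp[OF T(1)] by (simp add: has_bochner_integral_iff)
  qed
  ultimately show ?thesis
    using lin by (simp add: nonneg_Reals_quat_iff)
qed

lemma represents_iff_quat:
  assumes "represents \<mu> y K"
  shows "has_bochner_integral \<mu> (\<lambda>a. weval a w) (y w)"
proof -
  have *: "has_bochner_integral \<mu> (\<lambda>a. c (weval a w) *\<^sub>R u) (c (y w) *\<^sub>R u)"
    if "c \<in> {Qre, Qi, Qj, Qk}" for c and u :: quat
    using assms that unfolding represents_def by (intro has_bochner_integral_scaleR_left) auto
  have eq: "z = Qre z *\<^sub>R 1 + Qi z *\<^sub>R Quat 0 1 0 0 + Qj z *\<^sub>R Quat 0 0 1 0 + Qk z *\<^sub>R Quat 0 0 0 1" for z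
    by (simp add: quat_eq_iff)
  show ?thesis
    by (subst (1 2) eq) (intro has_bochner_integral_add *; simp)
qed

lemma has_bochner_integral_riesz:
  assumes "represents \<mu> y K"
  shows "has_bochner_integral \<mu> (\<lambda>a. peval a p) (riesz y p)"
  unfolding peval_def riesz_def
  by (intro has_bochner_integral_sum has_bochner_integral_scaleR_right represents_iff_quat[OF assms])

lemma represents_riesz_eq_0:
  assumes "represents \<mu> y K" "\<And>a. a \<in> K \<Longrightarrow> peval a p = 0"
  shows "riesz y p = 0"
proof -
  have "AE a in \<mu>. a \<in> K" using assms(1) by (simp add: represents_def)
  then have "AE a in \<mu>. peval a p = 0" by eventually_elim (rule assms(2))
  then have "integral\<^sup>L \<mu> (\<lambda>a. peval a p) = 0" by (rule integral_eq_zero_AE)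
  then show ?thesis using has_bochner_integral_riesz[OF assms(1), of p] by (simp add: has_bochner_integral_iff)
qed

lemma represents_quat_psd:
  assumes rep: "represents \<mu> y K" and g: "\<And>a. a \<in> K \<Longrightarrow> peval a g \<in> \<real>\<^sub>\<ge>\<^sub>0"
  shows "quat_psd V (localizing_matrix g y)"
  unfolding quat_psd_def
proof
  fix x
  define v where "v a = (\<Sum>w\<in>V. weval a w * x w)" for a
  have "has_bochner_integral \<mu> (\<lambda>a. \<Sum>u\<in>V. \<Sum>w\<in>V. star (x u) * peval a (mon (star u) * g * mon w) * x w)
      (\<Sum>u\<in>V. \<Sum>w\<in>V. star (x u) * localizing_matrix g y u w * x w)"
    unfolding localizing_matrix_def
    by (intro has_bochner_integral_sum has_bochner_integral_mult_left has_bochner_integral_mult_right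
        has_bochner_integral_riesz[OF rep])
  moreover have "(\<Sum>u\<in>V. \<Sum>w\<in>V. star (x u) * peval a (mon (star u) * g * mon w) * x w)
      = star (v a) * peval a g * v a" for a
    by (simp add: v_def star_sum weval_star sum_distrib_left sum_distrib_right mult.assoc,
        rule sum.swap)
  ultimately have int: "has_bochner_integral \<mu> (\<lambda>a. star (v a) * peval a g * v a)
      (\<Sum>u\<in>V. \<Sum>w\<in>V. star (x u) * localizing_matrix g y u w * x w)"
    by simp
  have "AE a in \<mu>. star (v a) * peval a g * v a \<in> \<real>\<^sub>\<ge>\<^sub>0"
  proof -
    have "star (v a) * peval a g * v a \<in> \<real>\<^sub>\<ge>\<^sub>0" if a: "a \<in> K" for a
    proof -
      obtain r where r: "peval a g = of_real r" "0 \<le> r" using g[OF a] by (elim nonneg_Reals_cases)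
      have "star (v a) * of_real r * v a = r *\<^sub>R (star (v a) * v a)"
        by (simp add: of_real_def)
      also have "\<dots> = of_real (r * (norm (v a))\<^sup>2)"
        by (simp add: star_mult_self scaleR_conv_of_real)
      finally show ?thesis using r by simp
    qed
    moreover have "AE a in \<mu>. a \<in> K" using rep by (simp add: represents_def)
    ultimately show ?thesis by (metis (mono_tags, lifting) AE_mp AE_I2)
  qed
  then show "(\<Sum>u\<in>V. \<Sum>w\<in>V. star (x u) * localizing_matrix g y u w * x w) \<in> \<real>\<^sub>\<ge>\<^sub>0"
    by (rule integral_nonneg_Reals[OF int])
qed

lemma represents_moment_conditions:
  assumes rep: "represents \<mu> y (semialg m g l h)"
  shows "moment_conditions m g l h y"
  unfolding moment_conditions_def
proof (intro conjI allI ballI)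
  show "quat_psd (words_upto d) (moment_matrix y)" for d
    unfolding moment_matrix_eq_localizing
    by (rule represents_quat_psd[OF rep]) simp
  show "quat_psd (words_upto d) (localizing_matrix (g i) y)" if "i \<in> {1..m}" for d i
    by (rule represents_quat_psd[OF rep]) (use that in \<open>auto simp: semialg_def\<close>)
  show "riesz y (mon u * h j * mon v) = 0" if "j \<in> {1..l}" for u v j
    by (rule represents_riesz_eq_0[OF rep]) (use that in \<open>auto simp: semialg_def\<close>)
  show "riesz y (mon u * commutator (mon w + mon (star w)) (mon (lword (Lq i))) * mon v) = 0" for u v w i
  proof (rule represents_riesz_eq_0[OF rep])
    fix a
    \<comment> \<open>Twice a real part is a real scalar, so these commutators vanish at every
      point, on or off the semialgebraic set.\<close>
    have "weval a w + star (weval a w) = (2 * Qre (weval a w)) *\<^sub>R 1"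
      by (simp add: quat_eq_iff)
    then have "(weval a w + star (weval a w)) * z = z * (weval a w + star (weval a w))" for z
      by simp
    then show "peval a (mon u * commutator (mon w + mon (star w)) (mon (lword (Lq i))) * mon v) = 0"
      by (simp add: commutator_def weval_star)
  qed
qed

text \<open>The Dirac measure makes point evaluations an instance of the necessity direction, which
  puts them into the cone.\<close>

lemma represents_return:
  assumes "a \<in> semialg m g l h"
  shows "represents (return borel a) (weval a) (semialg m g l h)"
proof -
  have "has_bochner_integral (return borel a) (\<lambda>b. c (weval b w)) (c (weval a w))"
    if "c \<in> {Qre, Qi, Qj, Qk}" for c w
  proof -
    have "linear c" using that by (auto intro!: linearI)
    then have "(\<lambda>b. c (weval b w)) \<in> borel_measurable borel"
      by (intro borel_measurable_continuous_onI linear_continuous_on_compose[OF continuous_on_weval])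
    moreover have "integrable (return borel a) (\<lambda>b. c (weval b w))"
    proof -
      interpret prob_space "return borel a" by (rule prob_space_return) simp
      show ?thesis
        using calculation by (intro integrable_const_bound[of _ "norm (c (weval a w))"])
          (subst AE_return, auto)
    qed
    ultimately show ?thesis
      by (simp add: has_bochner_integral_iff integral_return)
  qed
  moreover have "AE b in return borel a. b \<in> semialg m g l h"
    using assms borel_closed[OF closed_semialg[of m g l h]] by (subst AE_return) (simp_all add: pred_def)
  ultimately show ?thesis by (auto simp: represents_def)
qed

lemma pairing_weval_in_qcone:
  assumes "a \<in> semialg m g l h"
  shows "pairing (weval a) \<in> qcone m g l h"
  using pairing_in_qcone[OF represents_moment_conditions[OF represents_return[OF assms]]]
  by (simp add: weval_star)

section \<open>Consequences of the Archimedean condition\<close>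

text \<open>The certificate bounds the sum of the |q_i|^2, taken between \<open>star p\<close> and
  \<open>p\<close>, and each summand is nonnegative. R comes from the certificate alone, so it
  serves the whole cone.\<close>

lemma archimedean_bound:
  fixes g h :: "nat \<Rightarrow> 'n::finite rpoly"
  assumes arch: "archimedean m g l h" and g: "\<And>i. i \<in> {1..m} \<Longrightarrow> star (g i) = g i"
  shows "\<exists>R>0. \<forall>L\<in>qcone m g l h. \<forall>x p.
    L (star (ofr (mon (lword x)) * p) * (ofr (mon (lword x)) * p)) \<le> R * L (star p * p)"
proof -
  obtain R where R: "R > 0" "fp_inr (of_real R - (\<Sum>i\<in>UNIV. mon (absq2 i))) \<in> qmodule m g l h"
    using arch by (auto simp: archimedean_def)
  have "L (star (ofr (mon (lword x)) * p) * (ofr (mon (lword x)) * p)) \<le> R * L (star p * p)"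
    if L: "L \<in> qcone m g l h" for L x p
  proof -
    interpret positive_functional L by (rule pos_cone_positive_functional[OF L])
    have sq: "L (star p * ofr (mon (absq2 (idx x))) * p) = L (star (ofr (mon (lword x)) * p) * (ofr (mon (lword x)) * p))" for x
    proof -
      have "absq2 (idx x) = star (lword x) + lword x"
      proof (cases x)
        case (Lq i)
        then show ?thesis by (simp add: star_lword absq2_eq)
      next
        case (Lqbar i)
        then show ?thesis by (simp add: star_lword absq2_def)
      qed
      then have "ofr (mon (absq2 (idx x))) = star (ofr (mon (lword x))) * ofr (mon (lword x))"
        by (simp add: mon_add flip: ofr_star)
      then show ?thesis by (simp add: mult.assoc)
    qed
    have nn: "0 \<le> L (star p * ofr (mon (absq2 i)) * p)" for i
      using sq[of "Lq i"] nonneg[of "ofr (mon (lword (Lq i))) * p"] by simp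
    have "0 \<le> L (star p * fphom (fp_inr (of_real R - (\<Sum>i\<in>UNIV. mon (absq2 i)))) * p)"
      by (rule qmodule_nonneg[OF L g R(2)])
    also have "\<dots> = R * L (star p * p) - (\<Sum>i\<in>UNIV. L (star p * ofr (mon (absq2 i)) * p))"
      by (simp add: of_real_def linear_sum[OF linear_ofr] L_simps right_diff_distrib left_diff_distrib
          sum_distrib_left sum_distrib_right linear_sum[OF linear])
    finally have "(\<Sum>i\<in>UNIV. L (star p * ofr (mon (absq2 i)) * p)) \<le> R * L (star p * p)" by simp
    moreover have "L (star p * ofr (mon (absq2 (idx x))) * p) \<le> (\<Sum>i\<in>UNIV. L (star p * ofr (mon (absq2 i)) * p))"
      by (rule member_le_sum) (auto simp: nn)
    ultimately show ?thesis by (simp add: sq)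
  qed
  with R(1) show ?thesis by blast
qed

lemma word_bound:
  fixes g h :: "nat \<Rightarrow> 'n::finite rpoly"
  assumes arch: "archimedean m g l h" and g: "\<And>i. i \<in> {1..m} \<Longrightarrow> star (g i) = g i"
  shows "\<exists>C\<ge>0. \<forall>L\<in>qcone m g l h. \<forall>p. L (star (ofr (mon w) * p) * (ofr (mon w) * p)) \<le> C * L (star p * p)"
proof -
  obtain R where R: "R > 0" "\<And>L x p. L \<in> qcone m g l h \<Longrightarrow>
      L (star (ofr (mon (lword x)) * p) * (ofr (mon (lword x)) * p)) \<le> R * L (star p * p)"
    using archimedean_bound[OF arch g] by blast
  show ?thesis
  proof (induction w rule: qword_induct)
    case zero
    show ?case by (intro exI[of _ 1]) simp
  next
    case (letter x w)
    then obtain C where C: "C \<ge> 0"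
      "\<And>L p. L \<in> qcone m g l h \<Longrightarrow> L (star (ofr (mon w) * p) * (ofr (mon w) * p)) \<le> C * L (star p * p)"
      by blast
    have "L (star (ofr (mon (lword x + w)) * p) * (ofr (mon (lword x + w)) * p)) \<le> R * C * L (star p * p)"
      if L: "L \<in> qcone m g l h" for L p
    proof -
      have "L (star (ofr (mon (lword x + w)) * p) * (ofr (mon (lword x + w)) * p))
          = L (star (ofr (mon (lword x)) * (ofr (mon w) * p)) * (ofr (mon (lword x)) * (ofr (mon w) * p)))"
        by (simp add: mon_add mult.assoc)
      also have "\<dots> \<le> R * L (star (ofr (mon w) * p) * (ofr (mon w) * p))" by (rule R(2)[OF L])
      also have "\<dots> \<le> R * (C * L (star p * p))" using C(2)[OF L, of p] R(1) by (intro mult_left_mono) auto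
      finally show ?thesis by (simp add: mult.assoc)
    qed
    then show ?case using R(1) C(1) by (intro exI[of _ "R * C"]) auto
  qed
qed

lemma state_bound:
  fixes g h :: "nat \<Rightarrow> 'n::finite rpoly"
  assumes arch: "archimedean m g l h" and g: "\<And>i. i \<in> {1..m} \<Longrightarrow> star (g i) = g i"
  shows "\<exists>B. \<forall>L\<in>states (nonneg_constraints m g) (null_constraints l h). \<bar>L p\<bar> \<le> B"
proof (induction p rule: poly_mapping_additive_induct)
  case (single w c)
  obtain C where C: "C \<ge> 0"
    "\<And>L p. L \<in> qcone m g l h \<Longrightarrow> L (star (ofr (mon w) * p) * (ofr (mon w) * p)) \<le> C * L (star p * p)"
    using word_bound[OF arch g] by blast
  have "\<bar>L (Poly_Mapping.single w c)\<bar> \<le> sqrt (C * (norm c)\<^sup>2)"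
    if "L \<in> states (nonneg_constraints m g) (null_constraints l h)" for L
  proof -
    have L: "L \<in> qcone m g l h" "L 1 = 1" using that by (auto simp: states_def)
    interpret positive_functional L by (rule pos_cone_positive_functional[OF L(1)])
    have cc: "star (konst c) * konst c = (norm c)\<^sup>2 *\<^sub>R 1"
    proof -
      have "star (konst c) * konst c = konst (star c * c)" by simp
      also have "star c * c = (norm c)\<^sup>2 *\<^sub>R 1" by (simp add: star_mult_self of_real_def)
      finally show ?thesis by simp
    qed
    have "Poly_Mapping.single w c = ofr (mon w) * konst c"
      by (simp add: single_eq_konst_mon konst_ofr_commute)
    then have "(L (Poly_Mapping.single w c))\<^sup>2 \<le> L (star (ofr (mon w) * konst c) * (ofr (mon w) * konst c))"
      using square_le[of "ofr (mon w) * konst c"] L(2) by simp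
    also have "\<dots> \<le> C * L (star (konst c) * konst c)" by (rule C(2)[OF L(1)])
    also have "\<dots> = C * (norm c)\<^sup>2" by (simp add: cc L_simps L(2))
    finally show ?thesis by (rule real_le_rsqrt[of "\<bar>_\<bar>", simplified])
  qed
  then show ?case by blast
next
  case (add p q)
  then obtain B B' where B: "\<And>L. L \<in> states (nonneg_constraints m g) (null_constraints l h) \<Longrightarrow> \<bar>L p\<bar> \<le> B"
    "\<And>L. L \<in> states (nonneg_constraints m g) (null_constraints l h) \<Longrightarrow> \<bar>L q\<bar> \<le> B'"
    by blast
  have "\<bar>L (p + q)\<bar> \<le> B + B'" if L: "L \<in> states (nonneg_constraints m g) (null_constraints l h)" for L
  proof -
    have "linear L" using L by (simp add: states_def pos_cone_def)
    then show ?thesis using B[OF L] by (simp add: linear_add)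
  qed
  then show ?case by blast
qed

text \<open>Evaluation at a point of the set lies in the cone, where the letter bound with p = 1
  reads |a_i|^2 \<le> R.\<close>

lemma compact_semialg:
  fixes g h :: "nat \<Rightarrow> 'n::finite rpoly"
  assumes arch: "archimedean m g l h" and g: "\<And>i. i \<in> {1..m} \<Longrightarrow> star (g i) = g i"
  shows "compact (semialg m g l h)"
proof -
  obtain R where R: "R > 0" "\<And>L x p. L \<in> qcone m g l h \<Longrightarrow>
      L (star (ofr (mon (lword x)) * p) * (ofr (mon (lword x)) * p)) \<le> R * L (star p * p)"
    using archimedean_bound[OF arch g] by blast
  have "norm a \<le> sqrt (real CARD('n) * R)" if a: "a \<in> semialg m g l h" for a :: "quat ^ 'n"
  proof -
    have "(norm (a $ i))\<^sup>2 \<le> R" for i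
    proof -
      have "star (ofr (mon (lword (Lq i)))) * ofr (mon (lword (Lq i)))
          = konst 1 * ofr (star (mon (lword (Lq i))) * mon (lword (Lq i)))"
        by (simp del: mon_star)
      then have "pairing (weval a) (star (ofr (mon (lword (Lq i))) * 1) * (ofr (mon (lword (Lq i))) * 1))
          = Qre (star (a $ i) * a $ i)"
        by (simp only: mult_1_right pairing_konst_ofr peval_eq_riesz[symmetric])
          (simp add: weval_star weval_lword inner_quat_def)
      moreover have "pairing (weval a) (star 1 * 1) = 1"
        using pairing_single[of "weval a" 0 1] by (simp add: inner_quat_def)
      ultimately show ?thesis
        using R(2)[OF pairing_weval_in_qcone[OF a], of "Lq i" 1] by (simp add: star_mult_self del: of_real_power)
    qed
    then have "(\<Sum>i\<in>UNIV. (norm (a $ i))\<^sup>2) \<le> (\<Sum>i\<in>(UNIV::'n set). R)" by (rule sum_mono)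
    then show ?thesis by (simp add: norm_vec_def L2_set_def)
  qed
  then have "bounded (semialg m g l h)" by (rule boundedI)
  then show ?thesis using closed_semialg by (simp add: compact_eq_bounded_closed)
qed

text \<open>Banach-Alaoglu in pointwise form: the bounds place the states in a product of compact
  intervals, and each defining condition involves finitely many values of \<open>L\<close>, hence is
  closed.\<close>

lemma compact_states:
  fixes G N :: "'a::star_algebra set"
  assumes "\<And>p. \<exists>B. \<forall>L\<in>states G N. \<bar>L p\<bar> \<le> B"
  shows "compact (states G N)"
proof -
  obtain B where B: "\<And>p L. L \<in> states G N \<Longrightarrow> \<bar>L p\<bar> \<le> B p" using assms by metis
  have "compactin (product_topology (\<lambda>_. euclidean) (UNIV :: 'a set)) (PiE UNIV (\<lambda>p. {- B p..B p}))"
    by (simp add: compactin_PiE)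
  then have box: "compact (PiE UNIV (\<lambda>p. {- B p..B p}))"
    by (simp add: euclidean_product_topology)
  have "states G N = {L. (\<forall>p q. L (p + q) = L p + L q) \<and> (\<forall>c p. L (c *\<^sub>R p) = c * L p) \<and>
      (\<forall>p. L (star p) = L p) \<and> (\<forall>g\<in>insert 1 G. \<forall>p. 0 \<le> L (star p * g * p)) \<and>
      (\<forall>n\<in>N. \<forall>p r. L (p * n * r) = 0) \<and> L 1 = 1}"
    by (auto simp: states_def pos_cone_def linear_iff null_elems_def)
  also have "closed \<dots>"
    unfolding Ball_def
    by (intro closed_Collect_conj closed_Collect_all closed_Collect_imp closed_Collect_eq closed_Collect_le
        continuous_on_add continuous_on_mult continuous_on_const continuous_on_product_coordinates open_Collect_const)
  finally have "compact (PiE UNIV (\<lambda>p. {- B p..B p}) \<inter> states G N)"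
    by (rule compact_Int_closed[OF box])
  moreover have "states G N \<subseteq> PiE UNIV (\<lambda>p. {- B p..B p})"
    using B by (auto simp: abs_le_iff minus_le_iff)
  ultimately show ?thesis by (simp add: Int_absorb1)
qed

section \<open>Extreme states\<close>

lemma extreme_state_real_part:
  fixes g h :: "nat \<Rightarrow> 'n::finite rpoly"
  assumes arch: "archimedean m g l h" and g: "\<And>i. i \<in> {1..m} \<Longrightarrow> star (g i) = g i"
    and ext: "extreme_in (states (nonneg_constraints m g) (null_constraints l h)) L"
  shows "L (ofr (p + star p) * x) = L (ofr (p + star p)) * L x"
proof -
  have L: "L \<in> qcone m g l h" using ext by (simp add: extreme_in_def states_def)
  interpret positive_functional L by (rule pos_cone_positive_functional[OF L])
  have word: "L (ofr (mon w + mon (star w)) * x) = L (ofr (mon w + mon (star w))) * L x" for w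
  proof -
    obtain C where C: "C \<ge> 0"
      "\<And>L p. L \<in> qcone m g l h \<Longrightarrow> L (star (ofr (mon w) * p) * (ofr (mon w) * p)) \<le> C * L (star p * p)"
      using word_bound[OF arch g] by blast
    show ?thesis
    proof (rule extreme_state_central[OF ext])
      show "star (ofr (mon w + mon (star w))) = ofr (mon w + mon (star w))"
        by (simp add: add.commute flip: ofr_star)
      show "central L (ofr (mon w + mon (star w)))" by (rule qcone_central_mon[OF L])
      \<comment> \<open>Between \<open>star p\<close> and \<open>p\<close> the two summands have
        equal values, whence the 2; sqrt C is the norm bound for \<open>w\<close>, applied through
        Cauchy-Schwarz.\<close>
      show "0 \<le> 2 * sqrt C" using C by simp
      show "\<bar>L (star p * ofr (mon w + mon (star w)) * p)\<bar> \<le> 2 * sqrt C * L (star p * p)" for p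
      proof -
        have "L (star p * ofr (mon (star w)) * p) = L (star p * ofr (mon w) * p)"
          using L_star[of "star p * ofr (mon w) * p"] by (simp add: mult.assoc flip: ofr_star)
        then have eq: "L (star p * ofr (mon w + mon (star w)) * p) = 2 * L (star p * (ofr (mon w) * p))"
          by (simp add: L_simps distrib_left distrib_right mult.assoc)
        have "(L (star p * (ofr (mon w) * p)))\<^sup>2 \<le> L (star p * p) * L (star (ofr (mon w) * p) * (ofr (mon w) * p))"
          by (rule cauchy_schwarz)
        also have "\<dots> \<le> L (star p * p) * (C * L (star p * p))"
          by (intro mult_left_mono C(2)[OF L] nonneg)
        also have "\<dots> = (sqrt C * L (star p * p))\<^sup>2"
          using C(1) by (simp add: power_mult_distrib power2_eq_square)
        finally have "\<bar>L (star p * (ofr (mon w) * p))\<bar> \<le> \<bar>sqrt C * L (star p * p)\<bar>"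
          by (simp add: abs_le_square_iff)
        then show ?thesis unfolding eq using C(1) nonneg[of p] by (simp add: abs_mult)
      qed
    qed
  qed
  show ?thesis
  proof (induction p rule: poly_mapping_additive_induct)
    case (single w r)
    have "Poly_Mapping.single w r + star (Poly_Mapping.single w r) = r *\<^sub>R (mon w + mon (star w))"
      by (simp add: single_eq_scaleR_mon scaleR_add_right)
    then show ?case using word[of w] by (simp add: L_simps del: ofr_add)
  next
    case (add p q)
    have "ofr (p + q + star (p + q)) = ofr (p + star p) + ofr (q + star q)"
      by (simp add: algebra_simps)
    then show ?case using add by (simp only: distrib_right L_simps)
  qed
qed

text \<open>Only the restriction to real polynomials is claimed to be scalar: with a coefficient c,
  the sum of c w and its star is in general not central, and the full quotient may be a matrix
  algebra with zero divisors.\<close>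

lemma extreme_state_scalar_functional:
  fixes g h :: "nat \<Rightarrow> 'n::finite rpoly"
  assumes arch: "archimedean m g l h" and g: "\<And>i. i \<in> {1..m} \<Longrightarrow> star (g i) = g i"
    and ext: "extreme_in (states (nonneg_constraints m g) (null_constraints l h)) L"
  shows "scalar_functional (\<lambda>r. L (ofr r))"
proof -
  have L: "L \<in> qcone m g l h" "L 1 = 1" using ext by (simp_all add: extreme_in_def states_def)
  interpret positive_functional L by (rule pos_cone_positive_functional[OF L(1)])
  show ?thesis
    unfolding scalar_functional_def positive_functional_def scalar_functional_axioms_def
  proof (intro conjI allI)
    show "linear (\<lambda>r. L (ofr r))" by (intro linearI) (simp_all add: L_simps)
    show "L (ofr (star p)) = L (ofr p)" for p by (simp add: L_star)
    show "0 \<le> L (ofr (star p * p))" for p by (simp add: nonneg)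
    show "L (ofr 1) = 1" using L by simp
    fix p
    have "L (ofr (u * (p + star p - (2 * L (ofr p)) *\<^sub>R 1) * v)) = 0" for u v
    proof -
      have "L (ofr (p + star p) * (ofr u * ofr v)) = 2 * L (ofr p) * L (ofr u * ofr v)"
      proof -
        have "L (ofr (p + star p)) = 2 * L (ofr p)" by (simp add: L_simps L_star)
        then show ?thesis by (simp only: extreme_state_real_part[OF arch g ext])
      qed
      moreover have "L (ofr u * ofr (p + star p) * ofr v) = L (ofr (p + star p) * (ofr u * ofr v))"
        using central_swap_left[OF qcone_central_real_part[OF L(1), of p], of "ofr u" "ofr v"]
        by (simp only: mult.assoc)
      ultimately show ?thesis
        by (simp add: L_simps left_diff_distrib right_diff_distrib distrib_left distrib_right)
    qed
    then show "p + star p - (2 * L (ofr p)) *\<^sub>R 1 \<in> null_elems (\<lambda>r. L (ofr r))"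
      by (simp add: null_elems_def)
  qed
qed

section \<open>From homomorphisms into the quaternions to points\<close>

lemma star_eq_scaleR_inverse: "star x = (norm x)\<^sup>2 *\<^sub>R inverse x" for x :: quat
  by (cases "x = 0") (simp_all add: inverse_quat_def)

text \<open>Conjugation by any nonzero \<open>\<eta>\<close> commutes with the star, because the
  norm factors of \<open>\<eta>\<close> and its inverse cancel; so it turns \<open>\<phi>\<close>
  into the evaluation at a point.\<close>

lemma weval_conjugation:
  fixes \<phi> :: "'n::finite rpoly \<Rightarrow> quat"
  assumes \<phi>: "\<phi> 1 = 1" "\<And>p q. \<phi> (p * q) = \<phi> p * \<phi> q" "\<And>p. \<phi> (star p) = star (\<phi> p)" and \<eta>: "\<eta> \<noteq> 0"
  shows "weval (\<chi> i. inverse \<eta> * \<phi> (mon (lword (Lq i))) * \<eta>) w = inverse \<eta> * \<phi> (mon w) * \<eta>"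
proof (induction w rule: qword_induct)
  case zero
  then show ?case using \<phi> \<eta> by simp
next
  case (letter x w)
  have "leval (\<chi> i. inverse \<eta> * \<phi> (mon (lword (Lq i))) * \<eta>) x = inverse \<eta> * \<phi> (mon (lword x)) * \<eta>"
  proof (cases x)
    case (Lqbar i)
    have "star (inverse \<eta>) = inverse ((norm \<eta>)\<^sup>2) *\<^sub>R \<eta>"
      using \<eta> by (simp add: inverse_quat_def)
    moreover have "star \<eta> = (norm \<eta>)\<^sup>2 *\<^sub>R inverse \<eta>" by (rule star_eq_scaleR_inverse)
    ultimately have conj: "star (inverse \<eta> * b * \<eta>) = inverse \<eta> * star b * \<eta>" for b
      using \<eta> by (simp add: mult.assoc)
    have "\<phi> (mon (lword (Lqbar i))) = star (\<phi> (mon (lword (Lq i))))"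
      using \<phi>(3)[of "mon (lword (Lq i))"] by (simp add: star_lword)
    then show ?thesis
      by (simp only: Lqbar leval.simps vec_lambda_beta conj)
  qed simp
  with letter show ?case using \<eta> by (simp add: weval_add weval_lword mon_add \<phi> mult.assoc)
    (simp flip: mult.assoc)
qed

lemma peval_conjugation:
  fixes \<phi> :: "'n::finite rpoly \<Rightarrow> quat"
  assumes \<phi>: "linear \<phi>" "\<phi> 1 = 1" "\<And>p q. \<phi> (p * q) = \<phi> p * \<phi> q" "\<And>p. \<phi> (star p) = star (\<phi> p)"
    and \<eta>: "\<eta> \<noteq> 0"
  shows "peval (\<chi> i. inverse \<eta> * \<phi> (mon (lword (Lq i))) * \<eta>) p = inverse \<eta> * \<phi> p * \<eta>"
  by (induction p rule: poly_mapping_additive_induct)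
    (simp_all add: single_eq_scaleR_mon weval_conjugation[OF \<phi>(2-4) \<eta>] linear_add[OF \<phi>(1)]
      linear_cmul[OF \<phi>(1)] distrib_left distrib_right)

text \<open>For an extreme state the coefficients \<open>y w\<close> factor through a homomorphism \<open>\<phi>\<close> into the
  quaternions followed by a unital positive map \<open>T\<close>.\<close>

lemma extreme_state_factorization:
  fixes g h :: "nat \<Rightarrow> 'n::finite rpoly"
  assumes arch: "archimedean m g l h" and g: "\<And>i. i \<in> {1..m} \<Longrightarrow> star (g i) = g i"
    and ext: "extreme_in (states (nonneg_constraints m g) (null_constraints l h)) (pairing y)"
  shows "\<exists>\<phi> (N::nat) \<xi>. linear \<phi> \<and> \<phi> 1 = 1 \<and> (\<forall>p q. \<phi> (p * q) = \<phi> p * \<phi> q) \<and>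
    (\<forall>p. \<phi> (star p) = star (\<phi> p)) \<and> (\<forall>p. Qre (\<phi> p) = pairing y (ofr p)) \<and>
    (\<forall>p. riesz y p = (\<Sum>k<N. star (\<xi> k) * \<phi> p * \<xi> k))"
proof -
  define L where "L = pairing y"
  note ext' = ext[folded L_def]
  have L: "L \<in> qcone m g l h" "L 1 = 1" using ext' by (simp_all add: extreme_in_def states_def)
  interpret positive_functional L by (rule pos_cone_positive_functional[OF L(1)])
  interpret S: scalar_functional "\<lambda>r. L (ofr r)"
    by (rule extreme_state_scalar_functional[OF arch g ext'])
  obtain \<phi> E where emb: "S.quat_embedding \<phi> E" and range: "(\<forall>u. \<phi> (E u) = u) \<or>
     (\<forall>u. \<phi> (E u) = Quat (Qre u) (Qi u) 0 0 \<and> E u = E (\<phi> (E u))) \<or>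
     (\<forall>u. \<phi> (E u) = Quat (Qre u) 0 0 0 \<and> E u = E (\<phi> (E u)))"
    using S.frobenius_embedding by blast
  have \<phi>: "linear \<phi>" "\<phi> 1 = 1" "\<And>p q. \<phi> (p * q) = \<phi> p * \<phi> q" "\<And>p. \<phi> (star p) = star (\<phi> p)"
      "\<And>p. Qre (\<phi> p) = L (ofr p)"
    and E: "linear E" "E 1 = 1" "\<And>u. star (E u) = E (star u)"
      "\<And>p. p - E (\<phi> p) \<in> null_elems (\<lambda>r. L (ofr r))"
    using emb by (simp_all add: S.quat_embedding_def)
  define Y where "Y = riesz y"
  have LY: "L (konst c * ofr p) = inner c (Y p)" for c p
    by (simp add: L_def Y_def pairing_konst_ofr)
  have Y_null: "Y n = 0" if n: "n \<in> null_elems (\<lambda>r. L (ofr r))" for n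
  proof -
    have "L (star (ofr n) * ofr n) = 0"
      using null_elemsD1[OF null_elems_mult(1)[OF n, of "star n"]] by simp
    \<comment> \<open>\<open>n\<close> is null against real multipliers only; testing with the
      constant \<open>Y n\<close> lets Cauchy-Schwarz conclude |Y n|^2 = 0.\<close>
    then have "(L (star (star (konst (Y n))) * ofr n))\<^sup>2 \<le> 0"
      using cauchy_schwarz[of "star (konst (Y n))" "ofr n"] by simp
    then show ?thesis by (simp add: LY)
  qed
  have linY: "linear Y" by (simp add: Y_def linear_riesz)
  define T where "T u = Y (E u)" for u
  have YT: "Y p = T (\<phi> p)" for p
    using Y_null[OF E(4)[of p]] by (simp add: linear_diff[OF linY] T_def)
  have linT: "linear T"
    unfolding T_def using linear_compose[OF E(1) linY] by (simp add: o_def)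
  have Y_star: "Y (star p) = star (Y p)" for p
  proof -
    have "inner c (Y (star p)) = inner c (star (Y p))" for c
    proof -
      have "inner c (Y (star p)) = L (star (konst (star c) * ofr p))"
        by (simp add: konst_ofr_commute flip: LY ofr_star)
      also have "\<dots> = inner (star c) (Y p)" by (simp only: L_star LY)
      also have "\<dots> = inner c (star (Y p))" by (simp add: inner_quat_def)
      finally show ?thesis .
    qed
    then show ?thesis by (metis vector_eq_ldot)
  qed
  have T1: "T 1 = 1"
  proof -
    have "Y 1 = star (Y 1)" using Y_star[of 1] by simp
    moreover have "Qre (Y 1) = 1" using LY[of 1 1] L(2) by (simp add: inner_quat_def)
    ultimately show ?thesis by (simp add: T_def E(2) quat_eq_iff)
  qed
  have T_star: "T (star u) = star (T u)" for u
    by (simp add: T_def Y_star flip: E(3))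
  define qi qj qk where "qi = Quat 0 1 0 0" and "qj = Quat 0 0 1 0" and "qk = Quat 0 0 0 1"
  have pos: "0 \<le> inner (star x * x) 1 + inner (star x * qi * x) (T qi)
      + inner (star x * qj * x) (T qj) + inner (star x * qk * x) (T qk)" for x
  proof -
    define f where "f v = inner (star x * v * x) (T v)" for v
    have T0: "T 0 = 0" by (rule linear_0[OF linT])
    text \<open>On \<open>\<Sum>\<^sub>u (u x) E(u)\<close>, with \<open>u\<close> ranging over \<open>1, i, j, k\<close>, the positivity of \<open>L\<close> gives the required
      inequality multiplied by the dimension of the range of \<open>\<phi>\<close>.\<close>
    define U where "U = [1, qi, qj, qk]"
    define P where "P t = konst (U ! t * x) * ofr (E (U ! t))" for t
    have PP: "L (star (P s) * P t) = inner (star x * (star (U ! s) * U ! t) * x)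
        (T (star (\<phi> (E (U ! s))) * \<phi> (E (U ! t))))" for s t
    proof -
      have "star (P s) * P t = (konst (star (U ! s * x)) * ofr (star (E (U ! s)))) * P t"
        by (simp only: P_def star_mult ofr_star[symmetric] konst_simps(3)[symmetric]
            konst_ofr_commute[symmetric])
      also have "\<dots> = konst (star (U ! s * x) * (U ! t * x)) * ofr (star (E (U ! s)) * E (U ! t))"
        unfolding P_def by (rule konst_mult_shuffle)
      finally show ?thesis by (simp only: LY YT \<phi>) (simp add: mult.assoc)
    qed
    have sum4: "(\<Sum>k<4. F k) = F 0 + F 1 + F 2 + F 3" for F :: "nat \<Rightarrow> 'c::comm_monoid_add"
      by (simp add: eval_nat_numeral)
    have Un: "U ! 0 = 1" "U ! 1 = qi" "U ! 2 = qj" "U ! 3 = qk"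
      by (simp_all add: U_def eval_nat_numeral)
    have "0 \<le> L (star (\<Sum>t<4. P t) * (\<Sum>t<4. P t))" by (rule nonneg)
    also have "\<dots> = (\<Sum>s<4. \<Sum>t<4. L (star (P s) * P t))"
      by (simp add: star_sum sum_distrib_left sum_distrib_right linear_sum[OF linear], rule sum.swap)
    finally have ge: "0 \<le> (\<Sum>s<4. \<Sum>t<4. inner (star x * (star (U ! s) * U ! t) * x)
        (T (star (\<phi> (E (U ! s))) * \<phi> (E (U ! t)))))"
      by (simp only: PP)
    have table: "star qi = - qi" "star qj = - qj" "star qk = - qk" "qi * qi = - 1" "qj * qj = - 1" "qk * qk = - 1"
      "qi * qj = qk" "qj * qi = - qk" "qj * qk = qi" "qk * qj = - qi" "qk * qi = qj" "qi * qk = - qj"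
      by (simp_all add: qi_def qj_def qk_def quat_eq_iff quat_sel_mult)
    from range have "0 \<le> f 1 + f qi + f qj + f qk"
    proof (elim disjE)
      assume id: "\<forall>u. \<phi> (E u) = u"
      show ?thesis
        using ge unfolding sum4 Un id[rule_format]
        by (simp add: table f_def linear_neg[OF linT])
    next
      assume C: "\<forall>u. \<phi> (E u) = Quat (Qre u) (Qi u) 0 0 \<and> E u = E (\<phi> (E u))"
      then have \<phi>E: "\<phi> (E 1) = 1" "\<phi> (E qi) = qi" "\<phi> (E qj) = 0" "\<phi> (E qk) = 0"
        by (simp_all add: qi_def qj_def qk_def quat_eq_iff)
      \<comment> \<open>\<open>E\<close> of an unreached unit equals \<open>E 0\<close>, so these
        units contribute nothing to the required sum.\<close>
      have "T qj = T 0" "T qk = T 0" using C \<phi>E unfolding T_def by metis+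
      then have "f qj = 0" "f qk = 0" by (simp_all add: f_def T0)
      moreover have "0 \<le> f 1 + f qi"
        using ge unfolding sum4 Un \<phi>E
        by (simp add: table T0 f_def linear_neg[OF linT])
      ultimately show ?thesis by simp
    next
      assume R: "\<forall>u. \<phi> (E u) = Quat (Qre u) 0 0 0 \<and> E u = E (\<phi> (E u))"
      then have \<phi>E: "\<phi> (E 1) = 1" "\<phi> (E qi) = 0" "\<phi> (E qj) = 0" "\<phi> (E qk) = 0"
        by (simp_all add: qi_def qj_def qk_def quat_eq_iff)
      have "T qi = T 0" "T qj = T 0" "T qk = T 0" using R \<phi>E unfolding T_def by metis+
      then have "f qi = 0" "f qj = 0" "f qk = 0" by (simp_all add: f_def T0)
      moreover have "f 1 = (norm x)\<^sup>2"
        by (simp add: f_def T1 star_mult_self inner_quat_def del: of_real_power)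
      ultimately show ?thesis by simp
    qed
    then show ?thesis by (simp add: f_def T1)
  qed
  then obtain N :: nat and \<xi> where "\<And>b. T b = (\<Sum>k<N. star (\<xi> k) * b * \<xi> k)"
    using quat_map_sum_of_conjugations[OF linT T1 T_star] unfolding qi_def qj_def qk_def by blast
  then have "riesz y p = (\<Sum>k<N. star (\<xi> k) * \<phi> p * \<xi> k)" for p
    using YT[of p] by (simp add: Y_def)
  with \<phi> show ?thesis unfolding L_def by blast
qed

text \<open>\<open>star \<xi> * b * \<xi>\<close> is |\<xi>|^2 times a conjugate of b, and these
  weights add up to \<open>L 1\<close>. Conjugating the images of all letters simultaneously gives a
  point of the set: \<open>\<phi> (g i)\<close> is a nonnegative real scalar, untouched by
  conjugation, and \<open>\<phi> (h j)\<close> is 0.\<close>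

lemma extreme_state_mixture:
  fixes g h :: "nat \<Rightarrow> 'n::finite rpoly"
  assumes arch: "archimedean m g l h" and g: "\<And>i. i \<in> {1..m} \<Longrightarrow> star (g i) = g i"
    and ext: "extreme_in (states (nonneg_constraints m g) (null_constraints l h)) L"
  shows "L \<in> mixtures (semialg m g l h) (\<lambda>p a. pairing (weval a) p)"
proof -
  have L: "L \<in> qcone m g l h" "L 1 = 1" using ext by (simp_all add: extreme_in_def states_def)
  interpret positive_functional L by (rule pos_cone_positive_functional[OF L(1)])
  define y where "y w = (\<Sum>u\<in>Basis. L (Poly_Mapping.single w u) *\<^sub>R u)" for w
  have Ly: "L = pairing y"
    unfolding y_def[abs_def] by (rule HOL.ext) (rule linear_functional_eq_pairing[OF linear])
  obtain \<phi> N \<xi> where \<phi>: "linear \<phi>" "\<phi> 1 = 1" "\<And>p q. \<phi> (p * q) = \<phi> p * \<phi> q"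
      "\<And>p. \<phi> (star p) = star (\<phi> p)" "\<And>p. Qre (\<phi> p) = L (ofr p)"
    and \<xi>: "\<And>p. riesz y p = (\<Sum>k<N::nat. star (\<xi> k) * \<phi> p * \<xi> k)"
    using extreme_state_factorization[OF arch g ext[unfolded Ly]] unfolding Ly[symmetric] by blast
  have sum_norm: "(\<Sum>k<N. (norm (\<xi> k))\<^sup>2) = 1"
  proof -
    have "inner 1 (riesz y 1) = 1"
      using pairing_konst_ofr[of y 1 1] L(2) by (simp add: Ly)
    then have "Qre (\<Sum>k<N. star (\<xi> k) * \<xi> k) = 1"
      by (simp add: \<xi> \<phi>(2) inner_quat_def)
    moreover have "(\<Sum>k<N. star (\<xi> k) * \<xi> k) = of_real (\<Sum>k<N. (norm (\<xi> k))\<^sup>2)"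
      by (simp add: star_mult_self del: of_real_power)
    ultimately show ?thesis by (simp del: of_real_sum)
  qed
  then obtain k0 where k0: "\<xi> k0 \<noteq> 0"
    by (metis (no_types, lifting) norm_zero power_zero_numeral sum.neutral zero_neq_one)
  \<comment> \<open>A vanishing \<open>\<xi> k\<close> has weight 0 but still needs a point of the
    set; it borrows \<open>\<xi> k0\<close>.\<close>
  define \<eta> where "\<eta> k = (if \<xi> k = 0 then \<xi> k0 else \<xi> k)" for k
  have \<eta>: "\<eta> k \<noteq> 0" for k using k0 by (simp add: \<eta>_def)
  define a where "a k = (\<chi> i. inverse (\<eta> k) * \<phi> (mon (lword (Lq i))) * \<eta> k)" for k
  have pa: "peval (a k) p = inverse (\<eta> k) * \<phi> p * \<eta> k" for k p
    unfolding a_def by (rule peval_conjugation[OF \<phi>(1-4) \<eta>])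
  have "a k \<in> semialg m g l h" for k
    unfolding semialg_def mem_Collect_eq
  proof (intro conjI ballI)
    fix i assume i: "i \<in> {1..m}"
    have "star (\<phi> (g i)) = \<phi> (g i)" using \<phi>(4)[of "g i"] g[OF i] by simp
    then have "\<phi> (g i) = Qre (\<phi> (g i)) *\<^sub>R 1" by (simp add: quat_eq_iff)
    also have "Qre (\<phi> (g i)) = L (star 1 * ofr (g i) * 1)" by (simp add: \<phi>(5))
    finally have *: "\<phi> (g i) = L (star 1 * ofr (g i) * 1) *\<^sub>R 1" .
    have "0 \<le> L (star 1 * ofr (g i) * 1)"
    proof -
      have "ofr (g i) \<in> nonneg_constraints m g" using i by (auto simp: nonneg_constraints_def)
      then show ?thesis using L(1) unfolding pos_cone_def by blast
    qed
    moreover have "peval (a k) (g i) = of_real (L (star 1 * ofr (g i) * 1))"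
      unfolding pa by (subst *) (simp add: \<eta> of_real_def)
    ultimately show "peval (a k) (g i) \<in> \<real>\<^sub>\<ge>\<^sub>0" by simp
  next
    fix j assume j: "j \<in> {1..l}"
    have "ofr (h j) \<in> null_elems L"
      using L(1) j by (auto simp: pos_cone_def null_constraints_def)
    then have "L (star (ofr (h j)) * ofr (h j) * 1) = 0" by (rule null_elemsD)
    then have "Qre (\<phi> (star (h j) * h j)) = 0" by (simp add: \<phi>(5))
    then have "(norm (\<phi> (h j)))\<^sup>2 = 0" by (simp add: \<phi> star_mult_self del: of_real_power)
    then show "peval (a k) (h j) = 0" by (simp add: pa)
  qed
  moreover have "L p = (\<Sum>k<N. (norm (\<xi> k))\<^sup>2 * pairing (weval (a k)) p)" for p
  proof -
    have "star (\<xi> k) * b * \<xi> k = (norm (\<xi> k))\<^sup>2 *\<^sub>R (inverse (\<eta> k) * b * \<eta> k)" for k b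
      by (simp add: star_eq_scaleR_inverse \<eta>_def)
    then have y: "y w = (\<Sum>k<N. (norm (\<xi> k))\<^sup>2 *\<^sub>R weval (a k) w)" for w
      using \<xi>[of "mon w"] pa[of _ "mon w"] by simp
    have "pairing y p = (\<Sum>k<N. (norm (\<xi> k))\<^sup>2 * pairing (weval (a k)) p)"
      unfolding pairing_def y
      by (simp add: inner_sum_right sum_distrib_left, subst sum.swap) (simp add: mult.left_commute)
    then show ?thesis by (simp add: Ly)
  qed
  ultimately show ?thesis
    unfolding mixtures_def mem_Collect_eq using sum_norm
    by (intro exI[of _ N] exI[of _ "\<lambda>k. (norm (\<xi> k))\<^sup>2"] exI[of _ a]) auto
qed

section \<open>Existence of representing measures\<close>

lemma weval_component_measurable:
  assumes "c \<in> {Qre, Qi, Qj, Qk}"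
  shows "(\<lambda>a. c (weval a w)) \<in> borel_measurable borel"
proof -
  have "linear c" using assms by (auto intro!: linearI)
  then show ?thesis
    by (intro borel_measurable_continuous_onI linear_continuous_on_compose[OF continuous_on_weval])
qed

lemma countable_qword_basis: "countable {Poly_Mapping.single w u :: 'n::finite qpoly | w u. u \<in> Basis}"
proof -
  have "countable (UNIV :: 'n letter list set)"
    using countable_lists[OF countable_finite[OF finite_letter[where 'n = 'n]]] by simp
  then have "countable (range (abs_qword :: 'n letter list \<Rightarrow> 'n qword))" by (rule countable_image)
  moreover have "range (abs_qword :: 'n letter list \<Rightarrow> 'n qword) = UNIV"
    by (metis Quotient3_abs_rep Quotient3_qword surjI)
  ultimately have "countable (UNIV :: 'n qword set)" by simp
  then have "countable ((UNIV :: 'n qword set) \<times> (Basis :: quat set))"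
    by (intro countable_SIGMA) (auto intro: countable_finite)
  then have "countable ((\<lambda>(w, u). Poly_Mapping.single w u :: 'n qpoly) ` (UNIV \<times> Basis))"
    by (rule countable_image)
  moreover have "(\<lambda>(w, u). Poly_Mapping.single w u :: 'n qpoly) ` (UNIV \<times> Basis)
      = {Poly_Mapping.single w u | w u. u \<in> Basis}"
    by auto
  ultimately show ?thesis by simp
qed

theorem state_representing_measure:
  fixes g h :: "nat \<Rightarrow> 'n::finite rpoly"
  assumes arch: "archimedean m g l h" and g: "\<And>i. i \<in> {1..m} \<Longrightarrow> star (g i) = g i"
    and L: "L \<in> states (nonneg_constraints m g) (null_constraints l h)"
  shows "\<exists>\<mu>. sets \<mu> = sets borel \<and> (AE a in \<mu>. a \<in> semialg m g l h) \<and>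
    (\<forall>w. \<forall>u\<in>Basis. has_bochner_integral \<mu> (\<lambda>a. inner u (weval a w)) (L (Poly_Mapping.single w u)))"
proof -
  define S where "S = states (nonneg_constraints m g) (null_constraints l h)"
  define K where "K = semialg m g l h"
  define F :: "'n qpoly \<Rightarrow> quat ^ 'n \<Rightarrow> real" where "F p a = pairing (weval a) p" for p a
  \<comment> \<open>These countably many coordinates determine a linear functional, and convergence
    on them is all that the representing measure has to see.\<close>
  define J where "J = {Poly_Mapping.single w u :: 'n qpoly | w u. u \<in> Basis}"
  have "J \<noteq> {}" by (auto simp: J_def)
  then obtain e :: "nat \<Rightarrow> 'n qpoly" where e: "range e = J"
    using range_from_nat_into[of J] countable_qword_basis unfolding J_def by blast
  have K: "compact K" unfolding K_def by (rule compact_semialg[OF arch g])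
  have cF: "continuous_on A (F p)" for A p
    unfolding F_def by (rule continuous_on_pairing_weval)
  have "\<exists>B. (\<forall>x\<in>S. \<bar>x p\<bar> \<le> B) \<and> (\<forall>a\<in>K. \<bar>F p a\<bar> \<le> B)" for p
  proof -
    obtain B where B: "\<And>x. x \<in> S \<Longrightarrow> \<bar>x p\<bar> \<le> B"
      using state_bound[OF arch g] unfolding S_def by blast
    have "bounded (F p ` K)" by (intro compact_imp_bounded compact_continuous_image cF K)
    then obtain B' where "\<And>a. a \<in> K \<Longrightarrow> \<bar>F p a\<bar> \<le> B'" by (auto simp: bounded_iff)
    with B show ?thesis by (intro exI[of _ "max B B'"]) (auto simp: le_max_iff_disj)
  qed
  then obtain B where B: "\<And>x p. x \<in> S \<Longrightarrow> \<bar>x p\<bar> \<le> B p" "\<And>a p. a \<in> K \<Longrightarrow> \<bar>F p a\<bar> \<le> B p"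
    by metis
  have "\<exists>Z. (\<forall>n. Z n \<in> mixtures K F) \<and> (\<forall>k. (\<lambda>n. Z n (e k)) \<longlonglongrightarrow> L (e k))"
  proof (rule approximation_by_mixtures[of S B K F e L])
    show "compact S" unfolding S_def by (rule compact_states[OF state_bound[OF arch g]])
    show "L \<in> S" using L by (simp add: S_def)
    show "x \<in> mixtures K F" if "extreme_in S x" for x
      using extreme_state_mixture[OF arch g] that unfolding S_def K_def F_def by blast
    show "x = z" if xz: "x \<in> S" "z \<in> S" "\<And>k. x (e k) = z (e k)" for x z
    proof
      fix p
      have lin: "linear x" "linear z" using xz by (auto simp: S_def states_def pos_cone_def)
      have "x (Poly_Mapping.single w u) = z (Poly_Mapping.single w u)" if "u \<in> Basis" for w u
      proof -
        have "Poly_Mapping.single w u \<in> range e" using that by (auto simp: e J_def)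
        then show ?thesis using xz(3) by auto
      qed
      then show "x p = z p"
        unfolding linear_functional_eq_pairing[OF lin(1), of p] linear_functional_eq_pairing[OF lin(2), of p]
        by simp
    qed
  qed (use B in auto)
  then obtain Z where Z: "\<And>n. Z n \<in> mixtures K F" "\<And>k. (\<lambda>n. Z n (e k)) \<longlonglongrightarrow> L (e k)" by blast
  have lim: "(\<lambda>n. Z n i) \<longlonglongrightarrow> L i" if "i \<in> J" for i
    using that Z(2) unfolding e[symmetric] by auto
  from measure_from_mixtures[where J = J and y = L, OF K cF Z(1) lim]
  obtain \<mu> where \<mu>: "sets \<mu> = sets borel" "AE a in \<mu>. a \<in> K"
    "\<And>i. i \<in> J \<Longrightarrow> has_bochner_integral \<mu> (F i) (L i)"
    by auto
  have "has_bochner_integral \<mu> (\<lambda>a. inner u (weval a w)) (L (Poly_Mapping.single w u))" if "u \<in> Basis" for w u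
    using \<mu>(3)[of "Poly_Mapping.single w u"] that by (auto simp: F_def[abs_def] J_def)
  with \<mu> show ?thesis unfolding K_def by blast
qed

lemma quat_components_Basis:
  assumes "c \<in> {Qre, Qi, Qj, Qk}" shows "\<exists>u\<in>Basis. c = inner u"
proof -
  have "Qre = inner (Quat 1 0 0 0)" "Qi = inner (Quat 0 1 0 0)" "Qj = inner (Quat 0 0 1 0)"
    "Qk = inner (Quat 0 0 0 1)"
    by (simp_all add: fun_eq_iff inner_quat_def)
  with assms show ?thesis by (auto simp: Basis_quat_def)
qed

text \<open>\<open>L 1\<close> is the real part of \<open>y 0\<close>, the mass of the measure.
  Division by it gives a state, and a constant density restores it; if it is 0, then Cauchy-Schwarz
  forces \<open>y\<close> to vanish and the null measure serves.\<close>

theorem moment_conditions_imp_represents: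
  fixes g h :: "nat \<Rightarrow> 'n::finite rpoly"
  assumes arch: "archimedean m g l h" and g: "\<And>i. i \<in> {1..m} \<Longrightarrow> star (g i) = g i"
    and y: "moment_conditions m g l h y" "\<And>w. y w = star (y (star w))"
  shows "\<exists>\<mu>. represents \<mu> y (semialg m g l h)"
proof -
  define L where "L = pairing y"
  have cone: "L \<in> qcone m g l h" unfolding L_def by (rule pairing_in_qcone[OF y])
  interpret positive_functional L by (rule pos_cone_positive_functional[OF cone])
  show ?thesis
  proof (cases "L 1 = 0")
    case True
    have "inner u (y w) = 0" for u w
      using square_le[of "Poly_Mapping.single w u"] True by (simp add: L_def)
    then have "y w = 0" for w by (metis inner_eq_zero_iff)
    moreover have AE_null: "AE a in null_measure borel. P a" for P :: "quat ^ 'n \<Rightarrow> bool"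
      by (rule AE_I[of _ _ UNIV]) auto
    moreover have "has_bochner_integral (null_measure borel) (\<lambda>a. c (weval a w)) (0::real)"
      if "c \<in> {Qre, Qi, Qj, Qk}" for c and w :: "'n qword"
    proof -
      have "(\<lambda>a. c (weval a w)) \<in> borel_measurable (null_measure borel)"
        using weval_component_measurable[OF that] by (simp add: measurable_def)
      then show ?thesis
        by (subst has_bochner_integral_cong_AE[where g = "\<lambda>_. 0"])
          (auto intro: AE_null has_bochner_integral_zero)
    qed
    ultimately have "represents (null_measure borel) y (semialg m g l h)"
      by (auto simp: represents_def)
    then show ?thesis by blast
  next
    case False
    then have pos: "L 1 > 0" using L_one_nonneg by simp
    define L' where "L' p = L p / L 1" for p
    have "linear L'" unfolding L'_def by (intro linearI) (simp_all add: L_simps add_divide_distrib)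
    then have "L' \<in> states (nonneg_constraints m g) (null_constraints l h)"
      using cone pos unfolding states_def pos_cone_def L'_def null_elems_def by auto
    from state_representing_measure[OF arch g this]
    obtain \<mu> where \<mu>: "sets \<mu> = sets borel" "AE a in \<mu>. a \<in> semialg m g l h"
      "\<And>w u. u \<in> Basis \<Longrightarrow> has_bochner_integral \<mu> (\<lambda>a. inner u (weval a w)) (inner u (y w) / L 1)"
      unfolding L'_def L_def by auto
    define \<nu> where "\<nu> = density \<mu> (\<lambda>_. ennreal (L 1))"
    have "has_bochner_integral \<nu> (\<lambda>a. c (weval a w)) (c (y w))" if c: "c \<in> {Qre, Qi, Qj, Qk}" for c w
    proof -
      obtain u where u: "u \<in> Basis" "c = inner u" using quat_components_Basis[OF c] by blast
      have "has_bochner_integral \<mu> (\<lambda>a. L 1 *\<^sub>R inner u (weval a w)) (L 1 *\<^sub>R (inner u (y w) / L 1))"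
        by (intro has_bochner_integral_scaleR_right \<mu>(3) u)
      then show ?thesis
        unfolding \<nu>_def u(2) using pos \<mu>(3)[OF u(1), of w]
        by (intro has_bochner_integral_density) (auto simp: has_bochner_integral_iff)
    qed
    moreover have "AE a in \<nu>. a \<in> semialg m g l h"
      unfolding \<nu>_def using \<mu>(2) by (subst AE_density) auto
    moreover have "sets \<nu> = sets borel" using \<mu>(1) by (simp add: \<nu>_def)
    ultimately have "represents \<nu> y (semialg m g l h)"
      by (simp add: represents_def)
    then show ?thesis by blast
  qed
qed

theorem corollary5p9:
  fixes g h :: "nat \<Rightarrow> 'n::finite rpoly" and m l :: nat and y :: "'n qword \<Rightarrow> quat"
  assumes "\<And>i. i \<in> {1..m} \<Longrightarrow> star (g i) = g i"
    and "archimedean m g l h"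
    and "pseudo_moment y"
  shows "(\<exists>\<mu>. represents \<mu> y (semialg m g l h)) \<longleftrightarrow>
    (\<forall>d. quat_psd (words_upto d) (moment_matrix y)) \<and>
    (\<forall>d. \<forall>i\<in>{1..m}. quat_psd (words_upto d) (localizing_matrix (g i) y)) \<and>
    (\<forall>u v. \<forall>j\<in>{1..l}. riesz y (mon u * h j * mon v) = 0) \<and>
    (\<forall>u v w i. riesz y (mon u * commutator (mon w + mon (star w)) (mon (lword (Lq i))) * mon v) = 0)"
proof -
  have herm: "y w = star (y (star w))" for w
    using assms(3) unfolding pseudo_moment_def by blast
  have "(\<exists>\<mu>. represents \<mu> y (semialg m g l h)) \<longleftrightarrow> moment_conditions m g l h y"
  proof
    assume "moment_conditions m g l h y"
    from moment_conditions_imp_represents[OF assms(2) _ this herm] assms(1)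
    show "\<exists>\<mu>. represents \<mu> y (semialg m g l h)" by blast
  qed (auto intro: represents_moment_conditions)
  then show ?thesis unfolding moment_conditions_def .
qed


end
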